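(* Over $\mathbb{Q}$, the Schur algebra $S(n,d)$ is isomorphic with the associative algebra (with $1$) on the generators $e_i, f_i$ ($1\le i\le n-1$) and $H_i$ ($1\le i\le n$) with relations (R1) $H_iH_j=H_jH_i$; (R2) $e_if_j-f_je_i=\delta_{ij}(H_j-H_{j+1})$; (R3) $H_ie_j-e_jH_i=(\varepsilon_i,\alpha_j)e_j$, $\;H_if_j-f_jH_i=-(\varepsilon_i,\alpha_j)f_j$; (R4) $e_i^2e_j-2e_ie_je_i+e_je_i^2=0$ if $|i-j|=1$, and $e_ie_j-e_je_i=0$ otherwise; (R5) $f_i^2f_j-2f_if_jf_i+f_jf_i^2=0$ if $|i-j|=1$, and $f_if_j-f_jf_i=0$ otherwise; (R6) $H_1+H_2+\cdots+H_n=d$; (R7) $H_i(H_i-1)\cdots(H_i-d)=0$; where the indices range over all values for which the expressions make sense.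
   Context: $n\ge 1$ and $d\ge 0$ are fixed integers. $V$ is an $n$-dimensional $\mathbb{Q}$-vector space; the symmetric group $\Sigma_d$ acts on $V^{\otimes d}$ by permuting tensor places, and $S(n,d)=\operatorname{End}_{\Sigma_d}(V^{\otimes d})$ is the Schur algebra over $\mathbb{Q}$. (By Schur, it equals the image of the representation $U(\mathfrak{gl}_n)\to\operatorname{End}(V^{\otimes d})$ obtained by letting $\mathfrak{gl}_n$ act on $V^{\otimes d}$ by derivations.) $\varepsilon_1,\dots,\varepsilon_n$ is the standard orthonormal basis of $\mathbb{R}^n$ with inner product $(\ ,\ )$, and $\alpha_j=\varepsilon_j-\varepsilon_{j+1}$ for $1\le j\le n-1$. *)

theory Defs
  imports
    Complex_Main
    "HOL-Library.Poly_Mapping"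
    "HOL-Combinatorics.Permutations"
    "HOL-Algebra.QuotRing"
    "HOL-Algebra.Module"
begin

text \<open>
  Associative unital \<open>\<rat>\<close>-algebras are represented by records of type \<^typ>\<open>(rat, 'a) module\<close>,
  i.e. a ring record extended by a scalar multiplication, as in \<^theory>\<open>HOL-Algebra.Module\<close>.
  (The locale \<^locale>\<open>algebra\<close> itself is not used: it requires commutativity.)
\<close>

definition algebra_isomorphic :: "('k, 'a) module \<Rightarrow> ('k, 'b) module \<Rightarrow> bool"
  where "algebra_isomorphic A B \<longleftrightarrow>
    (\<exists>h \<in> ring_iso A B. \<forall>c. \<forall>x \<in> carrier A. h (c \<odot>\<^bsub>A\<^esub> x) = c \<odot>\<^bsub>B\<^esub> h x)"

text \<open>Scalar multiplication on cosets, in the style of \<^const>\<open>rcoset_mult\<close>.\<close>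

definition rcoset_smult :: "('k, 'a) module \<Rightarrow> 'a set \<Rightarrow> 'k \<Rightarrow> 'a set \<Rightarrow> 'a set"
  where "rcoset_smult M N c A = (\<Union>a\<in>A. N +>\<^bsub>M\<^esub> (c \<odot>\<^bsub>M\<^esub> a))"

definition quotient_algebra :: "('k, 'a) module \<Rightarrow> 'a set \<Rightarrow> ('k, 'a set) module"
  where "quotient_algebra A I = ring.extend (A Quot I) (module.fields (rcoset_smult A I))"

text \<open>For records that stand for mere modules, the two multiplicative fields are irrelevant.\<close>

definition quotient_module :: "('k, 'a) module \<Rightarrow> 'a set \<Rightarrow> ('k, 'a set) module"
  where "quotient_module M N =
    \<lparr>carrier = a_rcosets\<^bsub>M\<^esub> N, monoid.mult = undefined, one = undefined,
     zero = N, add = set_add M, smult = rcoset_smult M N\<rparr>"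


section \<open>Free vector spaces, tensor powers and the Schur algebra\<close>

definition pm_scale :: "rat \<Rightarrow> ('x \<Rightarrow>\<^sub>0 rat) \<Rightarrow> ('x \<Rightarrow>\<^sub>0 rat)"
  where "pm_scale c p = Poly_Mapping.map (\<lambda>a. c * a) p"

lemma lookup_pm_scale [simp]: "Poly_Mapping.lookup (pm_scale c p) x = c * Poly_Mapping.lookup p x"
  by (simp add: pm_scale_def Poly_Mapping.map.rep_eq when_def)

interpretation pm: vector_space "pm_scale :: rat \<Rightarrow> ('x \<Rightarrow>\<^sub>0 rat) \<Rightarrow> _"
  by unfold_locales (auto intro!: poly_mapping_eqI simp: lookup_add algebra_simps)

definition free_module :: "'x set \<Rightarrow> (rat, 'x \<Rightarrow>\<^sub>0 rat) module"
  where "free_module X =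
    \<lparr>carrier = {p. Poly_Mapping.keys p \<subseteq> X}, monoid.mult = undefined, one = undefined,
     zero = 0, add = (+), smult = pm_scale\<rparr>"

text \<open>
  The \<open>d\<close>-th tensor power of the vector space \<open>V = (UNIV :: 'v set)\<close> with scalar multiplication
  \<open>scale\<close>: the free vector space on \<open>V\<^sup>d\<close> (lists of length \<open>d\<close>) modulo the subspace
  spanned by the multilinearity relations.
\<close>

definition multilinear_relations ::
    "(rat \<Rightarrow> 'v \<Rightarrow> 'v) \<Rightarrow> nat \<Rightarrow> ('v::ab_group_add list \<Rightarrow>\<^sub>0 rat) set"
  where "multilinear_relations scale d =
    {Poly_Mapping.single (xs[i := u + v]) 1
       - Poly_Mapping.single (xs[i := u]) 1 - Poly_Mapping.single (xs[i := v]) 1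
     | xs i u v. length xs = d \<and> i < d} \<union>
    {Poly_Mapping.single (xs[i := scale c u]) 1
       - pm_scale c (Poly_Mapping.single (xs[i := u]) 1)
     | xs i c u. length xs = d \<and> i < d}"

definition tensor_power ::
    "(rat \<Rightarrow> 'v \<Rightarrow> 'v) \<Rightarrow> nat \<Rightarrow> (rat, ('v::ab_group_add list \<Rightarrow>\<^sub>0 rat) set) module"
  where "tensor_power scale d =
    quotient_module (free_module {xs. length xs = d}) (pm.span (multilinear_relations scale d))"

text \<open>
  The place permutation
  \<open>v\<^sub>0 \<otimes> \<dots> \<otimes> v\<^sub>d\<^sub>-\<^sub>1 \<mapsto> v\<^bsub>\<sigma> 0\<^esub> \<otimes> \<dots> \<otimes> v\<^bsub>\<sigma> (d-1)\<^esub>\<close>.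
  Linear extension to the free vector space maps the subspace of multilinearity relations onto
  itself, so on cosets the induced map is simply the image. (This is a right action of the
  symmetric group; passing to the left action replaces \<open>\<sigma>\<close> by its inverse and does not change
  the commuting endomorphisms.)
\<close>

definition free_place_perm :: "(nat \<Rightarrow> nat) \<Rightarrow> ('v list \<Rightarrow>\<^sub>0 rat) \<Rightarrow> ('v list \<Rightarrow>\<^sub>0 rat)"
  where "free_place_perm \<sigma> p =
    (\<Sum>xs\<in>Poly_Mapping.keys p.
       Poly_Mapping.single (permute_list \<sigma> xs) (Poly_Mapping.lookup p xs))"

definition place_perm :: "(nat \<Rightarrow> nat) \<Rightarrow> ('v list \<Rightarrow>\<^sub>0 rat) set \<Rightarrow> ('v list \<Rightarrow>\<^sub>0 rat) set"
  where "place_perm \<sigma> t = free_place_perm \<sigma> ` t"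

text \<open>
  Endomorphisms are extensional functions on the carrier, so that function equality is
  equality of endomorphisms.
\<close>

definition linear_endos :: "('k, 'a) module \<Rightarrow> ('a \<Rightarrow> 'a) set"
  where "linear_endos M =
    {f \<in> carrier M \<rightarrow>\<^sub>E carrier M.
      (\<forall>x \<in> carrier M. \<forall>y \<in> carrier M. f (x \<oplus>\<^bsub>M\<^esub> y) = f x \<oplus>\<^bsub>M\<^esub> f y) \<and>
      (\<forall>c. \<forall>x \<in> carrier M. f (c \<odot>\<^bsub>M\<^esub> x) = c \<odot>\<^bsub>M\<^esub> f x)}"

definition schur_algebra ::
    "(rat \<Rightarrow> 'v \<Rightarrow> 'v) \<Rightarrow> nat \<Rightarrow>
     (rat, ('v::ab_group_add list \<Rightarrow>\<^sub>0 rat) set \<Rightarrow> ('v list \<Rightarrow>\<^sub>0 rat) set) module"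
  where "schur_algebra scale d =
    (let T = tensor_power scale d in
      \<lparr>carrier = {f \<in> linear_endos T.
         \<forall>\<sigma>. \<sigma> permutes {..<d} \<longrightarrow>
           (\<forall>t \<in> carrier T. f (place_perm \<sigma> t) = place_perm \<sigma> (f t))},
       monoid.mult = (\<lambda>f g. compose (carrier T) f g),
       one = (\<lambda>t \<in> carrier T. t),
       zero = (\<lambda>t \<in> carrier T. \<zero>\<^bsub>T\<^esub>),
       add = (\<lambda>f g. \<lambda>t \<in> carrier T. f t \<oplus>\<^bsub>T\<^esub> g t),
       smult = (\<lambda>c f. \<lambda>t \<in> carrier T. c \<odot>\<^bsub>T\<^esub> f t)\<rparr>)"


section \<open>Free associative algebras and presentations\<close>

text \<open>
  The free associative algebra is the monoid algebra of the free monoid; the wrapper around lists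
  makes the convolution product of \<^theory>\<open>HOL-Library.Poly_Mapping\<close> available.
\<close>

datatype 'g word = Word (letters: "'g list")

instantiation word :: (type) monoid_add
begin

definition zero_word :: "'a word" where "0 = Word []"

definition plus_word :: "'a word \<Rightarrow> 'a word \<Rightarrow> 'a word"
  where "u + v = Word (letters u @ letters v)"

instance
  by standard (simp_all add: zero_word_def plus_word_def)

end

definition free_algebra :: "'g set \<Rightarrow> (rat, 'g word \<Rightarrow>\<^sub>0 rat) module"
  where "free_algebra G =
    \<lparr>carrier = {p. \<forall>w \<in> Poly_Mapping.keys p. set (letters w) \<subseteq> G}, monoid.mult = (*), one = 1,
     zero = 0, add = (+), smult = pm_scale\<rparr>"

definition gen :: "'g \<Rightarrow> ('g word \<Rightarrow>\<^sub>0 rat)"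
  where "gen g = Poly_Mapping.single (Word [g]) 1"

text \<open>\<^const>\<open>genideal\<close> is the two-sided ideal generated by a set.\<close>

definition presented_algebra ::
    "'g set \<Rightarrow> ('g word \<Rightarrow>\<^sub>0 rat) set \<Rightarrow> (rat, ('g word \<Rightarrow>\<^sub>0 rat) set) module"
  where "presented_algebra G R = quotient_algebra (free_algebra G) (Idl\<^bsub>free_algebra G\<^esub> R)"

lemma free_algebra_ring: "ring (free_algebra G)"
proof (rule ringI)
  show "abelian_group (free_algebra G)"
  proof (rule abelian_groupI)
    fix x assume "x \<in> carrier (free_algebra G)"
    then show "\<exists>y\<in>carrier (free_algebra G). y \<oplus>\<^bsub>free_algebra G\<^esub> x = \<zero>\<^bsub>free_algebra G\<^esub>"
      by (intro bexI[of _ "- x"]) (auto simp: free_algebra_def in_keys_iff)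
  qed (use Poly_Mapping.keys_add in \<open>fastforce simp: free_algebra_def algebra_simps\<close>)+
  show "monoid (free_algebra G)"
  proof (rule monoidI)
    fix x y assume "x \<in> carrier (free_algebra G)" "y \<in> carrier (free_algebra G)"
    then show "x \<otimes>\<^bsub>free_algebra G\<^esub> y \<in> carrier (free_algebra G)"
      using keys_mult[of x y] by (fastforce simp: free_algebra_def plus_word_def)
  qed (auto simp: free_algebra_def algebra_simps zero_word_def)
qed (auto simp: free_algebra_def algebra_simps)


section \<open>The generators and relations\<close>

datatype generator = E nat | F nat | H nat

definition schur_generators :: "nat \<Rightarrow> generator set"
  where "schur_generators n = E ` {1..<n} \<union> F ` {1..<n} \<union> H ` {1..n}"

text \<open>
  All the vectors involved lie in the lattice \<open>\<int>\<^sup>n\<close> of the Euclidean space \<open>\<real>\<^sup>n\<close>, so the inner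
  products are computed with integer coordinates, indexed by \<open>{1..n}\<close>.
\<close>

definition eps :: "nat \<Rightarrow> nat \<Rightarrow> int"
  where "eps i = (\<lambda>k. if k = i then 1 else 0)"

definition alpha :: "nat \<Rightarrow> nat \<Rightarrow> int"
  where "alpha j = (\<lambda>k. eps j k - eps (j + 1) k)"

definition inner_prod :: "nat \<Rightarrow> (nat \<Rightarrow> int) \<Rightarrow> (nat \<Rightarrow> int) \<Rightarrow> int"
  where "inner_prod n x y = (\<Sum>k = 1..n. x k * y k)"

text \<open>Each relation \<open>l = r\<close> is represented by the element \<open>l - r\<close> of the free algebra.\<close>

definition schur_relations :: "nat \<Rightarrow> nat \<Rightarrow> (generator word \<Rightarrow>\<^sub>0 rat) set"
  where "schur_relations n d =
    (let e = (\<lambda>i. gen (E i)); f = (\<lambda>i. gen (F i)); h = (\<lambda>i. gen (H i)) in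
     {h i * h j - h j * h i | i j. i \<in> {1..n} \<and> j \<in> {1..n}} \<union>
     {e i * f j - f j * e i - (if i = j then h j - h (j + 1) else 0)
      | i j. i \<in> {1..<n} \<and> j \<in> {1..<n}} \<union>
     {h i * e j - e j * h i - of_int (inner_prod n (eps i) (alpha j)) * e j
      | i j. i \<in> {1..n} \<and> j \<in> {1..<n}} \<union>
     {h i * f j - f j * h i + of_int (inner_prod n (eps i) (alpha j)) * f j
      | i j. i \<in> {1..n} \<and> j \<in> {1..<n}} \<union>
     {(e i)^2 * e j - 2 * e i * e j * e i + e j * (e i)^2
      | i j. i \<in> {1..<n} \<and> j \<in> {1..<n} \<and> \<bar>int i - int j\<bar> = 1} \<union>
     {e i * e j - e j * e i
      | i j. i \<in> {1..<n} \<and> j \<in> {1..<n} \<and> \<bar>int i - int j\<bar> \<noteq> 1} \<union>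
     {(f i)^2 * f j - 2 * f i * f j * f i + f j * (f i)^2
      | i j. i \<in> {1..<n} \<and> j \<in> {1..<n} \<and> \<bar>int i - int j\<bar> = 1} \<union>
     {f i * f j - f j * f i
      | i j. i \<in> {1..<n} \<and> j \<in> {1..<n} \<and> \<bar>int i - int j\<bar> \<noteq> 1} \<union>
     {(\<Sum>i = 1..n. h i) - of_nat d} \<union>
     {prod_list (map (\<lambda>k. h i - of_nat k) [0..<d + 1]) | i. i \<in> {1..n}})"

end

theory Submission
  imports Defs
begin

text \<open>
  The Serre relations turn the generators into matrix units \<open>X\<^sub>i\<^sub>j\<close> satisfying the relations of
  \<open>\<gg>\<ll>\<^sub>n\<close>. For a multiset \<open>Z\<close> of index pairs let \<open>N(Z)\<close> be the normally ordered product, so that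
  \<open>X\<^sub>i\<^sub>j N(Z) = N(Z + (i, j)) + \<dots>\<close>, where the remaining terms arise from \<open>Z\<close> by replacing a row
  index \<open>j\<close> by \<open>i\<close>. The relation (R7) kills \<open>N\<close> of \<open>d + 1\<close> copies of \<open>(i, i)\<close>, hence \<open>N(Z)\<close> whenever
  some column occurs more than \<open>d\<close> times; with (R6), which gives
  \<open>\<Sum>\<^sub>i N(Z + (i, i)) = (d - |Z|) N(Z)\<close>, and the pigeonhole principle it follows that \<open>N(Z) = 0\<close> for
  \<open>|Z| > d\<close>, and then that the \<open>N(Z)\<close> with \<open>|Z| = d\<close> span the presented algebra. On
  \<open>V\<^bsup>\<otimes>d\<^esup>\<close> these elements act as nonzero multiples of the orbit sums of matrix units, which form a
  basis of the endomorphisms commuting with the place permutations.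
\<close>

section \<open>From the Serre relations to matrix units\<close>

text \<open>No PBW theorem and no dimension count is used. The span of the products of size
  \<open>d\<close> contains the unit and is stable under left multiplication by the generators, so
  it is everything. Independence is read off matrix entries: in degree \<open>d\<close> the entry at
  a pair of words sees exactly one product, the one formed by the pairs of letters in equal places.
  Hence the ideal of relations is the full kernel of the action, and dividing entries by the nonzero
  multiplicity factors writes every commuting endomorphism as a combination of these products;
  Schur's surjectivity is thereby proved, not assumed. The main obstacle is that (R7) bounds only
  powers of one diagonal generator. Passing from there to a whole column rests on -1 not being among
  the roots 0, ..., d. The presented algebra is a carrier record of cosets, whereas the computations
  take place in a type of rings without unit; this is why the unit occurs as an explicit element
  \<open>u\<close> and scalars act separately.\<close>

definition bracket :: "'a::ring \<Rightarrow> 'a \<Rightarrow> 'a"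
  where "bracket x y = x * y - y * x"

lemma bracket_zero [simp]: "bracket 0 x = 0" "bracket x 0 = 0" "bracket x x = 0"
  by (simp_all add: bracket_def)

lemma bracket_linear [simp]:
  "bracket (x + y) z = bracket x z + bracket y z" "bracket z (x + y) = bracket z x + bracket z y"
  "bracket (x - y) z = bracket x z - bracket y z" "bracket z (x - y) = bracket z x - bracket z y"
  "bracket (- x) z = - bracket x z" "bracket z (- x) = - bracket z x"
  by (simp_all add: bracket_def algebra_simps)

lemma bracket_if:
  "bracket x (if P then y else z) = (if P then bracket x y else bracket x z)"
  by simp

lemma bracket_anti: "bracket x y = - bracket y x"
  by (simp add: bracket_def)

lemma jacobi: "bracket x (bracket y z) = bracket (bracket x y) z + bracket y (bracket x z)"
  by (simp add: bracket_def algebra_simps)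

lemma jacobi': "bracket (bracket x y) z = bracket x (bracket y z) - bracket y (bracket x z)"
  by (simp add: bracket_def algebra_simps)

section \<open>Root vectors of type A as iterated brackets\<close>

primrec up :: "(nat \<Rightarrow> 'a::ring) \<Rightarrow> nat \<Rightarrow> nat \<Rightarrow> 'a" where
  "up e i 0 = e i"
| "up e i (Suc k) = bracket (up e i k) (e (i + k + 1))"

text \<open>For \<open>i < j\<close> this is the root vector with row \<open>i\<close> and column
  \<open>j\<close>. Truncated subtraction gives the junk value \<open>e i\<close> when
  \<open>j \<le> i\<close>, so the lemmas carry the order of the indices as a hypothesis.\<close>

definition upper :: "(nat \<Rightarrow> 'a::ring) \<Rightarrow> nat \<Rightarrow> nat \<Rightarrow> 'a"
  where "upper e i j = up e i (j - i - 1)"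

lemma upper_Suc_self [simp]: "upper e i (Suc i) = e i"
  by (simp add: upper_def)

lemma upper_Suc: "i < j \<Longrightarrow> upper e i (Suc j) = bracket (upper e i j) (e j)"
proof -
  assume "i < j"
  then obtain k where "j = Suc (i + k)"
    using less_imp_Suc_add by blast
  then show ?thesis
    by (simp add: upper_def)
qed

text \<open>One triangular half of the presentation on its own, so that it applies to
  \<open>e\<close> and, through the Chevalley involution, to the negated \<open>f\<close>. The
  condition \<open>no_2_torsion\<close> stands in for division by 2, as the ring carries no scalars
  here.\<close>

locale serre_relations =
  fixes e :: "nat \<Rightarrow> 'a::ring" and n :: nat
  assumes serre: "\<And>i j. i \<in> {1..<n} \<Longrightarrow> j \<in> {1..<n} \<Longrightarrow> j = Suc i \<or> i = Suc j \<Longrightarrow>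
      bracket (e i) (bracket (e i) (e j)) = 0"
    and far: "\<And>i j. i \<in> {1..<n} \<Longrightarrow> j \<in> {1..<n} \<Longrightarrow> j \<noteq> Suc i \<Longrightarrow> i \<noteq> Suc j \<Longrightarrow>
      bracket (e i) (e j) = 0"
    and no_2_torsion: "\<And>x :: 'a. x + x = 0 \<Longrightarrow> x = 0"
begin

abbreviation "U \<equiv> upper e"

lemma far_high:
  assumes "i < j" "1 \<le> i" "j < k" "k < n"
  shows "bracket (e k) (U i j) = 0"
  using assms
proof (induction j)
  case (Suc j)
  show ?case
  proof (cases "i = j")
    case True
    then show ?thesis using far[of k i] Suc.prems by simp
  next
    case False
    then have "i < j" using Suc.prems by simp
    then show ?thesis
      using Suc far[of k j] by (simp add: upper_Suc jacobi)
  qed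
qed simp

lemma far_low:
  assumes "i < j" "1 \<le> k" "Suc k < i" "j \<le> n"
  shows "bracket (e k) (U i j) = 0"
  using assms
proof (induction j)
  case (Suc j)
  show ?case
  proof (cases "i = j")
    case True
    then show ?thesis using far[of k i] Suc.prems by simp
  next
    case False
    then have "i < j" using Suc.prems by simp
    then show ?thesis
      using Suc far[of k j] by (simp add: upper_Suc jacobi)
  qed
qed simp

text \<open>\<open>U k j\<close> is built by adding letters on the right. By Jacobi it can also be
  extended on the left, because \<open>e k\<close> commutes with every letter added after
  \<open>e (Suc k)\<close>.\<close>

lemma extend_low:
  assumes "Suc k < j" "1 \<le> k" "j \<le> n"
  shows "bracket (e k) (U (Suc k) j) = U k j"
  using assms
proof (induction j)
  case (Suc j)
  show ?case
  proof (cases "Suc k = j")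
    case True
    then show ?thesis by (auto simp: upper_Suc)
  next
    case False
    then have "Suc k < j" using Suc.prems by simp
    then show ?thesis
      using Suc far[of k j] by (simp add: upper_Suc jacobi)
  qed
qed simp

lemma upper_concat:
  assumes "i < j" "j < l" "1 \<le> i" "l \<le> n"
  shows "bracket (U i j) (U j l) = U i l"
  using assms
proof (induction l)
  case (Suc l)
  show ?case
  proof (cases "j = l")
    case True
    then show ?thesis using Suc.prems by (auto simp: upper_Suc)
  next
    case False
    then have "j < l" using Suc.prems by simp
    moreover have "bracket (U i j) (e l) = 0"
      using far_high[of i j l] bracket_anti[of "U i j" "e l"] Suc.prems \<open>j < l\<close> by simp
    ultimately show ?thesis
      using Suc by (simp add: upper_Suc jacobi)
  qed
qed simp

text \<open>Split off the piece of two letters, which the Serre relation kills; the remaining piece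
  starts two steps further and commutes with \<open>e i\<close>.\<close>

lemma inner_first:
  assumes "i < j" "1 \<le> i" "j \<le> n"
  shows "bracket (e i) (U i j) = 0"
proof -
  have 2: "bracket (e i) (U i (Suc (Suc i))) = 0" if "Suc i < n"
    using that assms serre[of i "Suc i"] by (simp add: upper_Suc)
  consider "j = Suc i" | "j = Suc (Suc i)" | "Suc (Suc i) < j"
    using assms by linarith
  then show ?thesis
  proof cases
    case 3
    then have "U i j = bracket (U i (Suc (Suc i))) (U (Suc (Suc i)) j)"
      using assms by (simp add: upper_concat)
    then show ?thesis
      using 3 2 assms far_low[of "Suc (Suc i)" j i] by (simp add: jacobi)
  qed (use 2 assms in auto)
qed

lemma inner_last:
  assumes "i < j" "1 \<le> i" "j < n"
  shows "bracket (e j) (U i (Suc j)) = 0"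
proof (cases "j = Suc i")
  case True
  have "bracket (e j) (bracket (e i) (e j)) = - bracket (e j) (bracket (e j) (e i))"
    using bracket_anti[of "e i" "e j"] by simp
  then show ?thesis
    using True assms serre[of j i] by (simp add: upper_Suc)
next
  case False
  obtain k where k: "j = Suc k"
    using assms by (cases j) auto
  have "bracket (e j) (bracket (e k) (e j)) = - bracket (e j) (bracket (e j) (e k))"
    using bracket_anti[of "e k" "e j"] by simp
  then have "bracket (e j) (U k (Suc j)) = 0"
    using k False assms serre[of j k] by (simp add: upper_Suc)
  moreover have "U i (Suc j) = bracket (U i k) (U k (Suc j))"
    using k False assms by (simp add: upper_concat)
  ultimately show ?thesis
    using k False assms far_high[of i k j] by (simp add: jacobi)
qed

text \<open>Expanding the bracket in two ways gives the same element with opposite signs.\<close>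

lemma inner_core:
  assumes "1 \<le> k" "Suc (Suc k) < n"
  shows "bracket (e (Suc k)) (U k (Suc (Suc (Suc k)))) = 0"
proof -
  let ?a = "U k (Suc (Suc k))" and ?b = "U (Suc k) (Suc (Suc (Suc k)))" and ?c = "e (Suc k)"
  let ?x = "bracket ?c (U k (Suc (Suc (Suc k))))"
  have a: "bracket ?c ?a = 0"
    using inner_last[of k "Suc k"] assms by simp
  have b: "bracket ?c ?b = 0"
    using inner_first[of "Suc k" "Suc (Suc (Suc k))"] assms by simp
  have "?x = bracket ?c (bracket ?a (e (Suc (Suc k))))"
    by (simp add: upper_Suc)
  also have "\<dots> = bracket ?a ?b"
    using a by (subst jacobi) (simp add: upper_Suc)
  finally have 1: "?x = bracket ?a ?b" .
  have "?x = bracket ?c (bracket (e k) ?b)"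
    using extend_low[of k "Suc (Suc (Suc k))"] assms by simp
  also have "\<dots> = bracket (bracket ?c (e k)) ?b"
    using b by (subst jacobi) simp
  also have "\<dots> = - bracket ?a ?b"
    using bracket_anti[of ?c "e k"] by (simp add: upper_Suc)
  finally have "?x = - bracket ?a ?b" .
  with 1 have "?x + ?x = 0"
    by (metis add.right_inverse)
  then show ?thesis
    by (rule no_2_torsion)
qed

text \<open>An interior \<open>e k\<close> interacts only with the window of three letters centred
  at \<open>k\<close>, which \<open>inner_core\<close> settles. The pieces to the left and to the
  right of the window commute with \<open>e k\<close>.\<close>

lemma inner_zero:
  assumes "i \<le> k" "k < j" "1 \<le> i" "j \<le> n"
  shows "bracket (e k) (U i j) = 0"
proof -
  consider "k = i" | "j = Suc k" "i < k" | "i < k" "Suc k < j"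
    using assms by linarith
  then show ?thesis
  proof cases
    case 3
    obtain m where m: "k = Suc m"
      using 3 by (cases k) auto
    have "bracket (e k) (U m (Suc (Suc k))) = 0"
      using m 3 assms inner_core[of m] by simp
    moreover have "U m j = (if j = Suc (Suc k) then U m (Suc (Suc k))
        else bracket (U m (Suc (Suc k))) (U (Suc (Suc k)) j))"
      using m 3 assms by (auto simp: upper_concat)
    moreover have "bracket (e k) (U (Suc (Suc k)) j) = 0" if "j \<noteq> Suc (Suc k)"
      using that 3 assms far_low[of "Suc (Suc k)" j k] by simp
    ultimately have "bracket (e k) (U m j) = 0"
      by (simp add: jacobi split: if_splits)
    moreover have "U i j = (if i = m then U m j else bracket (U i m) (U m j))"
      using m 3 assms by (auto simp: upper_concat)
    moreover have "bracket (e k) (U i m) = 0" if "i \<noteq> m"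
      using that m 3 assms far_high[of i m k] by simp
    ultimately show ?thesis
      by (simp add: jacobi split: if_splits)
  qed (use assms inner_first inner_last in auto)
qed

lemma bracket_simple_upper:
  assumes "i < j" "1 \<le> i" "j \<le> n" "1 \<le> k" "k < n"
  shows "bracket (e k) (U i j) = (if Suc k = i then U k j else 0) - (if k = j then U i (Suc k) else 0)"
proof -
  consider "Suc k < i" | "Suc k = i" | "i \<le> k" "k < j" | "k = j" | "j < k"
    by linarith
  then show ?thesis
  proof cases
    case 4
    then show ?thesis
      using bracket_anti[of "e k" "U i j"] assms by (simp add: upper_Suc)
  qed (use assms extend_low far_low far_high inner_zero in auto)
qed

end

section \<open>Matrix units and their commutation relations\<close>

definition gl_unit :: "(nat \<Rightarrow> 'a::ring) \<Rightarrow> (nat \<Rightarrow> 'a) \<Rightarrow> (nat \<Rightarrow> 'a) \<Rightarrow> nat \<Rightarrow> nat \<Rightarrow> 'a"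
  where "gl_unit e f h i j =
    (if i < j then upper e i j else if i = j then h i else - upper (\<lambda>k. - f k) j i)"

lemma gl_unit_Suc [simp]:
  "gl_unit e f h i (Suc i) = e i" "gl_unit e f h (Suc i) i = f i" "gl_unit e f h i i = h i"
  by (simp_all add: gl_unit_def)

text \<open>The part of the presentation that does not involve \<open>d\<close>, namely (R1) to
  (R5), in bracket form and with the inner products evaluated. In this form it is visibly symmetric
  under the Chevalley involution.\<close>

locale gl_presentation =
  fixes e f h :: "nat \<Rightarrow> 'a::ring" and n :: nat
  assumes h_h: "\<And>i j. i \<in> {1..n} \<Longrightarrow> j \<in> {1..n} \<Longrightarrow> bracket (h i) (h j) = 0"
    and e_f: "\<And>i j. i \<in> {1..<n} \<Longrightarrow> j \<in> {1..<n} \<Longrightarrow>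
      bracket (e i) (f j) = (if i = j then h j - h (Suc j) else 0)"
    and h_e: "\<And>i j. i \<in> {1..n} \<Longrightarrow> j \<in> {1..<n} \<Longrightarrow>
      bracket (h i) (e j) = (if i = j then e j else if i = Suc j then - e j else 0)"
    and h_f: "\<And>i j. i \<in> {1..n} \<Longrightarrow> j \<in> {1..<n} \<Longrightarrow>
      bracket (h i) (f j) = (if i = j then - f j else if i = Suc j then f j else 0)"
    and serre_e: "\<And>i j. i \<in> {1..<n} \<Longrightarrow> j \<in> {1..<n} \<Longrightarrow> j = Suc i \<or> i = Suc j \<Longrightarrow>
      bracket (e i) (bracket (e i) (e j)) = 0"
    and far_e: "\<And>i j. i \<in> {1..<n} \<Longrightarrow> j \<in> {1..<n} \<Longrightarrow> j \<noteq> Suc i \<Longrightarrow> i \<noteq> Suc j \<Longrightarrow>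
      bracket (e i) (e j) = 0"
    and serre_f: "\<And>i j. i \<in> {1..<n} \<Longrightarrow> j \<in> {1..<n} \<Longrightarrow> j = Suc i \<or> i = Suc j \<Longrightarrow>
      bracket (f i) (bracket (f i) (f j)) = 0"
    and far_f: "\<And>i j. i \<in> {1..<n} \<Longrightarrow> j \<in> {1..<n} \<Longrightarrow> j \<noteq> Suc i \<Longrightarrow> i \<noteq> Suc j \<Longrightarrow>
      bracket (f i) (f j) = 0"
    and no_2_torsion: "\<And>x :: 'a. x + x = 0 \<Longrightarrow> x = 0"
begin

sublocale serre_relations e n
  using serre_e far_e no_2_torsion by unfold_locales

abbreviation "X \<equiv> gl_unit e f h"

text \<open>The Chevalley involution exchanges the roles of \<open>e\<close> and \<open>f\<close>.\<close>

lemma chevalley: "gl_presentation (\<lambda>k. - f k) (\<lambda>k. - e k) (\<lambda>k. - h k) n"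
proof
  show "bracket (- f i) (- e j) = (if i = j then - h j - - h (Suc j) else 0)"
    if "i \<in> {1..<n}" "j \<in> {1..<n}" for i j
    using that e_f[of j i] bracket_anti[of "f i" "e j"] by auto
  show "x = 0" if "x + x = 0" for x :: 'a
    using that by (rule no_2_torsion)
qed (auto simp: h_h h_e h_f serre_e far_e serre_f far_f)

lemma gl_unit_chevalley: "gl_unit (\<lambda>k. - f k) (\<lambda>k. - e k) (\<lambda>k. - h k) i j = - X j i"
  by (simp add: gl_unit_def)

lemma h_upper:
  assumes "i < j" "1 \<le> i" "j \<le> n" "m \<in> {1..n}"
  shows "bracket (h m) (U i j) = (if m = i then U i j else 0) - (if m = j then U i j else 0)"
  using assms
proof (induction j)
  case (Suc j)
  show ?case
  proof (cases "i = j")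
    case True
    then show ?thesis using h_e[of m i] Suc.prems by simp
  next
    case False
    then have "i < j" using Suc.prems by simp
    then show ?thesis
      using Suc h_e[of m j] by (auto simp: upper_Suc jacobi)
  qed
qed simp

lemma f_upper:
  assumes "i < j" "1 \<le> i" "j \<le> n" "k \<in> {1..<n}"
  shows "bracket (f k) (U i j) = (if k = i then X (Suc k) j else 0) - (if Suc k = j then X i k else 0)"
  using assms
proof (induction j)
  case (Suc j)
  show ?case
  proof (cases "i = j")
    case True
    then show ?thesis
      using bracket_anti[of "f k" "e i"] e_f[of i k] Suc.prems by auto
  next
    case False
    then have ij: "i < j" using Suc.prems by simp
    have IH: "bracket (f k) (U i j) = (if k = i then X (Suc k) j else 0) - (if Suc k = j then X i k else 0)"
      using Suc ij by simp
    have fe: "bracket (f k) (e j) = (if k = j then h (Suc j) - h j else 0)"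
      using bracket_anti[of "f k" "e j"] e_f[of j k] Suc.prems ij by auto
    have "bracket (f k) (U i (Suc j)) = bracket (bracket (f k) (U i j)) (e j) + bracket (U i j) (bracket (f k) (e j))"
      using ij by (subst jacobi[symmetric]) (simp add: upper_Suc)
    also have "\<dots> = (if k = i then X (Suc k) (Suc j) else 0) - (if Suc k = Suc j then X i k else 0)"
    proof -
      consider "k = j" | "k = i" "Suc k = j" | "k = i" "Suc k < j" | "k \<noteq> i" "Suc k = j" | "k \<noteq> i" "Suc k \<noteq> j" "k \<noteq> j"
        using ij by linarith
      then show ?thesis
      proof cases
        \<comment> \<open>Here the bracket of \<open>f j\<close> with \<open>e j\<close> is
          \<open>h (Suc j) - h j\<close>, and \<open>U i j\<close> has weight -1 for
          \<open>h j\<close> and 0 for \<open>h (Suc j)\<close>.\<close>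
        case 1
        then show ?thesis
          using IH fe ij Suc.prems h_upper[of i j j] h_upper[of i j "Suc j"]
            bracket_anti[of "U i j" "h j"] bracket_anti[of "U i j" "h (Suc j)"]
          by (simp add: gl_unit_def)
      next
        case 2
        then show ?thesis
          using IH fe ij Suc.prems h_e[of k j] h_e[of j j] by auto
      next
        case 3
        then show ?thesis
          using IH fe ij Suc.prems by (simp add: gl_unit_def upper_Suc)
      next
        case 4
        then have "X i k = U i k" "i < k"
          using ij by (auto simp: gl_unit_def)
        then show ?thesis
          using 4 IH fe ij Suc.prems far_high[of i k j] bracket_anti[of "U i k" "e j"] by simp
      next
        case 5
        then show ?thesis using IH fe by simp
      qed
    qed
    finally show ?thesis by simp
  qed
qed simp

text \<open>The left factor is fixed and the right one is quantified inside, so the rule describes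
  the operator \<open>ad (X i j)\<close> and can be composed with other such operators.\<close>

definition gl_rule :: "nat \<Rightarrow> nat \<Rightarrow> bool"
  where "gl_rule i j \<longleftrightarrow> (\<forall>k\<in>{1..n}. \<forall>l\<in>{1..n}.
    bracket (X i j) (X k l) = (if j = k then X i l else 0) - (if i = l then X k j else 0))"

lemma h_lower:
  assumes "i < j" "1 \<le> i" "j \<le> n" "m \<in> {1..n}"
  shows "bracket (h m) (X j i) = (if m = j then X j i else 0) - (if m = i then X j i else 0)"
proof -
  interpret op: gl_presentation "\<lambda>k. - f k" "\<lambda>k. - e k" "\<lambda>k. - h k" n
    by (rule chevalley)
  have "upper (\<lambda>k. - f k) i j = - X j i"
    using assms by (simp add: gl_unit_def)
  then show ?thesis
    using op.h_upper[OF assms] by (auto simp: algebra_simps)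
qed

lemma gl_rule_h: "i \<in> {1..n} \<Longrightarrow> gl_rule i i"
  unfolding gl_rule_def
proof (intro ballI)
  fix k l assume "i \<in> {1..n}" "k \<in> {1..n}" "l \<in> {1..n}"
  then show "bracket (X i i) (X k l) = (if i = k then X i l else 0) - (if i = l then X k i else 0)"
    using h_upper[of k l i] h_lower[of l k i] h_h[of i k]
    by (cases k l rule: linorder_cases) (auto simp: gl_unit_def)
qed

lemma gl_rule_e:
  assumes i: "i \<in> {1..<n}"
  shows "gl_rule i (Suc i)"
  unfolding gl_rule_def
proof (intro ballI)
  interpret op: gl_presentation "\<lambda>k. - f k" "\<lambda>k. - e k" "\<lambda>k. - h k" n
    by (rule chevalley)
  fix k l assume kl: "k \<in> {1..n}" "l \<in> {1..n}"
  show "bracket (X i (Suc i)) (X k l) =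
      (if Suc i = k then X i l else 0) - (if i = l then X k (Suc i) else 0)"
  proof (cases k l rule: linorder_cases)
    case less
    have "X k l = U k l" "Suc i = k \<Longrightarrow> X i l = U i l" "i = l \<Longrightarrow> X k (Suc i) = U k (Suc i)"
      using less by (auto simp: gl_unit_def)
    then show ?thesis
      using bracket_simple_upper[of k l i] less kl i by simp
  next
    case equal
    then show ?thesis
      using h_e[of k i] bracket_anti[of "e i" "h k"] kl i by auto
  next
    case greater
    \<comment> \<open>Below the diagonal the claim is the rule for \<open>f\<close> against upper
      root vectors, read through the involution.\<close>
    have "bracket (- e i) (upper (\<lambda>k. - f k) l k) =
        (if i = l then - X k (Suc i) else 0) - (if Suc i = k then - X i l else 0)"
      using op.f_upper[of l k i] greater kl i by (simp add: gl_unit_chevalley)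
    moreover have "upper (\<lambda>k. - f k) l k = - X k l"
      using greater by (simp add: gl_unit_def)
    ultimately show ?thesis by auto
  qed
qed

text \<open>Since \<open>X i m\<close> is the bracket of \<open>X i j\<close> and
  \<open>X j m\<close>, Jacobi makes \<open>ad (X i m)\<close> the commutator of two operators that
  are already known. Thus only simple root vectors need a direct check.\<close>

lemma gl_rule_trans:
  assumes ij: "gl_rule i j" "gl_rule j m" "i \<noteq> m" "i \<in> {1..n}" "j \<in> {1..n}" "m \<in> {1..n}"
  shows "gl_rule i m"
proof -
  have *: "X i m = bracket (X i j) (X j m)"
    using ij by (auto simp: gl_rule_def)
  have "bracket (X i m) (X k l) = (if m = k then X i l else 0) - (if i = l then X k m else 0)"
    if "k \<in> {1..n}" "l \<in> {1..n}" for k l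
  proof -
    have 1: "bracket (X i j) (X k l) = (if j = k then X i l else 0) - (if i = l then X k j else 0)"
      if "k \<in> {1..n}" "l \<in> {1..n}" for k l
      using ij(1) that by (simp add: gl_rule_def)
    have 2: "bracket (X j m) (X k l) = (if m = k then X j l else 0) - (if j = l then X k m else 0)"
      if "k \<in> {1..n}" "l \<in> {1..n}" for k l
      using ij(2) that by (simp add: gl_rule_def)
    have "bracket (X i m) (X k l) =
        ((if m = k then bracket (X i j) (X j l) else 0) - (if j = l then bracket (X i j) (X k m) else 0)) -
        ((if j = k then bracket (X j m) (X i l) else 0) - (if i = l then bracket (X j m) (X k j) else 0))"
      unfolding * jacobi' 1[OF that] 2[OF that] bracket_linear bracket_if bracket_zero by (rule refl)
    also have "\<dots> = (if m = k then X i l else 0) - (if i = l then X k m else 0)"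
      unfolding 1[OF ij(5) that(2)] 1[OF that(1) ij(6)] 2[OF ij(4) that(2)] 2[OF that(1) ij(5)]
      using ij(3) by auto
    finally show ?thesis .
  qed
  then show ?thesis by (simp add: gl_rule_def)
qed

lemma gl_rule_upper:
  assumes "i < j" "1 \<le> i" "j \<le> n"
  shows "gl_rule i j"
  using assms
proof (induction j)
  case (Suc j)
  show ?case
  proof (cases "i = j")
    case True
    then show ?thesis using gl_rule_e Suc.prems by auto
  next
    case False
    then show ?thesis
      using gl_rule_trans[of i j "Suc j"] gl_rule_e[of j] Suc by simp
  qed
qed simp

lemma gl_relations:
  assumes ij: "i \<in> {1..n}" "j \<in> {1..n}" and kl: "k \<in> {1..n}" "l \<in> {1..n}"
  shows "bracket (X i j) (X k l) = (if j = k then X i l else 0) - (if i = l then X k j else 0)"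
proof (cases i j rule: linorder_cases)
  case less
  then show ?thesis using gl_rule_upper[of i j] assms by (simp add: gl_rule_def)
next
  case equal
  then show ?thesis using gl_rule_h[of i] assms by (simp add: gl_rule_def)
next
  case greater
  interpret op: gl_presentation "\<lambda>k. - f k" "\<lambda>k. - e k" "\<lambda>k. - h k" n
    by (rule chevalley)
  have "bracket (X i j) (X k l) = (if i = l then - X k j else 0) - (if j = k then - X i l else 0)"
    using op.gl_rule_upper[of j i, unfolded op.gl_rule_def, rule_format, of l k] greater assms
    by (simp add: gl_unit_chevalley)
  then show ?thesis by simp
qed

end

section \<open>Normally ordered products\<close>

lemma sum_list_diff: "(\<Sum>x\<leftarrow>xs. f x - g x) = sum_list (map f xs) - (sum_list (map g xs) :: 'a::ab_group_add)"
  by (induction xs) (simp_all add: algebra_simps)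

section \<open>Row replacement and the symmetry of normal ordering\<close>

primrec replace_row :: "nat \<Rightarrow> nat \<Rightarrow> (nat \<times> nat) list \<Rightarrow> (nat \<times> nat) list list" where
  "replace_row i j [] = []"
| "replace_row i j (z # zs) =
    (if fst z = j then [(i, snd z) # zs] else []) @ map ((#) z) (replace_row i j zs)"

lemma length_replace_row: "zs' \<in> set (replace_row i j zs) \<Longrightarrow> length zs' = length zs"
  by (induction zs arbitrary: zs') (auto split: if_splits)

definition mreplace_row :: "nat \<Rightarrow> nat \<Rightarrow> (nat \<times> nat) multiset \<Rightarrow> (nat \<times> nat) multiset multiset"
  where "mreplace_row i j Z =
    image_mset (\<lambda>z. add_mset (i, snd z) (Z - {#z#})) (filter_mset (\<lambda>z. fst z = j) Z)"

lemma mset_replace_row: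
  "mset (map mset (replace_row i j zs)) = mreplace_row i j (mset zs)"
proof (induction zs)
  case (Cons z zs)
  have "image_mset (add_mset z) (mreplace_row i j (mset zs)) =
      image_mset (\<lambda>y. add_mset (i, snd y) (mset (z # zs) - {#y#})) (filter_mset (\<lambda>z. fst z = j) (mset zs))"
    unfolding mreplace_row_def multiset.map_comp
    by (rule image_mset_cong) (auto simp: add_mset_commute multiset_eq_iff)
  then show ?case
    using arg_cong[OF Cons, of "image_mset (add_mset z)"]
    by (simp add: mreplace_row_def multiset.map_comp comp_def)
qed (simp add: mreplace_row_def)

lemma mreplace_row_mem:
  assumes "Y \<in># mreplace_row i j Z"
  obtains z where "z \<in># Z" "fst z = j" "Y = add_mset (i, snd z) (Z - {#z#})"
  using assms by (auto simp: mreplace_row_def)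

lemma size_mreplace_row: "Y \<in># mreplace_row i j Z \<Longrightarrow> size Y = size Z"
  by (erule mreplace_row_mem) (metis insert_DiffM size_add_mset)

text \<open>Normally ordered products: in a representation \<open>V\<^bsup>\<otimes>d\<^esup>\<close>, the product of
  \<open>zs\<close> is the sum over all ways of letting the matrix units in \<open>zs\<close> act at pairwise distinct
  tensor places.\<close>

function nprod :: "(nat \<Rightarrow> nat \<Rightarrow> 'a::ring) \<Rightarrow> 'a \<Rightarrow> (nat \<times> nat) list \<Rightarrow> 'a" where
  "nprod X u [] = u"
| "nprod X u (z # zs) = X (fst z) (snd z) * nprod X u zs -
     (\<Sum>zs'\<leftarrow>replace_row (fst z) (snd z) zs. nprod X u zs')"
  by pat_completeness auto
termination
  by (relation "measure (\<lambda>(X, u, zs). length zs)") (auto dest: length_replace_row)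

text \<open>Row replacement is the derivation by which a matrix unit acts from the left, so two
  replacements satisfy the matrix unit relations. Replacements at different entries commute; the
  correction terms come from replacing the same entry twice. They are distributed over both sides to
  avoid subtraction.\<close>

lemma replace_row_commutator:
  fixes F :: "(nat \<times> nat) list \<Rightarrow> 'a::ab_group_add"
  shows "(\<Sum>ys\<leftarrow>replace_row i j zs. \<Sum>xs\<leftarrow>replace_row k l ys. F xs) + (if k = j then \<Sum>xs\<leftarrow>replace_row i l zs. F xs else 0)
    = (\<Sum>ys\<leftarrow>replace_row k l zs. \<Sum>xs\<leftarrow>replace_row i j ys. F xs) + (if i = l then \<Sum>xs\<leftarrow>replace_row k j zs. F xs else 0)"
proof (induction zs arbitrary: F)
  case (Cons z zs)
  show ?case
    using Cons[of "\<lambda>zs. F (z # zs)"]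
    by (auto simp: sum_list_addf comp_def algebra_simps split: if_splits)
qed simp

text \<open>The choice of an ordering is harmless for entries in the box once the matrix unit
  relations hold, by \<open>nprod_cong_mset\<close>.\<close>

definition nprod_mset :: "(nat \<Rightarrow> nat \<Rightarrow> 'a::ring) \<Rightarrow> 'a \<Rightarrow> (nat \<times> nat) multiset \<Rightarrow> 'a"
  where "nprod_mset X u Z = nprod X u (SOME zs. mset zs = Z)"

locale gl_rep =
  fixes X :: "nat \<Rightarrow> nat \<Rightarrow> 'a::ring" and u :: 'a and n :: nat
  assumes gl_relations: "\<And>i j k l. i \<in> {1..n} \<Longrightarrow> j \<in> {1..n} \<Longrightarrow> k \<in> {1..n} \<Longrightarrow> l \<in> {1..n} \<Longrightarrow>
    X i j * X k l - X k l * X i j = (if j = k then X i l else 0) - (if i = l then X k j else 0)"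
begin

abbreviation "box \<equiv> {1..n} \<times> {1..n}"

text \<open>The commutator of the two leading matrix units cancels against the terms in which one of
  them replaces the row of the other. The double replacements in the tail cancel by
  \<open>replace_row_commutator\<close>.\<close>

lemma nprod_swap:
  assumes "x \<in> box" "y \<in> box"
  shows "nprod X u (x # y # zs) = nprod X u (y # x # zs)"
proof -
  obtain i j k l where xy: "x = (i, j)" "y = (k, l)"
    by (cases x, cases y)
  let ?N = "nprod X u"
  let ?S = "\<lambda>i j zs. sum_list (map ?N (replace_row i j zs))"
  have expand: "?N ((i, j) # (k, l) # zs) =
      X i j * X k l * ?N zs - X i j * ?S k l zs
      - (if k = j then X i l * ?N zs - ?S i l zs else 0)
      - (X k l * ?S i j zs - (\<Sum>ys\<leftarrow>replace_row i j zs. ?S k l ys))" for i j k l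
    by (simp add: algebra_simps comp_def sum_list_diff sum_list_const_mult)
  have rel: "X i j * X k l = X k l * X i j + (if j = k then X i l else 0) - (if i = l then X k j else 0)"
    using gl_relations[of i j k l] assms xy by (simp add: algebra_simps)
  show ?thesis
    unfolding xy expand rel
    using replace_row_commutator[of ?N k l i j zs]
    by (auto simp: algebra_simps)
qed

lemma set_mreplace_row:
  "Y \<in># mreplace_row i j Z \<Longrightarrow> set_mset Z \<subseteq> box \<Longrightarrow> i \<in> {1..n} \<Longrightarrow> set_mset Y \<subseteq> box"
  by (erule mreplace_row_mem) (auto dest!: in_diffD)

text \<open>Induction on the length handles two lists with a common head. For different heads, the
  head of the second list is moved to second place in the first list and the two leading entries are
  exchanged.\<close>

lemma nprod_cong_mset:
  assumes "mset zs = mset zs'" "set zs \<subseteq> box"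
  shows "nprod X u zs = nprod X u zs'"
  using assms
proof (induction "length zs" arbitrary: zs zs' rule: less_induct)
  case less
  have tail: "nprod X u (z # ys) = nprod X u (z # ys')"
    if ys: "mset ys = mset ys'" "length ys < length zs" "set ys \<subseteq> box" "z \<in> box" for z ys ys'
  proof -
    let ?F = "\<lambda>Y. nprod X u (SOME xs. mset xs = Y)"
    \<comment> \<open>The subtracted terms can be matched only as multisets. The induction
      hypothesis allows each list to be replaced by a chosen ordering of its multiset.\<close>
    have *: "(\<Sum>xs\<leftarrow>replace_row (fst z) (snd z) ys. nprod X u xs) =
        sum_mset (image_mset ?F (mreplace_row (fst z) (snd z) (mset ys)))"
      if ys: "length ys < length zs" "set ys \<subseteq> box" for ys
    proof -
      have "nprod X u xs = ?F (mset xs)" if xs: "xs \<in> set (replace_row (fst z) (snd z) ys)" for xs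
      proof (rule less(1))
        show "length xs < length zs"
          using length_replace_row[OF xs] ys by simp
        show "mset xs = mset (SOME ys. mset ys = mset xs)"
          by (rule sym, rule someI) simp
        have "mset xs \<in># mreplace_row (fst z) (snd z) (mset ys)"
          using xs unfolding mset_replace_row[symmetric] by auto
        note set_mreplace_row[OF this]
        moreover have "set_mset (mset ys) \<subseteq> box" "fst z \<in> {1..n}"
          using ys \<open>z \<in> box\<close> by (auto simp only: set_mset_mset mem_Times_iff)
        ultimately show "set xs \<subseteq> box"
          by (simp only: set_mset_mset)
      qed
      then have "map (nprod X u) (replace_row (fst z) (snd z) ys) =
          map ?F (map mset (replace_row (fst z) (snd z) ys))"
        by simp
      then show ?thesis
        by (simp only: mset_replace_row[symmetric] mset_map[symmetric] sum_mset_sum_list)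
    qed
    have "length ys' < length zs" "set ys' \<subseteq> box"
      using ys mset_eq_length mset_eq_setD by metis+
    then show ?thesis
      using ys *[of ys] *[of ys'] less(1)[of ys ys'] by simp
  qed
  show ?case
  proof (cases zs)
    case Nil
    then show ?thesis using less.prems by simp
  next
    case z: (Cons z ys)
    then obtain z' ys' where z': "zs' = z' # ys'"
      using less.prems by (cases zs') auto
    show ?thesis
    proof (cases "z = z'")
      case True
      then show ?thesis using tail[of ys ys' z] z z' less.prems by simp
    next
      case False
      then have "z' \<in> set ys"
        using less.prems z z' by (metis list.set_intros(1) mset_eq_setD set_ConsD)
      define xs where "xs = remove1 z' ys"
      have xs: "mset ys = mset (z' # xs)"
        using \<open>z' \<in> set ys\<close> by (simp add: xs_def)
      then have xs': "mset ys' = mset (z # xs)"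
        using less.prems(1) z z' by (simp add: add_mset_commute)
      have in_box: "z \<in> box" "z' \<in> box" "set ys \<subseteq> box" "set ys' \<subseteq> box"
        using less.prems(2) less.prems(2)[unfolded mset_eq_setD[OF less.prems(1)]]
        unfolding z z' by simp_all
      have len: "length ys < length zs" "length ys' < length zs"
        using z z' mset_eq_length[OF less.prems(1)] by auto
      have "nprod X u zs = nprod X u (z # z' # xs)"
        unfolding z using tail[OF xs] in_box len by simp
      also have "\<dots> = nprod X u (z' # z # xs)"
        using in_box by (simp only: nprod_swap)
      also have "\<dots> = nprod X u zs'"
        unfolding z' using tail[OF xs'] in_box len by simp
      finally show ?thesis .
    qed
  qed
qed

abbreviation "N \<equiv> nprod_mset X u"

lemma nprod_mset_mset:
  assumes "set zs \<subseteq> box"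
  shows "N (mset zs) = nprod X u zs"
proof -
  have "mset (SOME xs. mset xs = mset zs) = mset zs"
    by (rule someI) simp
  then show ?thesis
    unfolding nprod_mset_def using nprod_cong_mset[of zs] assms by metis
qed

lemma nprod_mset_empty [simp]: "N {#} = u"
  using nprod_mset_mset[of "[]"] by simp

lemma unit_times_nprod_mset:
  assumes "(i, j) \<in> box" "set_mset Z \<subseteq> box"
  shows "X i j * N Z = N (add_mset (i, j) Z) + (\<Sum>Y\<in>#mreplace_row i j Z. N Y)"
proof -
  obtain zs where Z: "Z = mset zs"
    using ex_mset by metis
  have zs: "set ((i, j) # zs) \<subseteq> box" "set zs \<subseteq> box"
    using assms Z by auto
  have "nprod X u xs = N (mset xs)" if "xs \<in> set (replace_row i j zs)" for xs
  proof -
    have "mset xs \<in># mreplace_row i j (mset zs)"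
      using that unfolding mset_replace_row[symmetric] by auto
    then have "set xs \<subseteq> box"
      using set_mreplace_row[of "mset xs" i j Z] assms Z by simp
    then show ?thesis
      by (simp add: nprod_mset_mset)
  qed
  then have "map (nprod X u) (replace_row i j zs) = map N (map mset (replace_row i j zs))"
    by simp
  then have "(\<Sum>xs\<leftarrow>replace_row i j zs. nprod X u xs) = (\<Sum>Y\<in>#mreplace_row i j Z. N Y)"
    by (simp only: Z mset_replace_row[symmetric] mset_map[symmetric] sum_mset_sum_list)
  then show ?thesis
    using nprod_mset_mset[OF zs(1)] nprod_mset_mset[OF zs(2)] Z by simp
qed

end

section \<open>Degree bound and spanning set\<close>

text \<open>Without a unit in the type, a scalar cannot be viewed as a ring element, so the scalar
  action and its compatibility with products are separate data.\<close>

locale rat_algebra = vector_space smul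
  for smul :: "rat \<Rightarrow> 'a::ring \<Rightarrow> 'a" +
  assumes smul_mult_left: "smul c (x * y) = smul c x * y"
    and smul_mult_right: "smul c (x * y) = x * smul c y"
begin

lemma smul_zero_iff: "smul c x = 0 \<longleftrightarrow> c = 0 \<or> x = 0"
  by (rule scale_eq_0_iff)

lemma no_2_torsion: "(x::'a) + x = 0 \<Longrightarrow> x = 0"
  using scale_left_distrib[of 1 1 x] scale_eq_0_iff[of 2 x] by simp

lemma sum_mset_replicate_smul: "\<Sum>\<^sub># (replicate_mset m y) = smul (of_nat m) y"
  by (induction m) (simp_all add: scale_left_distrib)

lemma mult_span:
  assumes "x \<in> span S" "\<And>y. y \<in> S \<Longrightarrow> a * y \<in> span S"
  shows "a * x \<in> span S"
  using assms(1)
proof (induction rule: span_induct_alt)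
  case base
  then show ?case by (simp add: span_zero)
next
  case (step c x y)
  then show ?case
    using assms(2) by (simp add: distrib_left smul_mult_right[symmetric] span_add span_scale)
qed

end

text \<open>\<open>trace\<close> is (R6) and \<open>minimal\<close> is (R7), the latter written as a
  fold ending in \<open>u\<close> because there is no 1 from which a product could start.\<close>

locale gl_rep_degree = gl_rep X u n + rat_algebra smul
  for X :: "nat \<Rightarrow> nat \<Rightarrow> 'a::ring" and u n and smul :: "rat \<Rightarrow> 'a \<Rightarrow> 'a" +
  fixes d :: nat
  assumes u_u: "u * u = u"
    and u_X: "\<And>i j. (i, j) \<in> {1..n} \<times> {1..n} \<Longrightarrow> u * X i j = X i j"
    and X_u: "\<And>i j. (i, j) \<in> {1..n} \<times> {1..n} \<Longrightarrow> X i j * u = X i j"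
    and trace: "(\<Sum>i=1..n. X i i) = smul (of_nat d) u"
    and minimal: "\<And>i. i \<in> {1..n} \<Longrightarrow>
      foldr (\<lambda>k y. (X i i - smul (of_nat k) u) * y) [0..<d + 1] u = 0"
begin

lemma u_nprod_mset:
  assumes "set_mset Z \<subseteq> box"
  shows "u * N Z = N Z"
  using assms
proof (induction "size Z" arbitrary: Z rule: less_induct)
  case less
  show ?case
  proof (cases Z)
    case empty
    then show ?thesis by (simp add: u_u)
  next
    case (add z Y)
    obtain i j where z: "z = (i, j)"
      by (cases z)
    have ij: "(i, j) \<in> box" "set_mset Y \<subseteq> box"
      using less.prems add z by simp_all
    have "u * (X i j * N Y) = X i j * N Y"
      using u_X[OF ij(1)] by (simp add: mult.assoc[symmetric])
    moreover have "u * N Y' = N Y'" if "Y' \<in># mreplace_row i j Y" for Y'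
      using less(1)[of Y'] size_mreplace_row[OF that] set_mreplace_row[OF that] ij add by simp
    then have "u * (\<Sum>Y'\<in>#mreplace_row i j Y. N Y') = (\<Sum>Y'\<in>#mreplace_row i j Y. N Y')"
      by (simp add: sum_mset_distrib_left cong: image_mset_cong)
    moreover have "N Z = X i j * N Y - (\<Sum>Y'\<in>#mreplace_row i j Y. N Y')"
      using unit_times_nprod_mset[OF ij] add z by simp
    ultimately show ?thesis
      by (simp add: right_diff_distrib)
  qed
qed

text \<open>On \<open>y\<close> the polynomial of (R7) takes the scalar value given by the product
  of the numbers -1 - k for k = 0, ..., d, none of which is zero.\<close>

lemma eigenvector_minus_one:
  assumes i: "i \<in> {1..n}" and y: "u * y = y" "X i i * y = - y"
  shows "y = 0"
proof -
  have 1: "foldr (\<lambda>k y. (X i i - smul (of_nat k) u) * y) ks u * y =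
      smul (\<Prod>k\<leftarrow>ks. - 1 - of_nat k) y" for ks
  proof (induction ks)
    case (Cons k ks)
    have "(X i i - smul (of_nat k) u) * y = smul (- 1 - of_nat k) y"
      using y by (simp add: algebra_simps smul_mult_left[symmetric])
    then show ?case
      using Cons by (simp add: mult.assoc smul_mult_right[symmetric] mult.commute)
  qed (simp add: y)
  have "(- 1 - of_nat k :: rat) \<noteq> 0" for k
  proof -
    have "0 \<le> (of_nat k :: rat)" by simp
    then show ?thesis by linarith
  qed
  then have "(\<Prod>k\<leftarrow>ks. - 1 - of_nat k :: rat) \<noteq> 0" for ks
    by (induction ks) auto
  then show ?thesis
    using 1[of "[0..<d + 1]"] minimal[OF i] by (metis mult_zero_left scale_eq_0_iff)
qed

lemma mreplace_row_diagonal: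
  assumes "\<And>a. a \<in># A \<Longrightarrow> fst a \<noteq> i"
  shows "mreplace_row b i (A + replicate_mset m (i, i)) =
    replicate_mset m (add_mset (b, i) (A + replicate_mset (m - 1) (i, i)))"
proof -
  have A: "filter_mset (\<lambda>z. fst z = i) A = {#}"
    using assms by simp
  have "filter_mset (\<lambda>z. fst z = i) (A + replicate_mset m (i, i)) = replicate_mset m (i, i)"
    by (induction m) (simp_all add: A)
  moreover have "A + replicate_mset m (i, i) - {#(i, i)#} = A + replicate_mset (m - 1) (i, i)" if "m > 0"
    using that by (cases m) auto
  ultimately show ?thesis
    by (cases "m = 0") (simp_all add: mreplace_row_def A)
qed

text \<open>Hence \<open>N {(i, i)\<^sup>m}\<close> is the falling factorial \<open>X i i (X i i - 1) \<dots> (X i i - m + 1)\<close>.\<close>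

lemma nprod_diagonal_Suc:
  assumes "i \<in> {1..n}"
  shows "N (replicate_mset (Suc m) (i, i)) =
    (X i i - smul (of_nat m) u) * N (replicate_mset m (i, i))"
proof -
  have box: "set_mset (replicate_mset m (i, i)) \<subseteq> box"
    using assms by auto
  have "mreplace_row i i (replicate_mset m (i, i)) = replicate_mset m (replicate_mset m (i, i))"
    using mreplace_row_diagonal[of "{#}" i i m] by (cases m) auto
  then show ?thesis
    using unit_times_nprod_mset[of i i, OF _ box] assms u_nprod_mset[OF box]
    by (simp add: algebra_simps smul_mult_left[symmetric] sum_mset_replicate_smul)
qed

text \<open>(R7) applies the factor for 0 last, the falling factorial the factor for
  \<open>d\<close>; the factors commute, so both orders agree. Higher products are left multiples of
  the one that vanishes.\<close>

lemma nprod_diagonal_vanish: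
  assumes i: "i \<in> {1..n}" and "d < m"
  shows "N (replicate_mset m (i, i)) = 0"
proof -
  let ?f = "\<lambda>k y. (X i i - smul (of_nat k) u) * y"
  have "(X i i - smul j u) * (X i i - smul k u) = (X i i - smul k u) * (X i i - smul j u)" for j k
    using u_X[of i i] X_u[of i i] i u_u
    by (simp add: algebra_simps smul_mult_left[symmetric] smul_mult_right[symmetric])
  then have comm: "?f j (?f k y) = ?f k (?f j y)" for j k y
    by (simp only: mult.assoc[symmetric])
  have "foldr ?f ks u = fold ?f ks u" for ks
    using comm by (intro foldr_fold[THEN fun_cong]) (simp add: fun_eq_iff)
  moreover have "fold ?f [0..<k] u = N (replicate_mset k (i, i))" for k
    using nprod_diagonal_Suc[OF i] by (induction k) simp_all
  ultimately have "N (replicate_mset (d + 1) (i, i)) = 0"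
    using minimal[OF i] by metis
  moreover have "N (replicate_mset (d + 1 + k) (i, i)) = 0" for k
  proof (induction k)
    case 0
    show ?case using calculation by simp
  next
    case (Suc k)
    then show ?case
      using nprod_diagonal_Suc[OF i, of "d + 1 + k"] by simp
  qed
  ultimately show ?thesis
    using \<open>d < m\<close> by (metis Suc_eq_plus1 Suc_leI le_add_diff_inverse)
qed

text \<open>If all columns are \<open>i\<close>, then trading a diagonal entry \<open>(i, i)\<close> for an off-diagonal
  \<open>(a, i)\<close> produces an eigenvector of \<open>X i i\<close> for the eigenvalue \<open>-1\<close>.\<close>

lemma nprod_column_vanish:
  assumes i: "i \<in> {1..n}"
    and "\<And>a. a \<in># A \<Longrightarrow> fst a \<noteq> i \<and> snd a = i \<and> fst a \<in> {1..n}" "d < size A + m"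
  shows "N (A + replicate_mset m (i, i)) = 0"
  using assms(2,3)
proof (induction A arbitrary: m)
  case empty
  then show ?case using nprod_diagonal_vanish[OF i] by simp
next
  case (add x A)
  define a where "a = fst x"
  have x: "x = (a, i)" and a: "a \<in> {1..n}" "a \<noteq> i"
    using add.prems(1)[of x] by (auto simp: a_def prod_eq_iff)
  have A: "fst b \<noteq> i" "snd b = i" "fst b \<in> {1..n}" if "b \<in># A" for b
    using add.prems(1)[of b] that by auto
  define Z where "Z = A + replicate_mset m (i, i)"
  have box: "set_mset Z \<subseteq> box" "set_mset (add_mset (a, i) Z) \<subseteq> box" "set_mset (add_mset (i, i) Z) \<subseteq> box"
    using A a i by (auto simp: Z_def mem_Times_iff split: if_splits)
  \<comment> \<open>An off-diagonal entry is exchanged for a diagonal one, so the total size is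
    unchanged and the induction hypothesis applies with \<open>Suc m\<close>.\<close>
  have "N (add_mset (i, i) Z) = 0"
    using add.IH[of "Suc m"] add.prems A by (simp add: Z_def)
  moreover have "mreplace_row a i (add_mset (i, i) Z) = replicate_mset (Suc m) (add_mset (a, i) Z)"
    using mreplace_row_diagonal[of A i a "Suc m"] A by (simp add: Z_def)
  then have "(\<Sum>Y\<in>#mreplace_row a i (add_mset (i, i) Z). N Y) =
      smul (of_nat (Suc m)) (N (add_mset (a, i) Z))"
    by (simp only: image_replicate_mset sum_mset_replicate_smul)
  ultimately have "N (add_mset (a, i) (add_mset (i, i) Z)) = - smul (of_nat (Suc m)) (N (add_mset (a, i) Z))"
    using unit_times_nprod_mset[of a i, OF _ box(3)] a i by (simp add: eq_neg_iff_add_eq_0)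
  moreover have "X i i * N (add_mset (a, i) Z) =
      N (add_mset (i, i) (add_mset (a, i) Z)) + smul (of_nat m) (N (add_mset (a, i) Z))"
  proof -
    have "mreplace_row i i (add_mset (a, i) Z) = replicate_mset m (add_mset (a, i) Z)"
    proof -
      have "fst b \<noteq> i" if "b \<in># add_mset (a, i) A" for b
        using that A a by (cases "b = (a, i)") simp_all
      from mreplace_row_diagonal[of "add_mset (a, i) A" i i m, OF this] show ?thesis
        by (cases m) (simp_all add: Z_def add_mset_commute)
    qed
    then show ?thesis
      using unit_times_nprod_mset[of i i, OF _ box(2)] i by (simp add: sum_mset_replicate_smul)
  qed
  \<comment> \<open>The two computations of the product of size one larger leave the coefficient m -
    (m + 1) = -1.\<close>
  ultimately have "X i i * N (add_mset (a, i) Z) = - N (add_mset (a, i) Z)"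
    by (simp add: add_mset_commute[of "(i, i)"] scale_left_distrib)
  then show ?case
    using eigenvector_minus_one[OF i u_nprod_mset[OF box(2)]] by (simp add: x Z_def)
qed

text \<open>Row replacement never changes a column. Splitting off an entry outside column
  \<open>i\<close> therefore leaves only products with the same entries in column \<open>i\<close>
  and one fewer outside it.\<close>

lemma nprod_many_columns_vanish:
  assumes i: "i \<in> {1..n}"
    and "set_mset Z \<subseteq> box" "d < size (filter_mset (\<lambda>z. snd z = i) Z)"
  shows "N Z = 0"
  using assms(2,3)
proof (induction "size (filter_mset (\<lambda>z. snd z \<noteq> i) Z)" arbitrary: Z rule: less_induct)
  case less
  show ?case
  proof (cases "filter_mset (\<lambda>z. snd z \<noteq> i) Z = {#}")
    case True
    then have col: "snd z = i" if "z \<in># Z" for z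
      using that by (cases z) auto
    define A where "A = filter_mset (\<lambda>z. fst z \<noteq> i) Z"
    have "filter_mset (\<lambda>z. fst z = i) Z = filter_mset (\<lambda>z. z = (i, i)) Z"
      by (rule filter_mset_cong) (auto simp: col prod_eq_iff)
    then have Z: "Z = A + replicate_mset (count Z (i, i)) (i, i)"
      using multiset_partition[of Z "\<lambda>z. fst z \<noteq> i"] by (simp add: A_def filter_eq_replicate_mset)
    have "filter_mset (\<lambda>z. snd z = i) Z = Z"
      using col by (simp add: filter_mset_eq_conv)
    then have "d < size A + count Z (i, i)"
      using less.prems(2) arg_cong[OF Z, of size] by simp
    moreover have "fst a \<noteq> i \<and> snd a = i \<and> fst a \<in> {1..n}" if "a \<in># A" for a
      using that col less.prems(1) by (auto simp: A_def)
    ultimately show ?thesis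
      using nprod_column_vanish[OF i] Z by metis
  next
    case False
    then obtain z where z: "z \<in># Z" "snd z \<noteq> i"
      by auto
    define Y where "Y = Z - {#z#}"
    have Z: "Z = add_mset (fst z, snd z) Y"
      using z by (simp add: Y_def)
    have box: "(fst z, snd z) \<in> box" "set_mset Y \<subseteq> box"
      using less.prems(1) by (simp_all add: Z)
    have smaller: "N Y' = 0"
      if "set_mset Y' \<subseteq> box" "size (filter_mset (\<lambda>z. snd z \<noteq> i) Y') = size (filter_mset (\<lambda>z. snd z \<noteq> i) Y)"
        "size (filter_mset (\<lambda>z. snd z = i) Y') = size (filter_mset (\<lambda>z. snd z = i) Y)" for Y'
      using less(1)[of Y'] that less.prems(2) z(2) by (simp add: Z)
    have "N Y' = 0" if Y': "Y' \<in># mreplace_row (fst z) (snd z) Y" for Y'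
    proof (rule smaller)
      show "set_mset Y' \<subseteq> box"
        using set_mreplace_row[OF Y' box(2)] box(1) by (simp add: mem_Times_iff)
      obtain y B where "Y = add_mset y B" "Y' = add_mset (fst z, snd y) B"
        using mreplace_row_mem[OF Y'] by (metis insert_DiffM)
      then show "size (filter_mset (\<lambda>z. snd z \<noteq> i) Y') = size (filter_mset (\<lambda>z. snd z \<noteq> i) Y)"
        "size (filter_mset (\<lambda>z. snd z = i) Y') = size (filter_mset (\<lambda>z. snd z = i) Y)"
        by simp_all
    qed
    then have "(\<Sum>Y'\<in>#mreplace_row (fst z) (snd z) Y. N Y') = 0"
      by (simp cong: image_mset_cong)
    then show ?thesis
      using unit_times_nprod_mset[OF box] smaller[of Y] box(2) by (simp add: Z)
  qed
qed

section \<open>The trace relation, the degree bound and the spanning set\<close>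

lemma size_eq_sum_fibres:
  assumes "\<And>z. z \<in># Z \<Longrightarrow> f z \<in> {1..n}"
  shows "size Z = (\<Sum>i=1..n. size (filter_mset (\<lambda>z. f z = i) Z))"
  using assms
proof (induction Z)
  case (add z Z)
  have "(\<Sum>i=1..n. size (filter_mset (\<lambda>z. f z = i) (add_mset z Z))) =
      (\<Sum>i=1..n. (if i = f z then 1 else 0) + size (filter_mset (\<lambda>z. f z = i) Z))"
    by (rule sum.cong) auto
  then show ?case
    using add by (simp add: sum.distrib)
qed simp

text \<open>Replacing a row index by itself changes nothing, so every entry contributes one copy of
  \<open>Z\<close>, in the summand of its own row.\<close>

lemma sum_mreplace_row_diagonal:
  assumes "set_mset Z \<subseteq> box"
  shows "(\<Sum>i=1..n. \<Sum>Y\<in>#mreplace_row i i Z. N Y) = smul (of_nat (size Z)) (N Z)"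
proof -
  have "mreplace_row i i Z = replicate_mset (size (filter_mset (\<lambda>z. fst z = i) Z)) Z" for i
  proof -
    have "mreplace_row i i Z = image_mset (\<lambda>z. Z) (filter_mset (\<lambda>z. fst z = i) Z)"
      unfolding mreplace_row_def by (rule image_mset_cong) auto
    then show ?thesis by (simp add: image_mset_const_eq)
  qed
  then have "(\<Sum>i=1..n. \<Sum>Y\<in>#mreplace_row i i Z. N Y) =
      (\<Sum>i=1..n. smul (of_nat (size (filter_mset (\<lambda>z. fst z = i) Z))) (N Z))"
    by (simp add: sum_mset_replicate_smul)
  also have "\<dots> = smul (of_nat (\<Sum>i=1..n. size (filter_mset (\<lambda>z. fst z = i) Z))) (N Z)"
    by (simp add: scale_sum_left)
  also have "(\<Sum>i=1..n. size (filter_mset (\<lambda>z. fst z = i) Z)) = size Z"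
    using assms by (intro size_eq_sum_fibres[symmetric]) auto
  finally show ?thesis .
qed

lemma sum_nprod_add_diagonal:
  assumes "set_mset Z \<subseteq> box"
  shows "(\<Sum>i=1..n. N (add_mset (i, i) Z)) = smul (of_nat d - of_nat (size Z)) (N Z)"
proof -
  have "smul (of_nat d) (N Z) = (\<Sum>i=1..n. X i i) * N Z"
    unfolding trace using u_nprod_mset[OF assms] by (simp add: smul_mult_left[symmetric])
  also have "\<dots> = (\<Sum>i=1..n. N (add_mset (i, i) Z) + (\<Sum>Y\<in>#mreplace_row i i Z. N Y))"
    unfolding sum_distrib_right
    by (rule sum.cong[OF refl], rule unit_times_nprod_mset) (use assms in auto)
  also have "\<dots> = (\<Sum>i=1..n. N (add_mset (i, i) Z)) + smul (of_nat (size Z)) (N Z)"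
    by (simp only: sum.distrib sum_mreplace_row_diagonal[OF assms])
  finally show ?thesis
    by (simp add: scale_left_diff_distrib)
qed

lemma nprod_vanish:
  assumes "set_mset Z \<subseteq> box" "d < size Z"
  shows "N Z = 0"
  using assms
\<comment> \<open>The size grows in each step until it exceeds \<open>n * d\<close>, where the
  pigeonhole principle applies. The \<open>+ 1\<close> makes the measure drop also in the step from
  size \<open>n * d\<close>.\<close>
proof (induction "n * d + 1 - size Z" arbitrary: Z rule: less_induct)
  case less
  show ?case
  proof (cases "n * d < size Z")
    case True
    have "\<exists>i\<in>{1..n}. d < size (filter_mset (\<lambda>z. snd z = i) Z)"
    proof (rule ccontr)
      assume "\<not> ?thesis"
      then have "(\<Sum>i=1..n. size (filter_mset (\<lambda>z. snd z = i) Z)) \<le> (\<Sum>i=1..n. d)"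
        by (intro sum_mono) (auto simp: not_less)
      then show False
        using True size_eq_sum_fibres[of Z snd] less.prems(1) by (auto simp: subset_iff)
    qed
    then show ?thesis
      using nprod_many_columns_vanish less.prems(1) by blast
  next
    case False
    then have "N (add_mset (i, i) Z) = 0" if "i \<in> {1..n}" for i
      using less(1)[of "add_mset (i, i) Z"] less.prems that by auto
    then have "smul (of_nat d - of_nat (size Z)) (N Z) = 0"
      using sum_nprod_add_diagonal[OF less.prems(1)] by simp
    then show ?thesis
      using less.prems(2) by (simp add: smul_zero_iff)
  qed
qed

definition nprod_basis :: "'a set"
  where "nprod_basis = N ` {Z. set_mset Z \<subseteq> box \<and> size Z = d}"

text \<open>Below size \<open>d\<close> the trace formula is solved for \<open>N Z\<close>, as
  \<open>d - |Z|\<close> is invertible; above size \<open>d\<close> the product vanishes.\<close>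

lemma nprod_mset_in_span:
  assumes "set_mset Z \<subseteq> box"
  shows "N Z \<in> span nprod_basis"
  using assms
proof (induction "d - size Z" arbitrary: Z rule: less_induct)
  case less
  consider "size Z < d" | "size Z = d" | "size Z > d"
    by linarith
  then show ?case
  proof cases
    case 1
    have "N (add_mset (i, i) Z) \<in> span nprod_basis" if "i \<in> {1..n}" for i
      using less(1)[of "add_mset (i, i) Z"] less.prems that 1 by auto
    then have "smul (of_nat d - of_nat (size Z)) (N Z) \<in> span nprod_basis"
      unfolding sum_nprod_add_diagonal[OF less.prems, symmetric] by (intro span_sum) auto
    from span_scale[OF this, of "1 / (of_nat d - of_nat (size Z))"] show ?thesis
      using 1 by simp
  next
    case 2
    then show ?thesis
      using less.prems by (auto simp: nprod_basis_def intro: span_base)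
  next
    case 3
    then show ?thesis
      using nprod_vanish[OF less.prems] by (simp add: span_zero)
  qed
qed

lemma unit_in_span: "u \<in> span nprod_basis"
  using nprod_mset_in_span[of "{#}"] by simp

text \<open>Together with \<open>unit_in_span\<close> this puts every monomial in the generators
  into the span, built up letter by letter from the right.\<close>

lemma unit_times_span:
  assumes "(i, j) \<in> box" "x \<in> span nprod_basis"
  shows "X i j * x \<in> span nprod_basis"
proof (rule mult_span[OF assms(2)])
  fix y assume "y \<in> nprod_basis"
  then obtain Z where Z: "y = N Z" "set_mset Z \<subseteq> box"
    by (auto simp: nprod_basis_def)
  have "(\<Sum>Y\<in>#M. N Y) \<in> span nprod_basis" if "\<And>Y. Y \<in># M \<Longrightarrow> set_mset Y \<subseteq> box" for M
    using that by (induction M) (simp_all add: span_zero span_add nprod_mset_in_span)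
  then have "(\<Sum>Y\<in>#mreplace_row i j Z. N Y) \<in> span nprod_basis"
    using set_mreplace_row[of _ i j Z] Z assms(1) by blast
  moreover have "N (add_mset (i, j) Z) \<in> span nprod_basis"
    using Z assms(1) by (intro nprod_mset_in_span) auto
  ultimately show "X i j * y \<in> span nprod_basis"
    using unit_times_nprod_mset[OF assms(1) Z(2)] Z(1) by (simp add: span_add)
qed

end

section \<open>Action on tensor coordinates\<close>

text \<open>A tensor in \<open>V\<^bsup>\<otimes>d\<^esup>\<close> is represented by its coordinate function on words of length \<open>d\<close>.
  On coordinates, the matrix unit \<open>E\<^sub>i\<^sub>j\<close>, acting as a derivation, replaces a letter \<open>i\<close>
  of the argument by \<open>j\<close>.\<close>

fun unit_act :: "nat \<Rightarrow> nat \<Rightarrow> (nat list \<Rightarrow> rat) \<Rightarrow> nat list \<Rightarrow> rat" where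
  "unit_act i j g [] = 0"
| "unit_act i j g (c # w) = unit_act i j (\<lambda>v. g (c # v)) w + (if c = i then g (j # w) else 0)"

text \<open>The action of a normally ordered product, by recursion on the tensor places: at most one of
  its factors acts at the first place.\<close>

fun nprod_act :: "(nat \<times> nat) multiset \<Rightarrow> (nat list \<Rightarrow> rat) \<Rightarrow> nat list \<Rightarrow> rat" where
  "nprod_act Z g [] = (if Z = {#} then g [] else 0)"
| "nprod_act Z g (c # w) = nprod_act Z (\<lambda>v. g (c # v)) w +
    (\<Sum>z\<in>#Z. if fst z = c then nprod_act (Z - {#z#}) (\<lambda>v. g (snd z # v)) w else 0)"

lemma unit_act_linear [simp]:
  "unit_act i j (\<lambda>v. g v + g' v) w = unit_act i j g w + unit_act i j g' w"
  "unit_act i j (\<lambda>v. g v - g' v) w = unit_act i j g w - unit_act i j g' w"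
  "unit_act i j (\<lambda>v. c * g v) w = c * unit_act i j g w"
  "unit_act i j (\<lambda>v. - g v) w = - unit_act i j g w"
  "unit_act i j (\<lambda>v. 0) w = 0"
  by (induction w arbitrary: g g') (auto simp: algebra_simps)

lemma unit_act_if [simp]: "unit_act i j (\<lambda>v. if P then g v else 0) w = (if P then unit_act i j g w else 0)"
  by simp

lemma unit_act_sum_mset: "unit_act i j (\<lambda>v. \<Sum>z\<in>#Z. G z v) w = (\<Sum>z\<in>#Z. unit_act i j (G z) w)"
  by (induction Z) simp_all

lemma unit_act_commutator:
  "unit_act i j (unit_act k l g) w = unit_act k l (unit_act i j g) w +
    (if j = k then unit_act i l g w else 0) - (if i = l then unit_act k j g w else 0)"
  by (induction w arbitrary: g) auto

text \<open>Both sides are the full double sum minus its diagonal, which is why the values are taken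
  in a group.\<close>

lemma sum_mset_pairs_swap:
  fixes f :: "'b \<Rightarrow> 'b \<Rightarrow> 'a::ab_group_add"
  shows "(\<Sum>x\<in>#Z. \<Sum>y\<in>#Z - {#x#}. f x y) = (\<Sum>y\<in>#Z. \<Sum>x\<in>#Z - {#y#}. f x y)"
proof -
  have *: "(\<Sum>x\<in>#Z. \<Sum>y\<in>#Z - {#x#}. f x y) = (\<Sum>x\<in>#Z. \<Sum>y\<in>#Z. f x y) - (\<Sum>x\<in>#Z. f x x)"
    for f :: "'b \<Rightarrow> 'b \<Rightarrow> 'a"
  proof -
    have "(\<Sum>x\<in>#Z. \<Sum>y\<in>#Z. f x y) = (\<Sum>x\<in>#Z. (\<Sum>y\<in>#Z - {#x#}. f x y) + f x x)"
    proof (rule arg_cong[of _ _ sum_mset], rule image_mset_cong)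
      fix x assume "x \<in># Z"
      then obtain Y where "Z = add_mset x Y"
        by (metis insert_DiffM)
      then show "(\<Sum>y\<in>#Z. f x y) = (\<Sum>y\<in>#Z - {#x#}. f x y) + f x x"
        by simp
    qed
    then show ?thesis
      by (simp add: sum_mset.distrib)
  qed
  show ?thesis
    unfolding * by (simp only: sum_mset.swap[of f])
qed

lemma sum_mset_filter:
  "(\<Sum>z\<in>#filter_mset P Z. f z) = (\<Sum>z\<in>#Z. if P z then f z else (0 :: 'a::comm_monoid_add))"
  by (induction Z) simp_all

lemma sum_mset_if_add:
  "(\<Sum>z\<in>#Z. if P z then f z + g z else 0) =
    (\<Sum>z\<in>#Z. if P z then f z else 0) + (\<Sum>z\<in>#Z. if P z then g z else (0 :: 'a::comm_monoid_add))"
  by (induction Z) (simp_all add: ac_simps)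

text \<open>The factor removed after a replacement is either the new entry, which has row
  \<open>i\<close> and leaves only the other factors behind, or an old one, and then removal and
  replacement commute.\<close>

lemma sum_mreplace_row_remove:
  fixes f :: "(nat \<times> nat) multiset \<Rightarrow> nat \<Rightarrow> 'a::ab_group_add"
  shows "(\<Sum>Y\<in>#mreplace_row i j Z. \<Sum>y\<in>#Y. if fst y = c then f (Y - {#y#}) (snd y) else 0) =
    (\<Sum>z\<in>#Z. if fst z = c then (\<Sum>Y\<in>#mreplace_row i j (Z - {#z#}). f Y (snd z)) else 0) +
    (if c = i then (\<Sum>z\<in>#Z. if fst z = j then f (Z - {#z#}) (snd z) else 0) else 0)"
proof -
  have "(\<Sum>Y\<in>#mreplace_row i j Z. \<Sum>y\<in>#Y. if fst y = c then f (Y - {#y#}) (snd y) else 0) =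
    (\<Sum>x\<in>#Z. if fst x = j then (\<Sum>y\<in>#add_mset (i, snd x) (Z - {#x#}).
      if fst y = c then f (add_mset (i, snd x) (Z - {#x#}) - {#y#}) (snd y) else 0) else 0)"
    by (simp only: mreplace_row_def multiset.map_comp comp_def sum_mset_filter)
  also have "\<dots> = (\<Sum>x\<in>#Z. (if c = i then (if fst x = j then f (Z - {#x#}) (snd x) else 0) else 0) +
      (\<Sum>y\<in>#Z - {#x#}. if fst x = j \<and> fst y = c then f (add_mset (i, snd x) (Z - {#x#} - {#y#})) (snd y) else 0))"
  proof (rule arg_cong[of _ _ sum_mset], rule image_mset_cong)
    fix x
    have "(\<Sum>y\<in>#Z - {#x#}. if fst y = c then f (add_mset (i, snd x) (Z - {#x#}) - {#y#}) (snd y) else 0) =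
       (\<Sum>y\<in>#Z - {#x#}. if fst y = c then f (add_mset (i, snd x) (Z - {#x#} - {#y#})) (snd y) else 0)"
      by (rule arg_cong[of _ _ sum_mset], rule image_mset_cong) (simp add: add_mset_diff_bothsides)
    then show "(if fst x = j then (\<Sum>y\<in>#add_mset (i, snd x) (Z - {#x#}).
      if fst y = c then f (add_mset (i, snd x) (Z - {#x#}) - {#y#}) (snd y) else 0) else 0) =
      (if c = i then (if fst x = j then f (Z - {#x#}) (snd x) else 0) else 0) +
      (\<Sum>y\<in>#Z - {#x#}. if fst x = j \<and> fst y = c then f (add_mset (i, snd x) (Z - {#x#} - {#y#})) (snd y) else 0)"
      by auto
  qed
  also have "\<dots> = (if c = i then (\<Sum>z\<in>#Z. if fst z = j then f (Z - {#z#}) (snd z) else 0) else 0) +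
      (\<Sum>y\<in>#Z. \<Sum>x\<in>#Z - {#y#}. if fst x = j \<and> fst y = c then f (add_mset (i, snd x) (Z - {#x#} - {#y#})) (snd y) else 0)"
    by (auto simp: sum_mset.distrib intro: sum_mset_pairs_swap)
  also have "(\<Sum>y\<in>#Z. \<Sum>x\<in>#Z - {#y#}. if fst x = j \<and> fst y = c then f (add_mset (i, snd x) (Z - {#x#} - {#y#})) (snd y) else 0) =
      (\<Sum>z\<in>#Z. if fst z = c then (\<Sum>Y\<in>#mreplace_row i j (Z - {#z#}). f Y (snd z)) else 0)"
  proof (rule arg_cong[of _ _ sum_mset], rule image_mset_cong)
    fix y
    have "Z - {#x#} - {#y#} = Z - {#y#} - {#x#}" for x
      by (rule diff_right_commute)
    then show "(\<Sum>x\<in>#Z - {#y#}. if fst x = j \<and> fst y = c then f (add_mset (i, snd x) (Z - {#x#} - {#y#})) (snd y) else 0) =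
        (if fst y = c then \<Sum>Y\<in>#mreplace_row i j (Z - {#y#}). f Y (snd y) else 0)"
      unfolding mreplace_row_def multiset.map_comp comp_def sum_mset_filter
      by (cases "fst y = c") (simp_all only: simp_thms if_True if_False sum_mset.neutral_const)
  qed
  finally show ?thesis
    by (simp add: add.commute)
qed

text \<open>This is the recursion that defines \<open>N\<close>. At the first place the new unit
  either acts alone or meets a factor with row \<open>j\<close> already acting there, and merges
  with it into a factor with row \<open>i\<close>; elsewhere the induction applies.\<close>

lemma unit_act_nprod_act:
  "unit_act i j (nprod_act Z g) w = nprod_act (add_mset (i, j) Z) g w + (\<Sum>Y\<in>#mreplace_row i j Z. nprod_act Y g w)"
proof (induction w arbitrary: Z g)
  case Nil
  have "\<And>Y. Y \<in># mreplace_row i j Z \<Longrightarrow> Y \<noteq> {#}"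
    by (auto elim!: mreplace_row_mem)
  then show ?case
    by (simp cong: image_mset_cong)
next
  case (Cons c w)
  have add: "(\<Sum>z\<in>#Z. if fst z = c then nprod_act (add_mset (i, j) Z - {#z#}) (\<lambda>v. g (snd z # v)) w else 0) =
      (\<Sum>z\<in>#Z. if fst z = c then nprod_act (add_mset (i, j) (Z - {#z#})) (\<lambda>v. g (snd z # v)) w else 0)"
    by (rule arg_cong[of _ _ sum_mset], rule image_mset_cong) simp
  have "unit_act i j (nprod_act Z g) (c # w) =
      unit_act i j (nprod_act Z (\<lambda>v. g (c # v))) w +
      (\<Sum>z\<in>#Z. if fst z = c then unit_act i j (nprod_act (Z - {#z#}) (\<lambda>v. g (snd z # v))) w else 0) +
      (if c = i then nprod_act Z g (j # w) else 0)"
    by (simp add: unit_act_sum_mset)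
  also have "\<dots> = nprod_act (add_mset (i, j) Z) g (c # w) +
      ((\<Sum>Y\<in>#mreplace_row i j Z. nprod_act Y (\<lambda>v. g (c # v)) w) +
       ((\<Sum>z\<in>#Z. if fst z = c then \<Sum>Y\<in>#mreplace_row i j (Z - {#z#}). nprod_act Y (\<lambda>v. g (snd z # v)) w else 0) +
        (if c = i then (\<Sum>z\<in>#Z. if fst z = j then nprod_act (Z - {#z#}) (\<lambda>v. g (snd z # v)) w else 0) else 0)))"
    unfolding Cons.IH by (simp add: add sum_mset_if_add algebra_simps)
  also have "\<dots> = nprod_act (add_mset (i, j) Z) g (c # w) + (\<Sum>Y\<in>#mreplace_row i j Z. nprod_act Y g (c # w))"
    using sum_mreplace_row_remove[of c "\<lambda>Y b. nprod_act Y (\<lambda>v. g (b # v)) w" i j Z]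
    by (simp add: sum_mset.distrib)
  finally show ?case .
qed

lemma nprod_act_linear [simp]:
  "nprod_act Z (\<lambda>v. g v + g' v) w = nprod_act Z g w + nprod_act Z g' w"
  "nprod_act Z (\<lambda>v. c * g v) w = c * nprod_act Z g w"
  "nprod_act Z (\<lambda>v. 0) w = 0"
proof (induction w arbitrary: Z g g')
  case (Cons a w)
  { case 1 show ?case by (auto simp: Cons sum_mset.distrib[symmetric] intro!: arg_cong[of _ _ sum_mset] image_mset_cong) }
  { case 2 show ?case by (auto simp: Cons algebra_simps sum_mset_distrib_left intro!: arg_cong[of _ _ sum_mset] image_mset_cong) }
  { case 3 show ?case by (simp add: Cons cong: if_cong) }
qed simp_all

lemma nprod_act_empty [simp]: "nprod_act {#} g w = g w"
  by (induction w arbitrary: g) simp_all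

section \<open>Matrix entries of normally ordered products\<close>

lemma nprod_act_large: "length w < size Z \<Longrightarrow> nprod_act Z g w = 0"
proof (induction w arbitrary: Z g)
  case (Cons c w)
  then have "nprod_act (Z - {#z#}) g w = 0" if "z \<in># Z" for z g
    using that Cons by (simp add: size_Diff_singleton)
  then have "(\<Sum>z\<in>#Z. if fst z = c then nprod_act (Z - {#z#}) (\<lambda>v. g (snd z # v)) w else 0) = (\<Sum>z\<in>#Z. 0)"
    by (intro arg_cong[of _ _ sum_mset] image_mset_cong) simp
  then show ?case using Cons by simp
qed auto

text \<open>The order of the stabiliser, under place permutations, of a pair of words whose letter
  pairs form \<open>Z\<close>.\<close>

definition mset_weight :: "'b multiset \<Rightarrow> rat"
  where "mset_weight Z = (\<Prod>z\<in>set_mset Z. fact (count Z z))"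

lemma mset_weight_nonzero: "mset_weight Z \<noteq> 0"
  by (simp add: mset_weight_def)

lemma mset_weight_add: "mset_weight (add_mset z Z) = of_nat (Suc (count Z z)) * mset_weight Z"
proof -
  have "mset_weight Z = (\<Prod>y\<in>set_mset (add_mset z Z). fact (count Z y))"
    unfolding mset_weight_def by (rule prod.mono_neutral_left) (auto simp: not_in_iff)
  also have "\<dots> = fact (count Z z) * (\<Prod>y\<in>set_mset (add_mset z Z) - {z}. fact (count Z y))"
    by (rule prod.remove) auto
  finally have 1: "mset_weight Z = fact (count Z z) * (\<Prod>y\<in>set_mset (add_mset z Z) - {z}. fact (count Z y))" .
  have "mset_weight (add_mset z Z) = fact (count (add_mset z Z) z) *
      (\<Prod>y\<in>set_mset (add_mset z Z) - {z}. fact (count (add_mset z Z) y))"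
    unfolding mset_weight_def by (rule prod.remove) auto
  also have "(\<Prod>y\<in>set_mset (add_mset z Z) - {z}. fact (count (add_mset z Z) y) :: rat) =
      (\<Prod>y\<in>set_mset (add_mset z Z) - {z}. fact (count Z y))"
    by (rule prod.cong) auto
  finally show ?thesis
    using 1 by simp
qed

definition delta :: "nat list \<Rightarrow> nat list \<Rightarrow> rat"
  where "delta w = (\<lambda>v. if v = w then 1 else 0)"

text \<open>With as many factors as places, each place receives exactly one factor, and that factor
  must be the pair of letters found there. Equal factors can be exchanged, which accounts for the
  weight. So the product acts as a nonzero multiple of an orbit sum of matrix units.\<close>

lemma nprod_act_delta:
  assumes "length w = length v" "size Z = length w"
  shows "nprod_act Z (delta v) w = (if Z = mset (zip w v) then mset_weight Z else 0)"
  using assms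
proof (induction w arbitrary: v Z)
  case Nil
  then show ?case by (simp add: delta_def mset_weight_def)
next
  case (Cons c w)
  obtain b v' where v: "v = b # v'"
    using Cons.prems by (cases v) auto
  have d: "(\<lambda>xs. delta v (a # xs)) = (if a = b then delta v' else (\<lambda>_. 0))" for a
    by (auto simp: v delta_def fun_eq_iff)
  have "nprod_act Z (delta v) (c # w) =
      (\<Sum>z\<in>#Z. if fst z = c then nprod_act (Z - {#z#}) (\<lambda>xs. delta v (snd z # xs)) w else 0)"
    using Cons.prems nprod_act_large[of w Z] by simp
  also have "\<dots> = (\<Sum>z\<in>#Z. if z = (c, b) then nprod_act (Z - {#(c, b)#}) (delta v') w else 0)"
    by (intro arg_cong[of _ _ sum_mset] image_mset_cong) (auto simp: d prod_eq_iff)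
  also have "\<dots> = of_nat (count Z (c, b)) * nprod_act (Z - {#(c, b)#}) (delta v') w"
    by (simp add: sum_mset_delta)
  also have "\<dots> = (if Z = mset (zip (c # w) v) then mset_weight Z else 0)"
  proof (cases "(c, b) \<in># Z")
    case True
    then obtain Y where Z: "Z = add_mset (c, b) Y"
      by (metis insert_DiffM)
    then show ?thesis
      using Cons.IH[of v' Y] Cons.prems by (auto simp: v mset_weight_add)
  next
    case False
    then show ?thesis by (auto simp: v not_in_iff)
  qed
  finally show ?case .
qed

section \<open>Action of the free algebra\<close>

primrec letter_act :: "generator \<Rightarrow> (nat list \<Rightarrow> rat) \<Rightarrow> nat list \<Rightarrow> rat" where
  "letter_act (E i) = unit_act i (Suc i)"
| "letter_act (F i) = unit_act (Suc i) i"
| "letter_act (H i) = unit_act i i"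

primrec word_act :: "generator list \<Rightarrow> (nat list \<Rightarrow> rat) \<Rightarrow> nat list \<Rightarrow> rat" where
  "word_act [] g = g"
| "word_act (x # xs) g = letter_act x (word_act xs g)"

definition free_act :: "(generator word \<Rightarrow>\<^sub>0 rat) \<Rightarrow> (nat list \<Rightarrow> rat) \<Rightarrow> nat list \<Rightarrow> rat"
  where "free_act p g v =
    (\<Sum>w\<in>Poly_Mapping.keys p. Poly_Mapping.lookup p w * word_act (letters w) g v)"

lemma letter_act_linear [simp]:
  "letter_act x (\<lambda>v. g v + g' v) = (\<lambda>v. letter_act x g v + letter_act x g' v)"
  "letter_act x (\<lambda>v. c * g v) = (\<lambda>v. c * letter_act x g v)"
  "letter_act x (\<lambda>v. 0) = (\<lambda>v. 0)"
  by (cases x; simp add: fun_eq_iff)+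

lemma word_act_linear [simp]:
  "word_act xs (\<lambda>v. g v + g' v) = (\<lambda>v. word_act xs g v + word_act xs g' v)"
  "word_act xs (\<lambda>v. c * g v) = (\<lambda>v. c * word_act xs g v)"
  "word_act xs (\<lambda>v. 0) = (\<lambda>v. 0)"
  by (induction xs) simp_all

lemma word_act_append: "word_act (xs @ ys) g = word_act xs (word_act ys g)"
  by (induction xs) simp_all

lemma free_act_superset:
  assumes "finite A" "Poly_Mapping.keys p \<subseteq> A"
  shows "free_act p g v = (\<Sum>w\<in>A. Poly_Mapping.lookup p w * word_act (letters w) g v)"
  unfolding free_act_def using assms
  by (intro sum.mono_neutral_left) (auto simp: in_keys_iff)

lemma free_act_zero [simp]: "free_act 0 g = (\<lambda>v. 0)"
  by (simp add: free_act_def fun_eq_iff)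

lemma free_act_add [simp]: "free_act (p + q) g = (\<lambda>v. free_act p g v + free_act q g v)"
proof
  fix v
  let ?A = "Poly_Mapping.keys p \<union> Poly_Mapping.keys q"
  show "free_act (p + q) g v = free_act p g v + free_act q g v"
    using free_act_superset[of ?A "p + q" g v] free_act_superset[of ?A p g v]
      free_act_superset[of ?A q g v] Poly_Mapping.keys_add[of p q]
    by (simp add: lookup_add distrib_right sum.distrib)
qed

lemma free_act_scale [simp]: "free_act (pm_scale c p) g = (\<lambda>v. c * free_act p g v)"
proof
  fix v
  have "Poly_Mapping.keys (pm_scale c p) \<subseteq> Poly_Mapping.keys p"
    by (auto simp: in_keys_iff)
  from free_act_superset[OF _ this] show "free_act (pm_scale c p) g v = c * free_act p g v"
    by (simp add: free_act_def sum_distrib_left mult.assoc)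
qed

lemma free_act_minus [simp]: "free_act (- p) g = (\<lambda>v. - free_act p g v)"
proof -
  have "- p = pm_scale (- 1) p"
    by (rule poly_mapping_eqI) simp
  then show ?thesis
    by (simp only: free_act_scale) simp
qed

lemma free_act_diff [simp]: "free_act (p - q) g = (\<lambda>v. free_act p g v - free_act q g v)"
  using free_act_add[of p "- q" g] by simp

lemma free_act_sum: "free_act (\<Sum>a\<in>A. P a) g = (\<lambda>v. \<Sum>a\<in>A. free_act (P a) g v)"
  by (induction A rule: infinite_finite_induct) simp_all

lemma free_act_single: "free_act (Poly_Mapping.single w c) g = (\<lambda>v. c * word_act (letters w) g v)"
  by (simp add: free_act_def fun_eq_iff)

lemma free_act_one [simp]: "free_act 1 g = g"
  using free_act_single[of 0 1 g] by (simp only: single_one) (simp add: zero_word_def)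

lemma free_act_gen [simp]: "free_act (gen x) g = letter_act x g"
  by (simp add: gen_def free_act_single)

lemma sum_single: "p = (\<Sum>w\<in>Poly_Mapping.keys p. Poly_Mapping.single w (Poly_Mapping.lookup p w))"
  by (rule poly_mapping_eqI) (auto simp: lookup_sum lookup_single when_def in_keys_iff)

lemma free_act_linear [simp]:
  "free_act p (\<lambda>v. g v + g' v) = (\<lambda>v. free_act p g v + free_act p g' v)"
  "free_act p (\<lambda>v. c * g v) = (\<lambda>v. c * free_act p g v)"
  "free_act p (\<lambda>v. 0) = (\<lambda>v. 0)"
  by (simp_all add: free_act_def fun_eq_iff distrib_left sum.distrib sum_distrib_left mult.left_commute)

lemma free_act_fsum: "free_act p (\<lambda>v. \<Sum>a\<in>A. G a v) = (\<lambda>v. \<Sum>a\<in>A. free_act p (G a) v)"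
  by (induction A rule: infinite_finite_induct) simp_all

text \<open>Both sides are bilinear in \<open>p\<close> and \<open>q\<close>, which reduces the
  claim to monomials, where the product is concatenation.\<close>

lemma free_act_mult [simp]: "free_act (p * q) g = free_act p (free_act q g)"
proof -
  let ?s = "\<lambda>p w. Poly_Mapping.single w (Poly_Mapping.lookup p w)"
  have single: "free_act (?s p w * ?s q w') g = free_act (?s p w) (free_act (?s q w') g)" for w w'
    by (simp add: mult_single free_act_single plus_word_def word_act_append fun_eq_iff)
  have "free_act (p * q) g =
      free_act ((\<Sum>w\<in>Poly_Mapping.keys p. ?s p w) * (\<Sum>w'\<in>Poly_Mapping.keys q. ?s q w')) g"
    by (simp add: sum_single[symmetric])
  also have "\<dots> = free_act (\<Sum>w\<in>Poly_Mapping.keys p. ?s p w) (free_act (\<Sum>w'\<in>Poly_Mapping.keys q. ?s q w') g)"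
    by (simp add: sum_product free_act_sum free_act_fsum single fun_eq_iff) (intro allI sum.swap)
  also have "\<dots> = free_act p (free_act q g)"
    by (simp add: sum_single[symmetric])
  finally show ?thesis .
qed

lemma free_act_of_nat [simp]: "free_act (of_nat k) g = (\<lambda>v. of_nat k * g v)"
  by (induction k) (simp_all add: algebra_simps)

lemma free_act_of_int [simp]: "free_act (of_int k) g = (\<lambda>v. of_int k * g v)"
  by (cases k rule: int_cases2) simp_all

lemma free_act_2 [simp]: "free_act 2 g = (\<lambda>v. 2 * g v)"
  using free_act_of_nat[of 2 g] by simp

section \<open>Words over the index set, and the relations acting as zero\<close>

definition words :: "nat \<Rightarrow> nat \<Rightarrow> nat list set"
  where "words n d = {w. set w \<subseteq> {1..n} \<and> length w = d}"

lemma finite_words: "finite (words n d)"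
  unfolding words_def by (rule finite_lists_length_eq) simp

lemma unit_act_cong:
  assumes "\<And>v. v \<in> words n (length w) \<Longrightarrow> g v = g' v" "set w \<subseteq> {1..n}" "j \<in> {1..n}"
  shows "unit_act i j g w = unit_act i j g' w"
  using assms
proof (induction w arbitrary: g g')
  case (Cons c w)
  have "unit_act i j (\<lambda>v. g (c # v)) w = unit_act i j (\<lambda>v. g' (c # v)) w"
    by (rule Cons.IH) (use Cons.prems in \<open>auto simp: words_def\<close>)
  moreover have "g (j # w) = g' (j # w)"
    using Cons.prems by (auto simp: words_def)
  ultimately show ?case by simp
qed simp

text \<open>Coordinate functions are total on lists, but only their values on
  \<open>words n d\<close> represent a tensor. Generators with admissible indices write only letters
  in range and so never read any other value.\<close>

lemma word_act_cong:
  assumes "set xs \<subseteq> schur_generators n" "\<And>v. v \<in> words n d \<Longrightarrow> g v = g' v" "w \<in> words n d"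
  shows "word_act xs g w = word_act xs g' w"
  using assms(1,3)
proof (induction xs arbitrary: w)
  case (Cons x xs)
  obtain i j where ij: "letter_act x = unit_act i j" "j \<in> {1..n}"
    using Cons.prems by (cases x) (auto simp: schur_generators_def)
  show ?case
    unfolding word_act.simps ij(1)
    by (rule unit_act_cong) (use Cons ij in \<open>auto simp: words_def\<close>)
qed (use assms in simp)

lemma free_act_cong:
  assumes "p \<in> carrier (free_algebra (schur_generators n))"
    "\<And>v. v \<in> words n d \<Longrightarrow> g v = g' v" "w \<in> words n d"
  shows "free_act p g w = free_act p g' w"
  unfolding free_act_def
  by (rule sum.cong[OF refl], rule arg_cong[of _ _ "(*) _"], rule word_act_cong)
    (use assms in \<open>auto simp: free_algebra_def\<close>)

lemma unit_act_diagonal: "unit_act i i g w = of_nat (count_list w i) * g w"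
  by (induction w arbitrary: g) (auto simp: algebra_simps)

lemma sum_count_list:
  fixes n :: nat
  shows "set w \<subseteq> {1..n} \<Longrightarrow> (\<Sum>i=1..n. count_list w i) = length w"
proof (induction w)
  case (Cons c w)
  have "(\<Sum>i=1..n. count_list (c # w) i) = (\<Sum>i=1..n. count_list w i + (if c = i then 1 else 0))"
    by (rule sum.cong) auto
  moreover have "(\<Sum>i=1..n. if c = i then 1 else 0 :: nat) = 1"
    using Cons.prems by (subst sum.delta') auto
  ultimately show ?case
    using Cons by (simp only: sum.distrib) simp
qed simp

lemma inner_prod_eps_alpha:
  assumes "i \<in> {1..n}" "j \<in> {1..<n}"
  shows "inner_prod n (eps i) (alpha j) = (if i = j then 1 else 0) - (if i = Suc j then 1 else 0)"
proof -
  have "inner_prod n (eps i) (alpha j) = (\<Sum>k=1..n. if k = i then alpha j k else 0)"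
    unfolding inner_prod_def by (rule sum.cong) (auto simp: eps_def)
  then show ?thesis
    using assms by (simp add: alpha_def eps_def)
qed

lemma free_act_prod_list_diagonal:
  "free_act (prod_list (map (\<lambda>k. gen (H i) - of_nat k) ks)) g w =
    (\<Prod>k\<leftarrow>ks. of_nat (count_list w i) - of_nat k) * g w"
  by (induction ks arbitrary: g w) (simp_all add: unit_act_diagonal algebra_simps)

text \<open>The Serre relation is a double bracket \<open>[x, [x, y]]\<close>. Here the inner
  bracket is \<open>s\<close> times a single matrix unit that commutes with \<open>x\<close>, and
  \<open>s\<close> is a sign depending on which neighbour is involved.\<close>

lemma serre_act:
  fixes i j :: nat
  assumes "\<And>g. unit_act k l (unit_act k' l' g) = (\<lambda>w. unit_act k' l' (unit_act k l g) w + s * unit_act a b g w)"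
    and "\<And>g. unit_act k l (unit_act a b g) = unit_act a b (unit_act k l g)"
  shows "unit_act k l (unit_act k l (unit_act k' l' g)) w - 2 * unit_act k l (unit_act k' l' (unit_act k l g)) w
    + unit_act k' l' (unit_act k l (unit_act k l g)) w = 0"
  by (simp add: assms)

lemma free_act_relation:
  assumes r: "r \<in> schur_relations n d" and w: "w \<in> words n d"
  shows "free_act r g w = 0"
proof -
  have len: "length w = d" "set w \<subseteq> {1..n}"
    using w by (auto simp: words_def)
  have serre_E: "unit_act i (Suc i) (unit_act i (Suc i) (unit_act j (Suc j) g)) w
      - 2 * unit_act i (Suc i) (unit_act j (Suc j) (unit_act i (Suc i) g)) w
      + unit_act j (Suc j) (unit_act i (Suc i) (unit_act i (Suc i) g)) w = 0" if "j = Suc i \<or> i = Suc j" for i j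
    using that
  proof
    assume "j = Suc i"
    then show ?thesis
      by (intro serre_act[where s = 1 and a = i and b = "Suc j"])
        (simp_all add: fun_eq_iff unit_act_commutator[of i "Suc i" "Suc i" "Suc (Suc i)"] unit_act_commutator[of i "Suc i" i "Suc (Suc i)"])
  next
    assume "i = Suc j"
    then show ?thesis
      by (intro serre_act[where s = "- 1" and a = j and b = "Suc i"])
        (simp_all add: fun_eq_iff unit_act_commutator[of "Suc j" "Suc (Suc j)" j "Suc j"] unit_act_commutator[of "Suc j" "Suc (Suc j)" j "Suc (Suc j)"])
  qed
  have serre_F: "unit_act (Suc i) i (unit_act (Suc i) i (unit_act (Suc j) j g)) w
      - 2 * unit_act (Suc i) i (unit_act (Suc j) j (unit_act (Suc i) i g)) w
      + unit_act (Suc j) j (unit_act (Suc i) i (unit_act (Suc i) i g)) w = 0" if "j = Suc i \<or> i = Suc j" for i j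
    using that
  proof
    assume "j = Suc i"
    then show ?thesis
      by (intro serre_act[where s = "- 1" and a = "Suc j" and b = i])
        (simp_all add: fun_eq_iff unit_act_commutator[of "Suc i" i "Suc (Suc i)" "Suc i"] unit_act_commutator[of "Suc i" i "Suc (Suc i)" i])
  next
    assume "i = Suc j"
    then show ?thesis
      by (intro serre_act[where s = 1 and a = "Suc i" and b = j])
        (simp_all add: fun_eq_iff unit_act_commutator[of "Suc (Suc j)" "Suc j" "Suc j" j] unit_act_commutator[of "Suc (Suc j)" "Suc j" "Suc (Suc j)" j])
  qed
  have adj: "\<bar>int i - int j\<bar> = 1 \<longleftrightarrow> j = Suc i \<or> i = Suc j" for i j
    by linarith
  have trace: "(\<Sum>i=1..n. unit_act i i g w) = of_nat d * g w"
    using sum_count_list[OF len(2)] len(1)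
    by (simp add: unit_act_diagonal sum_distrib_right[symmetric] of_nat_sum[symmetric] del: of_nat_sum)
  \<comment> \<open>\<open>H i\<close> acts at \<open>w\<close> as the number of letters
    \<open>i\<close> in \<open>w\<close>, an integer between 0 and \<open>d\<close> and hence a root
    of the polynomial in (R7).\<close>
  have minimal: "(\<Prod>k\<leftarrow>[0..<d + 1]. of_nat (count_list w i) - of_nat k :: rat) = 0" for i
  proof -
    have "count_list w i \<in> set [0..<d + 1]"
      using count_le_length[of w i] len by auto
    then show ?thesis
      unfolding prod_list_zero_iff by (auto intro!: image_eqI[of _ _ "count_list w i"])
  qed
  consider
      i j where "r = gen (H i) * gen (H j) - gen (H j) * gen (H i)"
    | i j where "r = gen (E i) * gen (F j) - gen (F j) * gen (E i) - (if i = j then gen (H j) - gen (H (j + 1)) else 0)"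
    | i j where "r = gen (H i) * gen (E j) - gen (E j) * gen (H i) - of_int (inner_prod n (eps i) (alpha j)) * gen (E j)"
        "i \<in> {1..n}" "j \<in> {1..<n}"
    | i j where "r = gen (H i) * gen (F j) - gen (F j) * gen (H i) + of_int (inner_prod n (eps i) (alpha j)) * gen (F j)"
        "i \<in> {1..n}" "j \<in> {1..<n}"
    | i j where "r = (gen (E i))^2 * gen (E j) - 2 * gen (E i) * gen (E j) * gen (E i) + gen (E j) * (gen (E i))^2"
        "j = Suc i \<or> i = Suc j"
    | i j where "r = gen (E i) * gen (E j) - gen (E j) * gen (E i)" "\<not> (j = Suc i \<or> i = Suc j)"
    | i j where "r = (gen (F i))^2 * gen (F j) - 2 * gen (F i) * gen (F j) * gen (F i) + gen (F j) * (gen (F i))^2"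
        "j = Suc i \<or> i = Suc j"
    | i j where "r = gen (F i) * gen (F j) - gen (F j) * gen (F i)" "\<not> (j = Suc i \<or> i = Suc j)"
    | "r = (\<Sum>i = 1..n. gen (H i)) - of_nat d"
    | i where "r = prod_list (map (\<lambda>k. gen (H i) - of_nat k) [0..<d + 1])"
    using r unfolding schur_relations_def Let_def adj by blast
  then show ?thesis
  proof cases
    case 1
    then show ?thesis by (auto simp: unit_act_commutator[of i i j j])
  next
    case 2
    then show ?thesis by (auto simp: unit_act_commutator[of i "Suc i" "Suc j" j])
  next
    case 3
    then show ?thesis by (auto simp: inner_prod_eps_alpha unit_act_commutator[of i i j "Suc j"])
  next
    case 4
    then show ?thesis by (auto simp: inner_prod_eps_alpha unit_act_commutator[of i i "Suc j" j])
  next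
    case 5
    then show ?thesis using serre_E[of j i] by (simp add: power2_eq_square)
  next
    case 6
    then show ?thesis by (auto simp: unit_act_commutator[of i "Suc i" j "Suc j"])
  next
    case 7
    then show ?thesis using serre_F[of j i] by (simp add: power2_eq_square)
  next
    case 8
    then show ?thesis by (auto simp: unit_act_commutator[of "Suc i" i "Suc j" j])
  next
    case 9
    then show ?thesis using trace by (simp add: free_act_sum)
  next
    case 10
    then show ?thesis by (simp only: free_act_prod_list_diagonal minimal mult_zero_left)
  qed
qed

section \<open>Lifts of matrix units and their products to the free algebra\<close>

abbreviation free_unit :: "nat \<Rightarrow> nat \<Rightarrow> (generator word \<Rightarrow>\<^sub>0 rat)"
  where "free_unit \<equiv> gl_unit (\<lambda>i. gen (E i)) (\<lambda>i. gen (F i)) (\<lambda>i. gen (H i))"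

lemma free_act_upper: "i < j \<Longrightarrow> free_act (upper (\<lambda>i. gen (E i)) i j) g = unit_act i j g"
proof (induction j arbitrary: g)
  case (Suc j)
  show ?case
  proof (cases "i = j")
    case False
    then have "free_act (upper (\<lambda>i. gen (E i)) i (Suc j)) g =
        (\<lambda>v. unit_act i j (unit_act j (Suc j) g) v - unit_act j (Suc j) (unit_act i j g) v)"
      using Suc by (simp add: upper_Suc bracket_def)
    then show ?thesis
      using False Suc.prems by (simp add: fun_eq_iff unit_act_commutator[of i j])
  qed simp
qed simp

lemma free_act_lower: "i < j \<Longrightarrow> free_act (upper (\<lambda>i. - gen (F i)) i j) g = (\<lambda>v. - unit_act j i g v)"
proof (induction j arbitrary: g)
  case (Suc j)
  show ?case
  proof (cases "i = j")
    case False
    then have "free_act (upper (\<lambda>i. - gen (F i)) i (Suc j)) g =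
        (\<lambda>v. unit_act j i (unit_act (Suc j) j g) v - unit_act (Suc j) j (unit_act j i g) v)"
      using Suc by (simp add: upper_Suc bracket_def)
    then show ?thesis
      using False Suc.prems by (simp add: fun_eq_iff unit_act_commutator[of j i])
  qed simp
qed simp

lemma free_act_unit: "free_act (free_unit i j) g = unit_act i j g"
  by (auto simp: gl_unit_def free_act_upper free_act_lower)

text \<open>The lifted units need not obey the matrix unit relations in the free algebra, but their
  actions do; hence only the multiset of \<open>zs\<close> matters on the right.\<close>

lemma free_act_nprod: "free_act (nprod free_unit 1 zs) g v = nprod_act (mset zs) g v"
proof (induction "length zs" arbitrary: zs g v rule: less_induct)
  case less
  show ?case
  proof (cases zs)
    case Nil
    then show ?thesis by simp
  next
    case (Cons z ys)
    have 1: "free_act (sum_list ps) g = (\<lambda>v. \<Sum>p\<leftarrow>ps. free_act p g v)" for ps g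
      by (induction ps) simp_all
    have 2: "free_act (nprod free_unit 1 ys) g = nprod_act (mset ys) g"
      using less Cons by (simp add: fun_eq_iff)
    have "map (\<lambda>xs. free_act (nprod free_unit 1 xs) g v) (replace_row (fst z) (snd z) ys) =
        map (\<lambda>Y. nprod_act Y g v) (map mset (replace_row (fst z) (snd z) ys))"
      using less Cons length_replace_row by auto
    then have "(\<Sum>xs\<leftarrow>replace_row (fst z) (snd z) ys. free_act (nprod free_unit 1 xs) g v) =
        (\<Sum>Y\<in>#mreplace_row (fst z) (snd z) (mset ys). nprod_act Y g v)"
      by (simp only: mset_replace_row[symmetric] mset_map[symmetric] sum_mset_sum_list)
    then show ?thesis
      by (simp add: Cons 1 2 comp_def free_act_unit unit_act_nprod_act)
  qed
qed

section \<open>Algebras given by carrier records as rings\<close>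

definition q_algebra :: "(rat, 'a) module \<Rightarrow> bool"
  where "q_algebra R \<longleftrightarrow> ring R \<and>
    (\<forall>c. \<forall>x\<in>carrier R. c \<odot>\<^bsub>R\<^esub> x \<in> carrier R) \<and>
    (\<forall>c. \<forall>x\<in>carrier R. \<forall>y\<in>carrier R. c \<odot>\<^bsub>R\<^esub> (x \<oplus>\<^bsub>R\<^esub> y) = c \<odot>\<^bsub>R\<^esub> x \<oplus>\<^bsub>R\<^esub> c \<odot>\<^bsub>R\<^esub> y) \<and>
    (\<forall>b c. \<forall>x\<in>carrier R. (b + c) \<odot>\<^bsub>R\<^esub> x = b \<odot>\<^bsub>R\<^esub> x \<oplus>\<^bsub>R\<^esub> c \<odot>\<^bsub>R\<^esub> x) \<and>
    (\<forall>b c. \<forall>x\<in>carrier R. (b * c) \<odot>\<^bsub>R\<^esub> x = b \<odot>\<^bsub>R\<^esub> (c \<odot>\<^bsub>R\<^esub> x)) \<and>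
    (\<forall>x\<in>carrier R. 1 \<odot>\<^bsub>R\<^esub> x = x) \<and>
    (\<forall>c. \<forall>x\<in>carrier R. \<forall>y\<in>carrier R. c \<odot>\<^bsub>R\<^esub> (x \<otimes>\<^bsub>R\<^esub> y) = (c \<odot>\<^bsub>R\<^esub> x) \<otimes>\<^bsub>R\<^esub> y) \<and>
    (\<forall>c. \<forall>x\<in>carrier R. \<forall>y\<in>carrier R. c \<odot>\<^bsub>R\<^esub> (x \<otimes>\<^bsub>R\<^esub> y) = x \<otimes>\<^bsub>R\<^esub> (c \<odot>\<^bsub>R\<^esub> y))"

lemma q_algebra_ring: "q_algebra R \<Longrightarrow> ring R"
  by (simp add: q_algebra_def)

lemma q_algebra_closed: "q_algebra R \<Longrightarrow> x \<in> carrier R \<Longrightarrow> c \<odot>\<^bsub>R\<^esub> x \<in> carrier R"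
  by (simp add: q_algebra_def)

lemma q_algebra_laws:
  assumes "q_algebra A" "a \<in> carrier A" "b \<in> carrier A"
  shows "c \<odot>\<^bsub>A\<^esub> (a \<oplus>\<^bsub>A\<^esub> b) = c \<odot>\<^bsub>A\<^esub> a \<oplus>\<^bsub>A\<^esub> c \<odot>\<^bsub>A\<^esub> b"
    and "(c + c') \<odot>\<^bsub>A\<^esub> a = c \<odot>\<^bsub>A\<^esub> a \<oplus>\<^bsub>A\<^esub> c' \<odot>\<^bsub>A\<^esub> a"
    and "(c * c') \<odot>\<^bsub>A\<^esub> a = c \<odot>\<^bsub>A\<^esub> (c' \<odot>\<^bsub>A\<^esub> a)" "1 \<odot>\<^bsub>A\<^esub> a = a"
    and "c \<odot>\<^bsub>A\<^esub> (a \<otimes>\<^bsub>A\<^esub> b) = (c \<odot>\<^bsub>A\<^esub> a) \<otimes>\<^bsub>A\<^esub> b"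
    and "c \<odot>\<^bsub>A\<^esub> (a \<otimes>\<^bsub>A\<^esub> b) = a \<otimes>\<^bsub>A\<^esub> (c \<odot>\<^bsub>A\<^esub> b)"
  using assms unfolding q_algebra_def by blast+

text \<open>The product of all \<open>\<rat>\<close>-algebras with elements in a given type is an instance of the
  type class of rings (without unit). Every single algebra embeds into it as a direct factor, so
  that calculations in an algebra given by a carrier record can be done in a type.\<close>

typedef 'a algebras = "{f :: (rat, 'a) module \<Rightarrow> 'a.
    (\<forall>R. q_algebra R \<longrightarrow> f R \<in> carrier R) \<and> (\<forall>R. \<not> q_algebra R \<longrightarrow> f R = undefined)}"
proof
  show "(\<lambda>R. if q_algebra R then \<zero>\<^bsub>R\<^esub> else undefined) \<in> {f :: (rat, 'a) module \<Rightarrow> 'a.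
      (\<forall>R. q_algebra R \<longrightarrow> f R \<in> carrier R) \<and> (\<forall>R. \<not> q_algebra R \<longrightarrow> f R = undefined)}"
    by (auto simp: q_algebra_def ring.ring_simprules)
qed

setup_lifting type_definition_algebras

instantiation algebras :: (type) ring
begin

lift_definition zero_algebras :: "'a algebras"
  is "\<lambda>R. if q_algebra R then \<zero>\<^bsub>R\<^esub> else undefined"
  by (auto simp: q_algebra_ring ring.ring_simprules)

lift_definition plus_algebras :: "'a algebras \<Rightarrow> 'a algebras \<Rightarrow> 'a algebras"
  is "\<lambda>f g R. if q_algebra R then f R \<oplus>\<^bsub>R\<^esub> g R else undefined"
  by (auto simp: q_algebra_ring ring.ring_simprules)

lift_definition uminus_algebras :: "'a algebras \<Rightarrow> 'a algebras"
  is "\<lambda>f R. if q_algebra R then \<ominus>\<^bsub>R\<^esub> f R else undefined"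
  by (auto simp: q_algebra_ring ring.ring_simprules)

lift_definition minus_algebras :: "'a algebras \<Rightarrow> 'a algebras \<Rightarrow> 'a algebras"
  is "\<lambda>f g R. if q_algebra R then f R \<ominus>\<^bsub>R\<^esub> g R else undefined"
  by (auto simp: q_algebra_ring ring.ring_simprules)

lift_definition times_algebras :: "'a algebras \<Rightarrow> 'a algebras \<Rightarrow> 'a algebras"
  is "\<lambda>f g R. if q_algebra R then f R \<otimes>\<^bsub>R\<^esub> g R else undefined"
  by (auto simp: q_algebra_ring ring.ring_simprules)

instance
proof
  fix a b c :: "'a algebras"
  show "a + b + c = a + (b + c)" "a + b = b + a" "0 + a = a" "- a + a = 0" "a - b = a + - b"
    "a * b * c = a * (b * c)" "(a + b) * c = a * c + b * c" "a * (b + c) = a * b + a * c"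
    by (transfer; force dest: q_algebra_ring simp: fun_eq_iff ring.ring_simprules)+
qed

end

lift_definition algebras_scale :: "rat \<Rightarrow> 'a algebras \<Rightarrow> 'a algebras"
  is "\<lambda>c f R. if q_algebra R then c \<odot>\<^bsub>R\<^esub> f R else undefined"
  by (auto dest: q_algebra_closed)

lemma rat_algebra_algebras: "rat_algebra (algebras_scale :: rat \<Rightarrow> 'a algebras \<Rightarrow> _)"
proof
  fix a b :: rat and x y :: "'a algebras"
  show "algebras_scale a (x + y) = algebras_scale a x + algebras_scale a y"
    by transfer (simp add: fun_eq_iff q_algebra_laws(1))
  show "algebras_scale (a + b) x = algebras_scale a x + algebras_scale b x"
    by transfer (simp add: fun_eq_iff, blast intro: q_algebra_laws(2))
  show "algebras_scale a (algebras_scale b x) = algebras_scale (a * b) x"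
    by transfer (simp add: fun_eq_iff, metis q_algebra_laws(3))
  show "algebras_scale 1 x = x"
    by transfer (simp add: fun_eq_iff, metis q_algebra_laws(4))
  show "algebras_scale a (x * y) = algebras_scale a x * y"
    by transfer (simp add: fun_eq_iff, blast intro: q_algebra_laws(5))
  show "algebras_scale a (x * y) = x * algebras_scale a y"
    by transfer (simp add: fun_eq_iff, blast intro: q_algebra_laws(6))
qed

text \<open>The unit of \<open>R\<close> is sent to an idempotent, supported in a single factor.
  This idempotent is the \<open>u\<close> of the computations above.\<close>

lift_definition algebra_emb :: "(rat, 'a) module \<Rightarrow> 'a \<Rightarrow> 'a algebras"
  is "\<lambda>R x S. if q_algebra S then if S = R \<and> x \<in> carrier R then x else \<zero>\<^bsub>S\<^esub> else undefined"
  by (auto simp: q_algebra_ring ring.ring_simprules)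

lemma algebra_emb_hom:
  assumes "q_algebra R" "x \<in> carrier R" "y \<in> carrier R"
  shows "algebra_emb R (x \<oplus>\<^bsub>R\<^esub> y) = algebra_emb R x + algebra_emb R y"
    and "algebra_emb R (x \<otimes>\<^bsub>R\<^esub> y) = algebra_emb R x * algebra_emb R y"
    and "algebra_emb R (c \<odot>\<^bsub>R\<^esub> x) = algebras_scale c (algebra_emb R x)"
    and "algebra_emb R x = algebra_emb R y \<longleftrightarrow> x = y"
proof -
  have scale_zero: "c \<odot>\<^bsub>S\<^esub> \<zero>\<^bsub>S\<^esub> = \<zero>\<^bsub>S\<^esub>" if "q_algebra S" for S :: "(rat, 'a) module"
  proof -
    interpret S: ring S
      using that by (rule q_algebra_ring)
    \<comment> \<open>Writing zero as a product turns its scalar multiple into a ring multiple of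
      zero.\<close>
    have "c \<odot>\<^bsub>S\<^esub> (\<zero>\<^bsub>S\<^esub> \<otimes>\<^bsub>S\<^esub> \<zero>\<^bsub>S\<^esub>) = (c \<odot>\<^bsub>S\<^esub> \<zero>\<^bsub>S\<^esub>) \<otimes>\<^bsub>S\<^esub> \<zero>\<^bsub>S\<^esub>"
      using that S.zero_closed unfolding q_algebra_def by blast
    then show ?thesis
      using q_algebra_closed[OF that S.zero_closed, of c] by simp
  qed
  have R: "ring R"
    using assms by (simp add: q_algebra_ring)
  show "algebra_emb R (x \<oplus>\<^bsub>R\<^esub> y) = algebra_emb R x + algebra_emb R y"
    using assms R by transfer (auto dest!: q_algebra_ring simp: fun_eq_iff ring.ring_simprules)
  show "algebra_emb R (x \<otimes>\<^bsub>R\<^esub> y) = algebra_emb R x * algebra_emb R y"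
    using assms R by transfer (auto dest!: q_algebra_ring simp: fun_eq_iff ring.ring_simprules)
  show "algebra_emb R (c \<odot>\<^bsub>R\<^esub> x) = algebras_scale c (algebra_emb R x)"
    using assms scale_zero q_algebra_closed[OF assms(1,2)]
    by transfer (auto simp: fun_eq_iff)
  show "algebra_emb R x = algebra_emb R y \<longleftrightarrow> x = y"
    using assms by transfer (auto simp: fun_eq_iff)
qed

lemma algebra_emb_zero: "algebra_emb R \<zero>\<^bsub>R\<^esub> = 0"
  by transfer (auto simp: fun_eq_iff)

text \<open>Being a ring depends on the five ring fields only, so a record may be extended by a
  scalar multiplication without affecting it.\<close>

lemma ring_cong:
  assumes "carrier R = carrier S" "monoid.mult R = monoid.mult S" "one R = one S"
    "zero R = zero S" "add R = add S"
  shows "ring R \<longleftrightarrow> ring S"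
  unfolding ring_def abelian_group_def abelian_monoid_def abelian_group_axioms_def
    comm_group_def Group.comm_monoid_def group_def monoid_def Group.comm_monoid_axioms_def
    group_axioms_def Units_def ring_axioms_def
  by (simp add: assms)

section \<open>Quotients of algebras by ideals\<close>

lemma quotient_algebra_simps [simp]:
  "carrier (quotient_algebra A I) = a_rcosets\<^bsub>A\<^esub> I"
  "monoid.mult (quotient_algebra A I) = rcoset_mult A I"
  "one (quotient_algebra A I) = I +>\<^bsub>A\<^esub> \<one>\<^bsub>A\<^esub>"
  "zero (quotient_algebra A I) = I"
  "add (quotient_algebra A I) = set_add A"
  "smult (quotient_algebra A I) = rcoset_smult A I"
  by (simp_all add: quotient_algebra_def ring.extend_def module.fields_def FactRing_def)

lemma quotient_algebra_ring: "ring (quotient_algebra A I) \<longleftrightarrow> ring (A Quot I)"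
  by (rule ring_cong) (simp_all add: FactRing_def)

context
  fixes A :: "(rat, 'a) module" and I
  assumes A: "q_algebra A" and I: "ideal I A"
begin

interpretation ideal I A
  by (rule I)

text \<open>Scaling is multiplication by the scaled unit, so a ring ideal is automatically a
  subspace. This is what makes the scalar multiplication of cosets well defined.\<close>

lemma ideal_smult_closed: "i \<in> I \<Longrightarrow> c \<odot>\<^bsub>A\<^esub> i \<in> I"
proof -
  assume i: "i \<in> I"
  then have "c \<odot>\<^bsub>A\<^esub> (\<one>\<^bsub>A\<^esub> \<otimes>\<^bsub>A\<^esub> i) = (c \<odot>\<^bsub>A\<^esub> \<one>\<^bsub>A\<^esub>) \<otimes>\<^bsub>A\<^esub> i"
    using A Icarr[OF i] one_closed unfolding q_algebra_def by blast
  then show ?thesis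
    using i I_l_closed[OF i q_algebra_closed[OF A one_closed, of c]] by simp
qed

lemma rcoset_smult_coset:
  assumes "a \<in> carrier A"
  shows "rcoset_smult A I c (I +>\<^bsub>A\<^esub> a) = I +>\<^bsub>A\<^esub> (c \<odot>\<^bsub>A\<^esub> a)"
proof -
  have "I +>\<^bsub>A\<^esub> (c \<odot>\<^bsub>A\<^esub> x) = I +>\<^bsub>A\<^esub> (c \<odot>\<^bsub>A\<^esub> a)" if x: "x \<in> I +>\<^bsub>A\<^esub> a" for x
  proof -
    obtain i where i: "i \<in> I" "x = i \<oplus>\<^bsub>A\<^esub> a"
      using x by (auto simp: a_r_coset_def')
    have "c \<odot>\<^bsub>A\<^esub> x = c \<odot>\<^bsub>A\<^esub> i \<oplus>\<^bsub>A\<^esub> c \<odot>\<^bsub>A\<^esub> a"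
      using i(2) Icarr[OF i(1)] assms A unfolding q_algebra_def by blast
    then have "c \<odot>\<^bsub>A\<^esub> x \<in> I +>\<^bsub>A\<^esub> (c \<odot>\<^bsub>A\<^esub> a)"
      using ideal_smult_closed[OF i(1)] by (auto simp: a_r_coset_def')
    then show ?thesis
      using a_repr_independence q_algebra_closed[OF A assms] a_subgroup by metis
  qed
  moreover have "a \<in> I +>\<^bsub>A\<^esub> a"
    using assms by (rule a_rcos_self)
  ultimately show ?thesis
    unfolding rcoset_smult_def by blast
qed

lemma quotient_algebra_cosets:
  assumes "a \<in> carrier A" "b \<in> carrier A"
  shows "(I +>\<^bsub>A\<^esub> a) \<oplus>\<^bsub>quotient_algebra A I\<^esub> (I +>\<^bsub>A\<^esub> b) = I +>\<^bsub>A\<^esub> (a \<oplus>\<^bsub>A\<^esub> b)"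
    and "(I +>\<^bsub>A\<^esub> a) \<otimes>\<^bsub>quotient_algebra A I\<^esub> (I +>\<^bsub>A\<^esub> b) = I +>\<^bsub>A\<^esub> (a \<otimes>\<^bsub>A\<^esub> b)"
    and "c \<odot>\<^bsub>quotient_algebra A I\<^esub> (I +>\<^bsub>A\<^esub> a) = I +>\<^bsub>A\<^esub> (c \<odot>\<^bsub>A\<^esub> a)"
  using assms by (simp_all add: a_rcos_sum rcoset_mult_add rcoset_smult_coset)

lemma quotient_q_algebra: "q_algebra (quotient_algebra A I)"
proof -
  have carrier: "x \<in> carrier (quotient_algebra A I) \<longleftrightarrow> (\<exists>a\<in>carrier A. x = I +>\<^bsub>A\<^esub> a)" for x
    by (auto simp: A_RCOSETS_def')
  have closed: "c \<odot>\<^bsub>A\<^esub> a \<in> carrier A" if "a \<in> carrier A" for a c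
    using q_algebra_closed[OF A that] .
  note laws = q_algebra_laws[OF A]
  show ?thesis
    unfolding q_algebra_def
  proof (intro conjI allI ballI)
    show "ring (quotient_algebra A I)"
      by (simp add: quotient_algebra_ring quotient_is_ring)
    show "c \<odot>\<^bsub>quotient_algebra A I\<^esub> (x \<otimes>\<^bsub>quotient_algebra A I\<^esub> y) =
        x \<otimes>\<^bsub>quotient_algebra A I\<^esub> (c \<odot>\<^bsub>quotient_algebra A I\<^esub> y)"
      if "x \<in> carrier (quotient_algebra A I)" "y \<in> carrier (quotient_algebra A I)" for c x y
      using that unfolding carrier
      by (elim bexE, hypsubst) (simp only: quotient_algebra_cosets closed m_closed laws(6))
  qed (unfold carrier, (elim bexE, hypsubst, simp only: quotient_algebra_cosets closed a_closed m_closed laws(1-5); blast intro: closed)+)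
qed

lemma coset_eq_iff:
  assumes "a \<in> carrier A"
  shows "I +>\<^bsub>A\<^esub> a = I \<longleftrightarrow> a \<in> I"
  using assms a_rcos_self[OF assms] a_coset_join2[OF assms a_subgroup] by auto

lemma coset_emb_hom:
  assumes "a \<in> carrier A" "b \<in> carrier A"
  shows "algebra_emb (quotient_algebra A I) (I +>\<^bsub>A\<^esub> (a \<oplus>\<^bsub>A\<^esub> b)) =
      algebra_emb (quotient_algebra A I) (I +>\<^bsub>A\<^esub> a) + algebra_emb (quotient_algebra A I) (I +>\<^bsub>A\<^esub> b)"
    and "algebra_emb (quotient_algebra A I) (I +>\<^bsub>A\<^esub> (a \<otimes>\<^bsub>A\<^esub> b)) =
      algebra_emb (quotient_algebra A I) (I +>\<^bsub>A\<^esub> a) * algebra_emb (quotient_algebra A I) (I +>\<^bsub>A\<^esub> b)"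
    and "algebra_emb (quotient_algebra A I) (I +>\<^bsub>A\<^esub> (c \<odot>\<^bsub>A\<^esub> a)) =
      algebras_scale c (algebra_emb (quotient_algebra A I) (I +>\<^bsub>A\<^esub> a))"
    and "algebra_emb (quotient_algebra A I) (I +>\<^bsub>A\<^esub> a) = 0 \<longleftrightarrow> a \<in> I"
proof -
  let ?Q = "quotient_algebra A I"
  have Q: "I +>\<^bsub>A\<^esub> x \<in> carrier ?Q" if "x \<in> carrier A" for x
    using that by (auto simp: A_RCOSETS_def')
  note hom = algebra_emb_hom[OF quotient_q_algebra Q Q, OF assms]
  show "algebra_emb ?Q (I +>\<^bsub>A\<^esub> (a \<oplus>\<^bsub>A\<^esub> b)) = algebra_emb ?Q (I +>\<^bsub>A\<^esub> a) + algebra_emb ?Q (I +>\<^bsub>A\<^esub> b)"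
    using hom(1) quotient_algebra_cosets(1)[OF assms] by simp
  show "algebra_emb ?Q (I +>\<^bsub>A\<^esub> (a \<otimes>\<^bsub>A\<^esub> b)) = algebra_emb ?Q (I +>\<^bsub>A\<^esub> a) * algebra_emb ?Q (I +>\<^bsub>A\<^esub> b)"
    using hom(2) quotient_algebra_cosets(2)[OF assms] by simp
  show "algebra_emb ?Q (I +>\<^bsub>A\<^esub> (c \<odot>\<^bsub>A\<^esub> a)) = algebras_scale c (algebra_emb ?Q (I +>\<^bsub>A\<^esub> a))"
    using hom(3)[of c] quotient_algebra_cosets(3)[OF assms] by simp
  have "algebra_emb ?Q I = 0"
    using algebra_emb_zero[of ?Q] by simp
  moreover have "I \<in> carrier ?Q"
    using Q[OF zero_closed] coset_eq_iff[of "\<zero>\<^bsub>A\<^esub>"] by simp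
  ultimately show "algebra_emb ?Q (I +>\<^bsub>A\<^esub> a) = 0 \<longleftrightarrow> a \<in> I"
    using algebra_emb_hom(4)[OF quotient_q_algebra Q[OF assms(1)], of I] coset_eq_iff[OF assms(1)] by simp
qed

end

lemma pm_scale_single: "pm_scale c (Poly_Mapping.single w b) = Poly_Mapping.single w (c * b)"
  by (rule poly_mapping_eqI) (simp add: lookup_single when_def)

text \<open>Multiples of the empty word are central, so the compatibility of scalars with products
  reduces to associativity.\<close>

lemma pm_scale_eq_mult:
  fixes p :: "'x::monoid_add \<Rightarrow>\<^sub>0 rat"
  shows "pm_scale c p = Poly_Mapping.single 0 c * p" "pm_scale c p = p * Poly_Mapping.single 0 c"
proof -
  let ?s = "\<Sum>w\<in>Poly_Mapping.keys p. Poly_Mapping.single w (Poly_Mapping.lookup p w)"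
  have "pm_scale c ?s = Poly_Mapping.single 0 c * ?s" "pm_scale c ?s = ?s * Poly_Mapping.single 0 c"
    by (simp_all add: pm.scale_sum_right pm_scale_single sum_distrib_left sum_distrib_right mult_single mult.commute)
  then show "pm_scale c p = Poly_Mapping.single 0 c * p" "pm_scale c p = p * Poly_Mapping.single 0 c"
    by (simp_all only: sum_single[symmetric])
qed

lemma keys_pm_scale: "Poly_Mapping.keys (pm_scale c x) \<subseteq> Poly_Mapping.keys x"
  by (auto simp: in_keys_iff)

lemma free_q_algebra: "q_algebra (free_algebra (G :: 'g set))"
proof -
  have "pm_scale c x * y = x * pm_scale c y" for c and x y :: "'g word \<Rightarrow>\<^sub>0 rat"
    by (simp only: pm_scale_eq_mult(2)[of c x] pm_scale_eq_mult(1)[of c y] mult.assoc)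
  moreover have "pm_scale c (x * y) = x * pm_scale c y" for c and x y :: "'g word \<Rightarrow>\<^sub>0 rat"
    by (simp add: pm_scale_eq_mult(2) mult.assoc)
  ultimately show ?thesis
    unfolding q_algebra_def
    by (auto simp: free_algebra_ring) (auto simp: free_algebra_def pm.scale_right_distrib pm.scale_left_distrib
        dest: subsetD[OF keys_pm_scale])
qed

section \<open>The presented algebra\<close>

context
  fixes G :: "'g set"
begin

abbreviation "FA \<equiv> carrier (free_algebra G)"

lemma free_carrier_add: "x \<in> FA \<Longrightarrow> y \<in> FA \<Longrightarrow> x + y \<in> FA"
  using ring.ring_simprules(1)[OF free_algebra_ring, of x G y] by (simp add: free_algebra_def)

lemma free_carrier_mult: "x \<in> FA \<Longrightarrow> y \<in> FA \<Longrightarrow> x * y \<in> FA"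
  using ring.ring_simprules(5)[OF free_algebra_ring, of x G y] by (simp add: free_algebra_def)

lemma free_carrier_uminus: "x \<in> FA \<Longrightarrow> - x \<in> FA"
  by (auto simp: free_algebra_def in_keys_iff)

lemma free_carrier_diff: "x \<in> FA \<Longrightarrow> y \<in> FA \<Longrightarrow> x - y \<in> FA"
  using free_carrier_add[OF _ free_carrier_uminus, of x y] by simp

lemma free_carrier_scale: "x \<in> FA \<Longrightarrow> pm_scale c x \<in> FA"
  by (auto simp: free_algebra_def dest: subsetD[OF keys_pm_scale])

lemma free_carrier_zero: "0 \<in> FA"
  by (simp add: free_algebra_def)

lemma free_carrier_one: "1 \<in> FA"
  by (simp add: free_algebra_def zero_word_def)

lemma free_carrier_gen: "g \<in> G \<Longrightarrow> gen g \<in> FA"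
  by (simp add: free_algebra_def gen_def)

lemma free_carrier_sum: "(\<And>a. a \<in> S \<Longrightarrow> f a \<in> FA) \<Longrightarrow> sum f S \<in> FA"
  by (induction S rule: infinite_finite_induct) (auto simp: free_carrier_zero intro: free_carrier_add)

lemma free_carrier_sum_list: "(\<And>a. a \<in> set as \<Longrightarrow> f a \<in> FA) \<Longrightarrow> (\<Sum>a\<leftarrow>as. f a) \<in> FA"
  by (induction as) (auto simp: free_carrier_zero intro: free_carrier_add)

lemma free_carrier_prod_list: "(\<And>a. a \<in> set as \<Longrightarrow> f a \<in> FA) \<Longrightarrow> prod_list (map f as) \<in> FA"
  by (induction as) (auto simp: free_carrier_one intro: free_carrier_mult)

lemma free_carrier_power: "x \<in> FA \<Longrightarrow> x ^ k \<in> FA"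
  by (induction k) (auto simp: free_carrier_one intro: free_carrier_mult)

lemma free_carrier_of_nat: "of_nat k \<in> FA"
  by (induction k) (auto simp: free_carrier_zero free_carrier_one intro: free_carrier_add)

lemma free_carrier_of_int: "of_int k \<in> FA"
  by (cases k rule: int_cases2) (auto simp: free_carrier_of_nat intro: free_carrier_uminus)

lemma free_carrier_2: "2 \<in> FA"
  using free_carrier_of_nat[of 2] by simp

lemmas free_carrier_intros = free_carrier_add free_carrier_mult free_carrier_uminus
  free_carrier_diff free_carrier_scale free_carrier_zero free_carrier_one free_carrier_sum
  free_carrier_prod_list free_carrier_power free_carrier_of_nat free_carrier_of_int free_carrier_2

end

lemma schur_relations_carrier:
  "schur_relations n d \<subseteq> carrier (free_algebra (schur_generators n))"
proof -
  have "gen (E i) \<in> FA (schur_generators n)" "gen (F i) \<in> FA (schur_generators n)"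
    if "i \<in> {1..<n}" for i
    using that by (auto intro!: free_carrier_gen simp: schur_generators_def)
  moreover have "gen (H i) \<in> FA (schur_generators n)" if "i \<in> {1..n}" for i
    using that by (auto intro!: free_carrier_gen simp: schur_generators_def)
  ultimately show ?thesis
    unfolding schur_relations_def Let_def
    by (intro Un_least subsetI; clarsimp simp del: of_nat_Suc upt_Suc; intro conjI impI free_carrier_intros; auto)
qed

locale schur_presentation =
  fixes n d :: nat
begin

abbreviation "A \<equiv> free_algebra (schur_generators n)"
abbreviation "J \<equiv> Idl\<^bsub>A\<^esub> (schur_relations n d)"

lemma ideal_J: "ideal J A"
  by (rule ring.genideal_ideal[OF free_algebra_ring schur_relations_carrier])

text \<open>The quotient map followed by the embedding into a type of class \<open>ring\<close>. It
  is multiplicative and has kernel \<open>J\<close> on the carrier of the free algebra.\<close>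

definition quot :: "(generator word \<Rightarrow>\<^sub>0 rat) \<Rightarrow> (generator word \<Rightarrow>\<^sub>0 rat) set algebras"
  where "quot p = algebra_emb (quotient_algebra A J) (J +>\<^bsub>A\<^esub> p)"

sublocale rat_algebra "algebras_scale :: rat \<Rightarrow> (generator word \<Rightarrow>\<^sub>0 rat) set algebras \<Rightarrow> _"
  by (rule rat_algebra_algebras)

lemma free_ops: "x \<oplus>\<^bsub>A\<^esub> y = x + y" "x \<otimes>\<^bsub>A\<^esub> y = x * y" "c \<odot>\<^bsub>A\<^esub> x = pm_scale c x" "\<zero>\<^bsub>A\<^esub> = 0" "\<one>\<^bsub>A\<^esub> = 1"
  by (simp_all add: free_algebra_def)

lemma quot_add: "x \<in> carrier A \<Longrightarrow> y \<in> carrier A \<Longrightarrow> quot (x + y) = quot x + quot y"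
  using coset_emb_hom(1)[OF free_q_algebra ideal_J] by (simp add: quot_def free_ops)

lemma quot_mult: "x \<in> carrier A \<Longrightarrow> y \<in> carrier A \<Longrightarrow> quot (x * y) = quot x * quot y"
  using coset_emb_hom(2)[OF free_q_algebra ideal_J] by (simp add: quot_def free_ops)

lemma quot_scale: "x \<in> carrier A \<Longrightarrow> quot (pm_scale c x) = algebras_scale c (quot x)"
  using coset_emb_hom(3)[OF free_q_algebra ideal_J, of x x] by (simp add: quot_def free_ops)

lemma quot_eq_0_iff: "x \<in> carrier A \<Longrightarrow> quot x = 0 \<longleftrightarrow> x \<in> J"
  using coset_emb_hom(4)[OF free_q_algebra ideal_J, of x x] by (simp add: quot_def)

lemma quot_zero: "quot 0 = 0"
  using quot_add[OF free_carrier_zero free_carrier_zero] by simp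

lemma quot_uminus: "x \<in> carrier A \<Longrightarrow> quot (- x) = - quot x"
  using quot_add[of x "- x"] free_carrier_uminus[of x] by (simp add: quot_zero eq_neg_iff_add_eq_0 add.commute)

lemma quot_diff: "x \<in> carrier A \<Longrightarrow> y \<in> carrier A \<Longrightarrow> quot (x - y) = quot x - quot y"
  using quot_add[of x "- y"] quot_uminus[of y] free_carrier_uminus[of y] by simp

lemma quot_sum: "(\<And>a. a \<in> S \<Longrightarrow> f a \<in> carrier A) \<Longrightarrow> quot (sum f S) = (\<Sum>a\<in>S. quot (f a))"
  by (induction S rule: infinite_finite_induct) (auto simp: quot_zero quot_add free_carrier_sum)

lemma quot_sum_list:
  "(\<And>a. a \<in> set as \<Longrightarrow> f a \<in> carrier A) \<Longrightarrow> quot (\<Sum>a\<leftarrow>as. f a) = (\<Sum>a\<leftarrow>as. quot (f a))"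
  by (induction as) (auto simp: quot_zero quot_add free_carrier_sum_list)

lemma of_nat_eq_scale: "(of_nat k :: generator word \<Rightarrow>\<^sub>0 rat) = pm_scale (of_nat k) 1"
  by (induction k) (simp_all add: pm.scale_left_distrib)

lemma quot_of_nat: "quot (of_nat k) = algebras_scale (of_nat k) (quot 1)"
  unfolding of_nat_eq_scale by (rule quot_scale[OF free_carrier_one])

lemma bracket_carrier: "x \<in> carrier A \<Longrightarrow> y \<in> carrier A \<Longrightarrow> bracket x y \<in> carrier A"
  unfolding bracket_def by (intro free_carrier_intros)

lemma quot_bracket: "x \<in> carrier A \<Longrightarrow> y \<in> carrier A \<Longrightarrow> quot (bracket x y) = bracket (quot x) (quot y)"
  by (simp add: bracket_def quot_diff quot_mult free_carrier_mult)

lemma quot_relation: "r \<in> schur_relations n d \<Longrightarrow> quot r = 0"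
  using subsetD[OF schur_relations_carrier, of r n d] quot_eq_0_iff[of r]
    subsetD[OF ring.genideal_self[OF free_algebra_ring schur_relations_carrier], of r n d] by blast

lemma generators_carrier:
  "i \<in> {1..<n} \<Longrightarrow> gen (E i) \<in> carrier A" "i \<in> {1..<n} \<Longrightarrow> gen (F i) \<in> carrier A"
  "i \<in> {1..n} \<Longrightarrow> gen (H i) \<in> carrier A"
  by (auto intro!: free_carrier_gen simp: schur_generators_def)

lemma serre_eq_bracket: "x\<^sup>2 * y - 2 * x * y * x + y * x\<^sup>2 = bracket x (bracket x (y :: 'x::ring_1))"
proof -
  have "2 * x * y * x = x * y * x + x * y * x"
    by (simp add: mult_2 distrib_right)
  then show ?thesis
    by (simp add: bracket_def power2_eq_square algebra_simps)
qed

lemma gl_presentation_quot: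
  "gl_presentation (\<lambda>i. quot (gen (E i))) (\<lambda>i. quot (gen (F i))) (\<lambda>i. quot (gen (H i))) n"
proof
  note c = generators_carrier
  fix i j
  show "bracket (quot (gen (H i))) (quot (gen (H j))) = 0" if "i \<in> {1..n}" "j \<in> {1..n}"
  proof -
    have "bracket (gen (H i)) (gen (H j)) \<in> schur_relations n d"
      using that unfolding schur_relations_def Let_def bracket_def by blast
    then show ?thesis
      using quot_relation quot_bracket[of "gen (H i)" "gen (H j)"] that c by metis
  qed
  show "bracket (quot (gen (E i))) (quot (gen (F j))) = (if i = j then quot (gen (H j)) - quot (gen (H (Suc j))) else 0)"
    if ij: "i \<in> {1..<n}" "j \<in> {1..<n}"
  proof -
    let ?z = "if i = j then gen (H j) - gen (H (j + 1)) else 0"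
    have "bracket (gen (E i)) (gen (F j)) - ?z \<in> schur_relations n d"
      using ij unfolding schur_relations_def Let_def bracket_def by blast
    moreover have z: "?z \<in> carrier A"
      using ij c(3) by (auto intro!: free_carrier_diff free_carrier_zero)
    ultimately have "bracket (quot (gen (E i))) (quot (gen (F j))) = quot ?z"
      using quot_relation quot_diff[OF bracket_carrier z] quot_bracket ij c by (metis eq_iff_diff_eq_0)
    then show ?thesis
      using ij c(3) by (auto simp: quot_zero quot_diff)
  qed
  \<comment> \<open>The integer coefficient in (R3) is an element of the free algebra. In the target
    it has to become a scalar, as that ring type has no numerals.\<close>
  have int: "quot (of_int k * x) = algebras_scale (of_int k) (quot x)" if "x \<in> carrier A" for k x
  proof -
    have "of_int k = pm_scale (of_int k) (1 :: generator word \<Rightarrow>\<^sub>0 rat)"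
      by (cases k rule: int_cases2) (simp_all add: of_nat_eq_scale)
    moreover have "pm_scale (of_int k) 1 * x = pm_scale (of_int k) x"
      by (simp add: pm_scale_eq_mult(1))
    ultimately show ?thesis
      using quot_scale[OF that] by simp
  qed
  show "bracket (quot (gen (H i))) (quot (gen (E j))) =
      (if i = j then quot (gen (E j)) else if i = Suc j then - quot (gen (E j)) else 0)"
    if ij: "i \<in> {1..n}" "j \<in> {1..<n}"
  proof -
    let ?z = "of_int (inner_prod n (eps i) (alpha j)) * gen (E j)"
    have "bracket (gen (H i)) (gen (E j)) - ?z \<in> schur_relations n d"
      using ij unfolding schur_relations_def Let_def bracket_def by blast
    moreover have z: "?z \<in> carrier A"
      using ij c(1) by (intro free_carrier_mult free_carrier_of_int)
    ultimately have "bracket (quot (gen (H i))) (quot (gen (E j))) = quot ?z"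
      using quot_relation quot_diff[OF bracket_carrier z] quot_bracket ij c by (metis eq_iff_diff_eq_0)
    then show ?thesis
      using int[OF c(1)[OF ij(2)]] ij by (simp add: inner_prod_eps_alpha)
  qed
  show "bracket (quot (gen (H i))) (quot (gen (F j))) =
      (if i = j then - quot (gen (F j)) else if i = Suc j then quot (gen (F j)) else 0)"
    if ij: "i \<in> {1..n}" "j \<in> {1..<n}"
  proof -
    let ?z = "of_int (inner_prod n (eps i) (alpha j)) * gen (F j)"
    have "bracket (gen (H i)) (gen (F j)) + ?z \<in> schur_relations n d"
      using ij unfolding schur_relations_def Let_def bracket_def by blast
    moreover have z: "?z \<in> carrier A"
      using ij c(2) by (intro free_carrier_mult free_carrier_of_int)
    ultimately have "bracket (quot (gen (H i))) (quot (gen (F j))) = - quot ?z"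
      using quot_relation quot_add[OF bracket_carrier z] quot_bracket ij c by (metis eq_neg_iff_add_eq_0)
    then show ?thesis
      using int[OF c(2)[OF ij(2)]] ij by (simp add: inner_prod_eps_alpha)
  qed
  have adj: "\<bar>int i - int j\<bar> = 1 \<longleftrightarrow> j = Suc i \<or> i = Suc j" for i j
    by linarith
  show "bracket (quot (gen (E i))) (bracket (quot (gen (E i))) (quot (gen (E j)))) = 0"
    if ij: "i \<in> {1..<n}" "j \<in> {1..<n}" "j = Suc i \<or> i = Suc j"
  proof -
    have "bracket (gen (E i)) (bracket (gen (E i)) (gen (E j))) \<in> schur_relations n d"
      using ij unfolding schur_relations_def Let_def serre_eq_bracket[symmetric] adj by blast
    then show ?thesis
      using quot_relation quot_bracket bracket_carrier ij c by metis
  qed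
  show "bracket (quot (gen (F i))) (bracket (quot (gen (F i))) (quot (gen (F j)))) = 0"
    if ij: "i \<in> {1..<n}" "j \<in> {1..<n}" "j = Suc i \<or> i = Suc j"
  proof -
    have "bracket (gen (F i)) (bracket (gen (F i)) (gen (F j))) \<in> schur_relations n d"
      using ij unfolding schur_relations_def Let_def serre_eq_bracket[symmetric] adj by blast
    then show ?thesis
      using quot_relation quot_bracket bracket_carrier ij c by metis
  qed
  show "bracket (quot (gen (E i))) (quot (gen (E j))) = 0"
    if ij: "i \<in> {1..<n}" "j \<in> {1..<n}" "j \<noteq> Suc i" "i \<noteq> Suc j"
  proof -
    have "bracket (gen (E i)) (gen (E j)) \<in> schur_relations n d"
      using ij unfolding schur_relations_def Let_def bracket_def adj by blast
    then show ?thesis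
      using quot_relation quot_bracket ij c by metis
  qed
  show "bracket (quot (gen (F i))) (quot (gen (F j))) = 0"
    if ij: "i \<in> {1..<n}" "j \<in> {1..<n}" "j \<noteq> Suc i" "i \<noteq> Suc j"
  proof -
    have "bracket (gen (F i)) (gen (F j)) \<in> schur_relations n d"
      using ij unfolding schur_relations_def Let_def bracket_def adj by blast
    then show ?thesis
      using quot_relation quot_bracket ij c by metis
  qed
  show "x = 0" if "x + x = 0" for x :: "(generator word \<Rightarrow>\<^sub>0 rat) set algebras"
    using that by (rule no_2_torsion)
qed

abbreviation "QX \<equiv> gl_unit (\<lambda>i. quot (gen (E i))) (\<lambda>i. quot (gen (F i))) (\<lambda>i. quot (gen (H i)))"

lemma quot_upper:
  assumes "\<And>k. k \<in> {1..<n} \<Longrightarrow> e k \<in> carrier A \<and> quot (e k) = e' k" "i < j" "1 \<le> i" "j \<le> n"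
  shows "upper e i j \<in> carrier A \<and> quot (upper e i j) = upper e' i j"
  using assms(2-)
proof (induction j)
  case (Suc j)
  then show ?case
    using assms(1) by (cases "i = j") (auto simp: upper_Suc bracket_carrier quot_bracket)
qed simp

lemma quot_free_unit:
  assumes "(i, j) \<in> {1..n} \<times> {1..n}"
  shows "free_unit i j \<in> carrier A \<and> quot (free_unit i j) = QX i j"
proof (cases i j rule: linorder_cases)
  case less
  then show ?thesis
    using quot_upper[of "\<lambda>i. gen (E i)" "\<lambda>i. quot (gen (E i))" i j] generators_carrier(1) assms
    by (simp add: gl_unit_def)
next
  case equal
  then show ?thesis
    using generators_carrier(3) assms by simp
next
  case greater
  have "upper (\<lambda>k. - gen (F k)) j i \<in> carrier A \<and>
      quot (upper (\<lambda>k. - gen (F k)) j i) = upper (\<lambda>k. - quot (gen (F k))) j i"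
    by (rule quot_upper) (use greater assms generators_carrier(2) free_carrier_uminus quot_uminus in auto)
  then show ?thesis
    using greater by (simp add: gl_unit_def free_carrier_uminus quot_uminus)
qed

lemma quot_prod_list:
  assumes "i \<in> {1..n}"
  shows "quot (prod_list (map (\<lambda>k. gen (H i) - of_nat k) ks)) =
    foldr (\<lambda>k y. (QX i i - algebras_scale (of_nat k) (quot 1)) * y) ks (quot 1)"
proof (induction ks)
  case (Cons k ks)
  have c: "gen (H i) - of_nat k \<in> carrier A" for k
    using assms by (intro free_carrier_diff generators_carrier free_carrier_of_nat)
  then have "prod_list (map (\<lambda>k. gen (H i) - of_nat k) ks) \<in> carrier A"
    by (rule free_carrier_prod_list)
  then show ?case
    using c[of k] assms
    by (simp add: quot_mult Cons quot_diff generators_carrier free_carrier_of_nat quot_of_nat)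
qed simp

sublocale rep: gl_rep_degree QX "quot 1" n algebras_scale d
proof
  interpret gl: gl_presentation "\<lambda>i. quot (gen (E i))" "\<lambda>i. quot (gen (F i))" "\<lambda>i. quot (gen (H i))" n
    by (rule gl_presentation_quot)
  show "QX i j * QX k l - QX k l * QX i j = (if j = k then QX i l else 0) - (if i = l then QX k j else 0)"
    if "i \<in> {1..n}" "j \<in> {1..n}" "k \<in> {1..n}" "l \<in> {1..n}" for i j k l
    using gl.gl_relations[OF that] by (simp only: bracket_def)
  show "quot 1 * quot 1 = quot 1"
    using quot_mult[OF free_carrier_one free_carrier_one] by simp
  show "quot 1 * QX i j = QX i j" "QX i j * quot 1 = QX i j" if "(i, j) \<in> {1..n} \<times> {1..n}" for i j
    using quot_mult[OF free_carrier_one, of "free_unit i j"] quot_mult[OF _ free_carrier_one, of "free_unit i j"]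
      quot_free_unit[OF that] by simp_all
  have "(\<Sum>i=1..n. gen (H i)) - of_nat d \<in> schur_relations n d"
    unfolding schur_relations_def Let_def by blast
  from quot_relation[OF this] have "quot (\<Sum>i=1..n. gen (H i)) = quot (of_nat d)"
    using generators_carrier(3) by (subst (asm) quot_diff) (auto intro: free_carrier_sum free_carrier_of_nat)
  moreover have "quot (\<Sum>i=1..n. gen (H i)) = (\<Sum>i=1..n. quot (gen (H i)))"
    using generators_carrier(3) by (intro quot_sum) auto
  ultimately show "(\<Sum>i=1..n. QX i i) = algebras_scale (of_nat d) (quot 1)"
    by (simp add: quot_of_nat)
  show "foldr (\<lambda>k y. (QX i i - algebras_scale (of_nat k) (quot 1)) * y) [0..<d + 1] (quot 1) = 0"
    if "i \<in> {1..n}" for i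
  proof -
    have "prod_list (map (\<lambda>k. gen (H i) - of_nat k) [0..<d + 1]) \<in> schur_relations n d"
      using that unfolding schur_relations_def Let_def by blast
    from quot_relation[OF this] show ?thesis
      by (simp only: quot_prod_list[OF that])
  qed
qed

lemma set_replace_row:
  "zs' \<in> set (replace_row i j zs) \<Longrightarrow> set zs \<subseteq> rep.box \<Longrightarrow> i \<in> {1..n} \<Longrightarrow> set zs' \<subseteq> rep.box"
proof -
  assume "zs' \<in> set (replace_row i j zs)" "set zs \<subseteq> rep.box" "i \<in> {1..n}"
  moreover from this have "mset zs' \<in># mreplace_row i j (mset zs)"
    unfolding mset_replace_row[symmetric] by auto
  ultimately show ?thesis
    using rep.set_mreplace_row[of "mset zs'" i j "mset zs"] by simp
qed

lemma quot_nprod: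
  "set zs \<subseteq> rep.box \<Longrightarrow> nprod free_unit 1 zs \<in> carrier A \<and>
    quot (nprod free_unit 1 zs) = nprod QX (quot 1) zs"
proof (induction "length zs" arbitrary: zs rule: less_induct)
  case less
  show ?case
  proof (cases zs)
    case Nil
    then show ?thesis by (simp add: free_carrier_one)
  next
    case (Cons z ys)
    have z: "(fst z, snd z) \<in> rep.box" "set ys \<subseteq> rep.box"
      using less.prems Cons by simp_all
    have ys: "nprod free_unit 1 ys \<in> carrier A \<and> quot (nprod free_unit 1 ys) = nprod QX (quot 1) ys"
      using less Cons z by simp
    have rest: "nprod free_unit 1 xs \<in> carrier A \<and> quot (nprod free_unit 1 xs) = nprod QX (quot 1) xs"
      if "xs \<in> set (replace_row (fst z) (snd z) ys)" for xs
      using less(1)[of xs] Cons length_replace_row[OF that] set_replace_row[OF that z(2)] z(1)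
      by (simp add: mem_Times_iff)
    then have "(\<Sum>xs\<leftarrow>replace_row (fst z) (snd z) ys. nprod free_unit 1 xs) \<in> carrier A"
      "quot (\<Sum>xs\<leftarrow>replace_row (fst z) (snd z) ys. nprod free_unit 1 xs) =
        (\<Sum>xs\<leftarrow>replace_row (fst z) (snd z) ys. quot (nprod free_unit 1 xs))"
      by (auto intro: free_carrier_sum_list quot_sum_list)
    moreover have "(\<Sum>xs\<leftarrow>replace_row (fst z) (snd z) ys. quot (nprod free_unit 1 xs)) =
        (\<Sum>xs\<leftarrow>replace_row (fst z) (snd z) ys. nprod QX (quot 1) xs)"
      using rest by (intro arg_cong[of _ _ sum_list] map_cong) auto
    ultimately show ?thesis
      using ys quot_free_unit[OF z(1)]
      by (simp add: Cons free_carrier_diff free_carrier_mult quot_diff quot_mult)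
  qed
qed

section \<open>Combinations of products of size d, and the kernel of the action\<close>

definition shapes :: "(nat \<times> nat) multiset set"
  where "shapes = {Z. set_mset Z \<subseteq> rep.box \<and> size Z = d}"

lemma finite_shapes: "finite shapes"
proof -
  have "shapes \<subseteq> mset ` {zs. set zs \<subseteq> rep.box \<and> length zs = d}"
    unfolding shapes_def by (auto simp: image_iff) (metis ex_mset set_mset_mset size_mset)
  then show ?thesis
    by (rule finite_subset) (intro finite_imageI finite_lists_length_eq, simp)
qed

text \<open>A lift that may depend on the ordering chosen for \<open>Z\<close>, unlike its image
  under \<open>quot\<close> and its action.\<close>

abbreviation "FN \<equiv> nprod_mset free_unit 1"

lemma mset_SOME: "mset (SOME zs. mset zs = Z) = Z"
  using ex_mset by (rule someI_ex)

lemma set_SOME: "set (SOME zs. mset zs = Z) = set_mset Z"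
  using mset_SOME[of Z] by (metis set_mset_mset)

lemma quot_nprod_mset:
  assumes "Z \<in> shapes"
  shows "FN Z \<in> carrier A" "quot (FN Z) = rep.N Z"
  using quot_nprod[of "SOME zs. mset zs = Z"] assms
  by (simp_all add: nprod_mset_def set_SOME shapes_def)

lemma free_act_nprod_mset: "free_act (FN Z) g v = nprod_act Z g v"
  by (simp add: nprod_mset_def free_act_nprod mset_SOME)

definition combination :: "((nat \<times> nat) multiset \<Rightarrow> rat) \<Rightarrow> (generator word \<Rightarrow>\<^sub>0 rat)"
  where "combination c = (\<Sum>Z\<in>shapes. pm_scale (c Z) (FN Z))"

lemma combination_carrier: "combination c \<in> carrier A"
  unfolding combination_def by (intro free_carrier_sum free_carrier_scale quot_nprod_mset)

lemma quot_combination: "quot (combination c) = (\<Sum>Z\<in>shapes. algebras_scale (c Z) (rep.N Z))"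
  unfolding combination_def
  by (subst quot_sum) (auto simp: quot_scale quot_nprod_mset intro: free_carrier_scale)

text \<open>Only one shape contributes to a given matrix entry, so the entries return the
  coefficients. This yields independence and also the means to prescribe entries.\<close>

lemma free_act_combination_delta:
  assumes "w \<in> words n d" "v \<in> words n d"
  shows "free_act (combination c) (delta v) w =
    c (mset (zip w v)) * mset_weight (mset (zip w v))"
proof -
  have len: "length w = length v" "length w = d"
    using assms by (auto simp: words_def)
  have "mset (zip w v) \<in> shapes"
    using assms by (auto simp: shapes_def words_def dest: set_zip_leftD set_zip_rightD)
  moreover have "nprod_act Z (delta v) w = (if Z = mset (zip w v) then mset_weight Z else 0)" if "Z \<in> shapes" for Z
    using that len by (intro nprod_act_delta) (auto simp: shapes_def)
  then have "free_act (combination c) (delta v) w =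
      (\<Sum>Z\<in>shapes. if Z = mset (zip w v) then c Z * mset_weight Z else 0)"
    unfolding combination_def free_act_sum
    by (intro sum.cong) (auto simp: free_act_nprod_mset)
  ultimately show ?thesis
    using finite_shapes by simp
qed

text \<open>The empty word gives the unit, which lies in the span, and prepending a letter
  multiplies from the left by a matrix unit.\<close>

lemma quot_in_span:
  assumes "p \<in> carrier A"
  shows "quot p \<in> span rep.nprod_basis"
proof -
  have letter: "\<exists>z\<in>rep.box. quot (gen x) = QX (fst z) (snd z)" if "x \<in> schur_generators n" for x
  proof (cases x)
    case (E i)
    then show ?thesis
      using that by (intro bexI[of _ "(i, Suc i)"]) (auto simp: schur_generators_def)
  next
    case (F i)
    then show ?thesis
      using that by (intro bexI[of _ "(Suc i, i)"]) (auto simp: schur_generators_def)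
  next
    case (H i)
    then show ?thesis
      using that by (intro bexI[of _ "(i, i)"]) (auto simp: schur_generators_def)
  qed
  have word: "Poly_Mapping.single (Word xs) 1 \<in> carrier A \<and>
      quot (Poly_Mapping.single (Word xs) 1) \<in> span rep.nprod_basis"
    if "set xs \<subseteq> schur_generators n" for xs
    using that
  proof (induction xs)
    case Nil
    have "Poly_Mapping.single (Word []) 1 = (1 :: generator word \<Rightarrow>\<^sub>0 rat)"
      unfolding zero_word_def[symmetric] by (rule single_one)
    then show ?case
      using rep.unit_in_span by (simp add: free_carrier_one)
  next
    case (Cons x xs)
    have x: "x \<in> schur_generators n"
      using Cons.prems by simp
    have eq: "Poly_Mapping.single (Word (x # xs)) 1 = gen x * (Poly_Mapping.single (Word xs) 1 :: _ \<Rightarrow>\<^sub>0 rat)"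
      by (simp add: gen_def mult_single plus_word_def)
    obtain z where z: "z \<in> rep.box" "quot (gen x) = QX (fst z) (snd z)"
      using letter[OF x] by blast
    have IH: "Poly_Mapping.single (Word xs) 1 \<in> carrier A"
      "quot (Poly_Mapping.single (Word xs) 1) \<in> span rep.nprod_basis"
      using Cons by simp_all
    show ?case
      unfolding eq quot_mult[OF free_carrier_gen[OF x] IH(1)] z(2)
      using rep.unit_times_span[OF _ IH(2), of "fst z" "snd z"] z(1) IH(1) free_carrier_gen[OF x]
      by (simp add: free_carrier_mult)
  qed
  have single: "Poly_Mapping.single w (Poly_Mapping.lookup p w) \<in> carrier A \<and>
      quot (Poly_Mapping.single w (Poly_Mapping.lookup p w)) \<in> span rep.nprod_basis"
    if "w \<in> Poly_Mapping.keys p" for w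
  proof -
    have w: "set (letters w) \<subseteq> schur_generators n"
      using that assms by (simp add: free_algebra_def)
    have "Poly_Mapping.single w (Poly_Mapping.lookup p w) =
        pm_scale (Poly_Mapping.lookup p w) (Poly_Mapping.single (Word (letters w)) 1)"
      by (simp add: pm_scale_single)
    then show ?thesis
      using word[OF w] by (simp add: free_carrier_scale quot_scale span_scale)
  qed
  have "quot p = (\<Sum>w\<in>Poly_Mapping.keys p. quot (Poly_Mapping.single w (Poly_Mapping.lookup p w)))"
    using arg_cong[OF sum_single[of p], of quot] quot_sum[of "Poly_Mapping.keys p"] single by simp
  also have "\<dots> \<in> span rep.nprod_basis"
    using single by (intro span_sum) auto
  finally show ?thesis .
qed

lemma exists_combination:
  assumes "p \<in> carrier A"
  obtains c where "p - combination c \<in> J"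
proof -
  have "quot p \<in> range (\<lambda>c. \<Sum>Z\<in>shapes. algebras_scale (c Z) (rep.N Z))"
  proof (rule subsetD[OF span_minimal quot_in_span[OF assms]])
    show "rep.nprod_basis \<subseteq> range (\<lambda>c. \<Sum>Z\<in>shapes. algebras_scale (c Z) (rep.N Z))"
    proof
      fix y assume "y \<in> rep.nprod_basis"
      then obtain Y where Y: "y = rep.N Y" "Y \<in> shapes"
        by (auto simp: rep.nprod_basis_def shapes_def)
      have "(\<Sum>Z\<in>shapes. algebras_scale (if Z = Y then 1 else 0) (rep.N Z)) =
          (\<Sum>Z\<in>shapes. if Z = Y then rep.N Z else 0)"
        by (rule sum.cong) auto
      also have "\<dots> = y"
        using Y finite_shapes by simp
      finally show "y \<in> range (\<lambda>c. \<Sum>Z\<in>shapes. algebras_scale (c Z) (rep.N Z))"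
        by (intro image_eqI[of _ _ "\<lambda>Z. if Z = Y then 1 else 0"]) simp_all
    qed
    show "subspace (range (\<lambda>c. \<Sum>Z\<in>shapes. algebras_scale (c Z) (rep.N Z)))"
    proof (rule subspaceI)
      show "0 \<in> range (\<lambda>c. \<Sum>Z\<in>shapes. algebras_scale (c Z) (rep.N Z))"
        by (rule image_eqI[of _ _ "\<lambda>_. 0"]) simp_all
      fix x y assume "x \<in> range (\<lambda>c. \<Sum>Z\<in>shapes. algebras_scale (c Z) (rep.N Z))"
        and "y \<in> range (\<lambda>c. \<Sum>Z\<in>shapes. algebras_scale (c Z) (rep.N Z))"
      then obtain b c where "x = (\<Sum>Z\<in>shapes. algebras_scale (b Z) (rep.N Z))"
        "y = (\<Sum>Z\<in>shapes. algebras_scale (c Z) (rep.N Z))"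
        by blast
      then show "x + y \<in> range (\<lambda>c. \<Sum>Z\<in>shapes. algebras_scale (c Z) (rep.N Z))"
        by (intro image_eqI[of _ _ "\<lambda>Z. b Z + c Z"]) (simp_all add: scale_left_distrib sum.distrib)
    next
      fix a x assume "x \<in> range (\<lambda>c. \<Sum>Z\<in>shapes. algebras_scale (c Z) (rep.N Z))"
      then obtain b where "x = (\<Sum>Z\<in>shapes. algebras_scale (b Z) (rep.N Z))"
        by blast
      then show "algebras_scale a x \<in> range (\<lambda>c. \<Sum>Z\<in>shapes. algebras_scale (c Z) (rep.N Z))"
        by (intro image_eqI[of _ _ "\<lambda>Z. a * b Z"]) (simp_all add: scale_sum_right)
    qed
  qed
  then obtain c where "quot p = quot (combination c)"
    by (auto simp: quot_combination)
  then have "quot (p - combination c) = 0"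
    using assms combination_carrier by (simp add: quot_diff)
  then show ?thesis
    using that quot_eq_0_iff[of "p - combination c"] assms combination_carrier by (simp add: free_carrier_diff)
qed

definition kernel :: "(generator word \<Rightarrow>\<^sub>0 rat) set"
  where "kernel = {p \<in> carrier A. \<forall>g. \<forall>w\<in>words n d. free_act p g w = 0}"

lemma ideal_kernel: "ideal kernel A"
proof (rule idealI[OF free_algebra_ring])
  have "inv\<^bsub>add_monoid A\<^esub> x \<in> kernel" if "x \<in> kernel" for x
  proof -
    interpret R: ring A
      by (rule free_algebra_ring)
    have "x \<in> carrier A"
      using that by (simp add: kernel_def)
    then have "\<ominus>\<^bsub>A\<^esub> x = - x"
      using free_carrier_uminus[of x] by (intro R.minus_equality) (simp_all add: free_ops)
    then show ?thesis
      using that free_carrier_uminus[of x] by (simp add: a_inv_def kernel_def)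
  qed
  then show "subgroup kernel (add_monoid A)"
    by (intro group.subgroupI abelian_group.a_group ring.is_abelian_group free_algebra_ring)
      (auto simp: kernel_def free_ops free_carrier_add free_carrier_zero intro!: exI[of _ 0])
next
  fix a x assume "a \<in> kernel" "x \<in> carrier A"
  then show "x \<otimes>\<^bsub>A\<^esub> a \<in> kernel" "a \<otimes>\<^bsub>A\<^esub> x \<in> kernel"
    using free_act_cong[of x n d "free_act a _" "\<lambda>_. 0"]
    by (auto simp: kernel_def free_ops free_carrier_mult)
qed

text \<open>An element of the kernel is congruent modulo \<open>J\<close> to a combination of the
  spanning products, and this combination also acts as zero. Its coefficients are visible as matrix
  entries and therefore vanish.\<close>

lemma J_eq_kernel: "J = kernel"
proof
  have "schur_relations n d \<subseteq> kernel"
    using schur_relations_carrier free_act_relation by (auto simp: kernel_def)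
  then show J: "J \<subseteq> kernel"
    by (rule ring.genideal_minimal[OF free_algebra_ring ideal_kernel])
  show "kernel \<subseteq> J"
  proof
    fix p assume p: "p \<in> kernel"
    then have pA: "p \<in> carrier A"
      by (simp add: kernel_def)
    then obtain c where c: "p - combination c \<in> J"
      by (rule exists_combination)
    have "c Z = 0" if Z: "Z \<in> shapes" for Z
    proof -
      obtain zs where zs: "Z = mset zs"
        using ex_mset by metis
      \<comment> \<open>Separating rows from columns gives a pair of words whose letter pairs form
        exactly \<open>Z\<close>; the entry there isolates \<open>c Z\<close>.\<close>
      have w: "map fst zs \<in> words n d" "map snd zs \<in> words n d"
        using Z by (auto simp: zs shapes_def words_def)
      have "free_act (p - combination c) (delta (map snd zs)) (map fst zs) = 0"
        using subsetD[OF J c] w by (simp add: kernel_def)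
      then have "c Z * mset_weight Z = 0"
        using p w free_act_combination_delta[OF w, of c] by (simp add: kernel_def zip_map_fst_snd zs)
      then show ?thesis
        by (simp add: mset_weight_nonzero)
    qed
    then have "combination c = 0"
      by (simp add: combination_def)
    then show "p \<in> J"
      using c by simp
  qed
qed

text \<open>The hypothesis says that the matrix \<open>a\<close> is constant on the orbits of word
  pairs under simultaneous place permutation. Orbits correspond to shapes, and the coefficient of a
  shape is the common entry divided by its weight.\<close>

lemma exists_free_act:
  assumes "\<And>w v w' v'. w \<in> words n d \<Longrightarrow> v \<in> words n d \<Longrightarrow> w' \<in> words n d \<Longrightarrow> v' \<in> words n d \<Longrightarrow>
    mset (zip w v) = mset (zip w' v') \<Longrightarrow> a w v = a w' v'"
  obtains p where "p \<in> carrier A"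
    "\<And>w v. w \<in> words n d \<Longrightarrow> v \<in> words n d \<Longrightarrow> free_act p (delta v) w = a w v"
proof -
  define c where "c Z = (let wv = SOME wv. fst wv \<in> words n d \<and> snd wv \<in> words n d \<and>
    mset (zip (fst wv) (snd wv)) = Z in a (fst wv) (snd wv) / mset_weight Z)" for Z
  have "free_act (combination c) (delta v) w = a w v" if wv: "w \<in> words n d" "v \<in> words n d" for w v
  proof -
    let ?P = "\<lambda>wv. fst wv \<in> words n d \<and> snd wv \<in> words n d \<and> mset (zip (fst wv) (snd wv)) = mset (zip w v)"
    have "?P (SOME wv. ?P wv)"
      by (rule someI[of ?P "(w, v)"]) (use wv in simp)
    then have "a (fst (SOME wv. ?P wv)) (snd (SOME wv. ?P wv)) = a w v"
      using assms wv by blast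
    then show ?thesis
      using free_act_combination_delta[OF wv, of c] mset_weight_nonzero[of "mset (zip w v)"]
      by (simp add: c_def Let_def)
  qed
  then show ?thesis
    using that combination_carrier by blast
qed

end

section \<open>Coordinates on the tensor power\<close>

locale coordinates = vector_space scale
  for scale :: "rat \<Rightarrow> 'v::ab_group_add \<Rightarrow> 'v" +
  fixes n d :: nat and b :: "nat \<Rightarrow> 'v" and coord :: "nat \<Rightarrow> 'v \<Rightarrow> rat"
  assumes coord_add: "\<And>i u v. coord i (u + v) = coord i u + coord i v"
    and coord_scale: "\<And>i c v. coord i (scale c v) = c * coord i v"
    and coord_b: "\<And>i j. i \<in> {1..n} \<Longrightarrow> j \<in> {1..n} \<Longrightarrow> coord i (b j) = (if i = j then 1 else 0)"
    and expand: "\<And>v. v = (\<Sum>i=1..n. scale (coord i v) (b i))"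
begin

text \<open>The coefficient of the basis tensor indexed by \<open>w\<close> in the pure tensor with
  factors \<open>xs\<close>.\<close>

definition lcoord :: "nat list \<Rightarrow> 'v list \<Rightarrow> rat"
  where "lcoord w xs = (\<Prod>k<length w. coord (w ! k) (xs ! k))"

lemma lcoord_Nil [simp]: "lcoord [] xs = 1"
  by (simp add: lcoord_def)

lemma lcoord_Cons [simp]: "lcoord (c # w) (x # xs) = coord c x * lcoord w xs"
  by (simp add: lcoord_def prod.lessThan_Suc_shift del: prod.lessThan_Suc)

lemma lcoord_update:
  assumes "i < length w" "length xs = length w"
  shows "lcoord w (xs[i := u]) = coord (w ! i) u * (\<Prod>k\<in>{..<length w} - {i}. coord (w ! k) (xs ! k))"
proof -
  have "lcoord w (xs[i := u]) = coord (w ! i) (xs[i := u] ! i) *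
      (\<Prod>k\<in>{..<length w} - {i}. coord (w ! k) (xs[i := u] ! k))"
    unfolding lcoord_def using assms by (intro prod.remove) auto
  also have "(\<Prod>k\<in>{..<length w} - {i}. coord (w ! k) (xs[i := u] ! k)) =
      (\<Prod>k\<in>{..<length w} - {i}. coord (w ! k) (xs ! k))"
    by (rule prod.cong) auto
  finally show ?thesis
    using assms by simp
qed

lemma lcoord_b:
  assumes "set w \<subseteq> {1..n}" "set v \<subseteq> {1..n}" "length w = length v"
  shows "lcoord w (map b v) = (if w = v then 1 else 0)"
  using assms(3,1,2) by (induction w v rule: list_induct2) (auto simp: coord_b)

lemma lcoord_permute:
  assumes "\<sigma> permutes {..<length w}" "length xs = length w"
  shows "lcoord (permute_list \<sigma> w) (permute_list \<sigma> xs) = lcoord w xs"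
proof -
  have "lcoord (permute_list \<sigma> w) (permute_list \<sigma> xs) =
      (\<Prod>k<length w. coord (w ! \<sigma> k) (xs ! \<sigma> k))"
    unfolding lcoord_def using assms by (intro prod.cong) (auto simp: permute_list_nth)
  also have "\<dots> = lcoord w xs"
    unfolding lcoord_def
    using prod.permute[OF assms(1), of "\<lambda>k. coord (w ! k) (xs ! k)"] by (simp add: comp_def)
  finally show ?thesis .
qed

text \<open>The value 0 off \<open>words n d\<close> lets equality of coordinates be equality of
  functions.\<close>

definition tensor_coord :: "('v list \<Rightarrow>\<^sub>0 rat) \<Rightarrow> nat list \<Rightarrow> rat"
  where "tensor_coord p w = (if w \<in> words n d then
    \<Sum>xs\<in>Poly_Mapping.keys p. Poly_Mapping.lookup p xs * lcoord w xs else 0)"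

lemma tensor_coord_superset:
  assumes "finite A" "Poly_Mapping.keys p \<subseteq> A"
  shows "tensor_coord p w = (if w \<in> words n d then \<Sum>xs\<in>A. Poly_Mapping.lookup p xs * lcoord w xs else 0)"
proof -
  have "(\<Sum>xs\<in>Poly_Mapping.keys p. Poly_Mapping.lookup p xs * lcoord w xs) =
      (\<Sum>xs\<in>A. Poly_Mapping.lookup p xs * lcoord w xs)"
    using assms by (intro sum.mono_neutral_left) (auto simp: in_keys_iff)
  then show ?thesis
    by (simp add: tensor_coord_def)
qed

lemma tensor_coord_add: "tensor_coord (p + q) w = tensor_coord p w + tensor_coord q w"
proof -
  let ?A = "Poly_Mapping.keys p \<union> Poly_Mapping.keys q"
  show ?thesis
    using tensor_coord_superset[of ?A "p + q" w] tensor_coord_superset[of ?A p w]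
      tensor_coord_superset[of ?A q w] Poly_Mapping.keys_add[of p q]
    by (simp add: lookup_add distrib_right sum.distrib)
qed

lemma tensor_coord_scale: "tensor_coord (pm_scale c p) w = c * tensor_coord p w"
  using tensor_coord_superset[OF _ keys_pm_scale, of p c w]
  by (simp add: tensor_coord_def sum_distrib_left mult.assoc)

lemma tensor_coord_zero: "tensor_coord 0 w = 0"
  by (simp add: tensor_coord_def)

lemma tensor_coord_diff: "tensor_coord (p - q) w = tensor_coord p w - tensor_coord q w"
  using tensor_coord_add[of "p - q" q w] by simp

lemma tensor_coord_sum: "tensor_coord (\<Sum>a\<in>S. P a) w = (\<Sum>a\<in>S. tensor_coord (P a) w)"
  by (induction S rule: infinite_finite_induct) (simp_all add: tensor_coord_zero tensor_coord_add)

lemma tensor_coord_single: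
  "tensor_coord (Poly_Mapping.single xs c) w = (if w \<in> words n d then c * lcoord w xs else 0)"
  by (simp add: tensor_coord_def)

abbreviation "Rel \<equiv> pm.span (multilinear_relations scale d)"
abbreviation "LD \<equiv> {p :: 'v list \<Rightarrow>\<^sub>0 rat. Poly_Mapping.keys p \<subseteq> {xs. length xs = d}}"

lemma subspace_LD: "pm.subspace LD"
proof (rule pm.subspaceI)
  fix p q :: "'v list \<Rightarrow>\<^sub>0 rat" and c
  show "p + q \<in> LD" if "p \<in> LD" "q \<in> LD"
    using that Poly_Mapping.keys_add[of p q] by blast
  show "pm_scale c p \<in> LD" if "p \<in> LD"
    using that keys_pm_scale[of c p] by blast
qed simp

lemma single_LD: "length xs = d \<Longrightarrow> Poly_Mapping.single xs c \<in> LD"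
  by simp

lemma Rel_LD: "Rel \<subseteq> LD"
proof (rule pm.span_minimal[OF _ subspace_LD], rule subsetI)
  fix p assume "p \<in> multilinear_relations scale d"
  then consider
      xs i u v where "p = Poly_Mapping.single (xs[i := u + v]) 1
        - Poly_Mapping.single (xs[i := u]) 1 - Poly_Mapping.single (xs[i := v]) 1" "length xs = d"
    | xs i c u where "p = Poly_Mapping.single (xs[i := scale c u]) 1
        - pm_scale c (Poly_Mapping.single (xs[i := u]) 1)" "length xs = d"
    unfolding multilinear_relations_def by blast
  then show "p \<in> LD"
  proof cases
    case 1
    show ?thesis
      unfolding 1 by (intro pm.subspace_diff[OF subspace_LD] single_LD) (simp_all add: 1)
  next
    case 2
    show ?thesis
      unfolding 2 by (intro pm.subspace_diff[OF subspace_LD] pm.subspace_scale[OF subspace_LD] single_LD)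
        (simp_all add: 2)
  qed
qed

lemma tensor_coord_Rel:
  assumes "p \<in> Rel"
  shows "tensor_coord p w = 0"
  using assms
proof (induction rule: pm.span_induct)
  case base
  show ?case
    by (rule pm.subspaceI) (simp_all add: tensor_coord_zero tensor_coord_add tensor_coord_scale)
next
  case (step p)
  have lin: "lcoord w (xs[i := u + v]) = lcoord w (xs[i := u]) + lcoord w (xs[i := v])"
    "lcoord w (xs[i := scale c u]) = c * lcoord w (xs[i := u])"
    if "w \<in> words n d" "length xs = d" "i < d" for xs i u v c
    using that by (simp_all add: words_def lcoord_update coord_add coord_scale algebra_simps)
  from step consider
      xs i u v where "p = Poly_Mapping.single (xs[i := u + v]) 1
        - Poly_Mapping.single (xs[i := u]) 1 - Poly_Mapping.single (xs[i := v]) 1" "length xs = d" "i < d"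
    | xs i c u where "p = Poly_Mapping.single (xs[i := scale c u]) 1
        - pm_scale c (Poly_Mapping.single (xs[i := u]) 1)" "length xs = d" "i < d"
    unfolding multilinear_relations_def by blast
  then show ?case
  proof cases
    case 1
    show ?thesis
      unfolding 1(1) using 1(2,3) by (simp add: tensor_coord_diff tensor_coord_single lin)
  next
    case 2
    show ?thesis
      unfolding 2(1) using 2(2,3)
      by (simp add: tensor_coord_diff tensor_coord_scale tensor_coord_single lin)
  qed
qed

lemma single_zero_Rel:
  assumes "length xs = d" "i < d"
  shows "Poly_Mapping.single (xs[i := 0]) 1 \<in> Rel"
proof -
  have "Poly_Mapping.single (xs[i := scale 0 0]) 1 - pm_scale 0 (Poly_Mapping.single (xs[i := 0]) 1) \<in> Rel"
    by (rule pm.span_base) (use assms in \<open>unfold multilinear_relations_def, blast\<close>)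
  then show ?thesis by simp
qed

lemma single_linear:
  assumes "length xs = d" "i < d"
  shows "Poly_Mapping.single (xs[i := \<Sum>c\<in>S. scale (a c) (f c)]) 1
    - (\<Sum>c\<in>S. pm_scale (a c) (Poly_Mapping.single (xs[i := f c]) 1)) \<in> Rel"
proof (induction S rule: infinite_finite_induct)
  case (insert c S)
  let ?s = "\<lambda>u. Poly_Mapping.single (xs[i := u]) (1 :: rat)"
  let ?u = "\<Sum>c\<in>S. scale (a c) (f c)"
  have "?s (scale (a c) (f c) + ?u) - ?s (scale (a c) (f c)) - ?s ?u \<in> Rel"
    by (rule pm.span_base) (use assms in \<open>unfold multilinear_relations_def, blast\<close>)
  moreover have "?s (scale (a c) (f c)) - pm_scale (a c) (?s (f c)) \<in> Rel"
    by (rule pm.span_base) (use assms in \<open>unfold multilinear_relations_def, blast\<close>)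
  ultimately have "(?s (scale (a c) (f c) + ?u) - ?s (scale (a c) (f c)) - ?s ?u) +
      (?s (scale (a c) (f c)) - pm_scale (a c) (?s (f c))) +
      (?s ?u - (\<Sum>c\<in>S. pm_scale (a c) (?s (f c)))) \<in> Rel"
    using insert.IH by (intro pm.span_add)
  then show ?case
    using insert.hyps by (simp add: algebra_simps)
qed (use single_zero_Rel assms in simp_all)

lemma words_0: "words n 0 = {[]}"
  by (auto simp: words_def)

lemma sum_words_Suc:
  "(\<Sum>w\<in>words n (Suc m). f w) = (\<Sum>c=1..n. \<Sum>w\<in>words n m. f (c # w))"
proof -
  have "words n (Suc m) = (\<lambda>(c, w). c # w) ` ({1..n} \<times> words n m)"
    by (auto simp: words_def image_iff length_Suc_conv)
  moreover have "inj_on (\<lambda>(c, w). c # w) ({1..n} \<times> words n m)"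
    by (auto simp: inj_on_def)
  ultimately show ?thesis
    by (simp add: sum.reindex sum.cartesian_product case_prod_unfold)
qed

text \<open>The places are expanded one at a time; \<open>ys\<close> collects those already replaced
  by basis vectors, so it has to stay arbitrary in the induction.\<close>

lemma single_expand:
  assumes "length ys + length zs = d"
  shows "Poly_Mapping.single (ys @ zs) 1
    - (\<Sum>w\<in>words n (length zs). pm_scale (lcoord w zs) (Poly_Mapping.single (ys @ map b w) 1)) \<in> Rel"
  using assms
proof (induction zs arbitrary: ys)
  case Nil
  then show ?case by (simp add: words_0 pm.span_zero)
next
  case (Cons z zs)
  let ?rest = "\<lambda>c. \<Sum>w\<in>words n (length zs). pm_scale (lcoord w zs) (Poly_Mapping.single ((ys @ [b c]) @ map b w) 1)"
  have "Poly_Mapping.single ((ys @ z # zs)[length ys := \<Sum>c=1..n. scale (coord c z) (b c)]) 1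
      - (\<Sum>c=1..n. pm_scale (coord c z) (Poly_Mapping.single ((ys @ z # zs)[length ys := b c]) 1)) \<in> Rel"
    by (rule single_linear) (use Cons.prems in simp_all)
  then have 1: "Poly_Mapping.single (ys @ z # zs) 1
      - (\<Sum>c=1..n. pm_scale (coord c z) (Poly_Mapping.single ((ys @ [b c]) @ zs) 1)) \<in> Rel"
    unfolding expand[of z, symmetric] by simp
  have "Poly_Mapping.single ((ys @ [b c]) @ zs) 1 - ?rest c \<in> Rel" for c
    using Cons.prems by (intro Cons.IH) simp
  then have 2: "(\<Sum>c=1..n. pm_scale (coord c z) (Poly_Mapping.single ((ys @ [b c]) @ zs) 1 - ?rest c)) \<in> Rel"
    by (intro pm.span_sum pm.span_scale)
  have "(\<Sum>w\<in>words n (length (z # zs)). pm_scale (lcoord w (z # zs)) (Poly_Mapping.single (ys @ map b w) 1)) =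
      (\<Sum>c=1..n. pm_scale (coord c z) (?rest c))"
    by (simp add: sum_words_Suc pm.scale_sum_right)
  then have "Poly_Mapping.single (ys @ z # zs) 1
      - (\<Sum>w\<in>words n (length (z # zs)). pm_scale (lcoord w (z # zs)) (Poly_Mapping.single (ys @ map b w) 1)) =
    (Poly_Mapping.single (ys @ z # zs) 1
      - (\<Sum>c=1..n. pm_scale (coord c z) (Poly_Mapping.single ((ys @ [b c]) @ zs) 1))) +
    (\<Sum>c=1..n. pm_scale (coord c z) (Poly_Mapping.single ((ys @ [b c]) @ zs) 1 - ?rest c))"
    by (simp only: pm.scale_right_diff_distrib sum_subtractf) simp
  then show ?case
    using pm.span_add[OF 1 2] by (simp only:)
qed

text \<open>Coordinates are multilinear and so vanish on the relations. Conversely, modulo the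
  relations every element equals the combination of basis tensors given by its coordinates. Thus the
  basis tensors really form a basis.\<close>

lemma mem_Rel_iff: "p \<in> Rel \<longleftrightarrow> p \<in> LD \<and> tensor_coord p = (\<lambda>_. 0)"
proof
  assume "p \<in> Rel"
  then show "p \<in> LD \<and> tensor_coord p = (\<lambda>_. 0)"
    using Rel_LD tensor_coord_Rel by blast
next
  assume p: "p \<in> LD \<and> tensor_coord p = (\<lambda>_. 0)"
  let ?e = "\<lambda>w. Poly_Mapping.single (map b w) (1 :: rat)"
  have "(\<Sum>xs\<in>Poly_Mapping.keys p. pm_scale (Poly_Mapping.lookup p xs)
      (Poly_Mapping.single xs 1 - (\<Sum>w\<in>words n d. pm_scale (lcoord w xs) (?e w)))) \<in> Rel"
    using single_expand[of "[]"] p by (intro pm.span_sum pm.span_scale) auto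
  also have "(\<Sum>xs\<in>Poly_Mapping.keys p. pm_scale (Poly_Mapping.lookup p xs)
      (Poly_Mapping.single xs 1 - (\<Sum>w\<in>words n d. pm_scale (lcoord w xs) (?e w)))) =
      (\<Sum>xs\<in>Poly_Mapping.keys p. Poly_Mapping.single xs (Poly_Mapping.lookup p xs)) -
      (\<Sum>xs\<in>Poly_Mapping.keys p. \<Sum>w\<in>words n d. pm_scale (Poly_Mapping.lookup p xs * lcoord w xs) (?e w))"
    by (simp add: pm.scale_right_diff_distrib sum_subtractf pm_scale_single pm.scale_sum_right)
  also have "(\<Sum>xs\<in>Poly_Mapping.keys p. Poly_Mapping.single xs (Poly_Mapping.lookup p xs)) = p"
    by (rule sum_single[symmetric])
  also have "(\<Sum>xs\<in>Poly_Mapping.keys p. \<Sum>w\<in>words n d. pm_scale (Poly_Mapping.lookup p xs * lcoord w xs) (?e w)) =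
      (\<Sum>w\<in>words n d. pm_scale (tensor_coord p w) (?e w))"
    by (subst sum.swap) (simp add: tensor_coord_def pm.scale_sum_left)
  finally show "p \<in> Rel"
    using p by simp
qed

section \<open>The tensor power as the set of coordinate fibres\<close>

definition fib :: "(nat list \<Rightarrow> rat) \<Rightarrow> ('v list \<Rightarrow>\<^sub>0 rat) set"
  where "fib g = {p \<in> LD. tensor_coord p = g}"

definition supported :: "(nat list \<Rightarrow> rat) set"
  where "supported = {g. \<forall>w. w \<notin> words n d \<longrightarrow> g w = 0}"

lemma tensor_coord_supported: "tensor_coord p \<in> supported"
  by (simp add: supported_def tensor_coord_def)

lemma fib_nonempty:
  assumes "g \<in> supported"
  obtains p where "p \<in> fib g"
proof -
  let ?p = "\<Sum>v\<in>words n d. pm_scale (g v) (Poly_Mapping.single (map b v) 1)"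
  have "?p \<in> LD"
    by (intro pm.subspace_sum[OF subspace_LD] pm.subspace_scale[OF subspace_LD] single_LD)
      (simp add: words_def)
  moreover have "tensor_coord ?p w = g w" for w
  proof (cases "w \<in> words n d")
    case True
    then have "tensor_coord ?p w = (\<Sum>v\<in>words n d. if w = v then g v else 0)"
      unfolding tensor_coord_sum
      by (intro sum.cong refl) (auto simp: tensor_coord_scale tensor_coord_single lcoord_b words_def)
    then show ?thesis
      using True finite_words by simp
  next
    case False
    then show ?thesis
      using assms by (simp add: supported_def tensor_coord_def)
  qed
  ultimately show ?thesis
    using that[of ?p] by (simp add: fib_def fun_eq_iff)
qed

abbreviation "T \<equiv> tensor_power scale d"
abbreviation "M \<equiv> free_module {xs :: 'v list. length xs = d}"

text \<open>The elements of the tensor power are the fibres of the coordinate map.\<close>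

lemma coset_eq_fib:
  assumes "p \<in> LD"
  shows "Rel +>\<^bsub>M\<^esub> p = fib (tensor_coord p)"
proof
  show "Rel +>\<^bsub>M\<^esub> p \<subseteq> fib (tensor_coord p)"
  proof
    fix q assume "q \<in> Rel +>\<^bsub>M\<^esub> p"
    then obtain r where r: "r \<in> Rel" "q = r + p"
      by (auto simp: a_r_coset_def' free_module_def)
    then show "q \<in> fib (tensor_coord p)"
      using pm.subspace_add[OF subspace_LD, of r p] assms unfolding fib_def mem_Rel_iff
      by (simp add: tensor_coord_add fun_eq_iff)
  qed
  show "fib (tensor_coord p) \<subseteq> Rel +>\<^bsub>M\<^esub> p"
  proof
    fix q assume "q \<in> fib (tensor_coord p)"
    then have "q - p \<in> Rel"
      using assms pm.subspace_diff[OF subspace_LD, of q p]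
      by (simp add: fib_def mem_Rel_iff tensor_coord_diff fun_eq_iff)
    then show "q \<in> Rel +>\<^bsub>M\<^esub> p"
      by (auto simp: a_r_coset_def' free_module_def intro!: bexI[of _ "q - p"])
  qed
qed

lemma carrier_T: "carrier T = fib ` supported"
proof -
  have "carrier T = (\<Union>p\<in>carrier M. {Rel +>\<^bsub>M\<^esub> p})"
    by (simp add: tensor_power_def quotient_module_def A_RCOSETS_def')
  also have "carrier M = LD"
    by (simp add: free_module_def)
  also have "(\<Union>p\<in>LD. {Rel +>\<^bsub>M\<^esub> p}) = (\<lambda>p. fib (tensor_coord p)) ` LD"
    using coset_eq_fib by auto
  finally have "carrier T = (\<lambda>p. fib (tensor_coord p)) ` LD" .
  then show ?thesis
    using tensor_coord_supported by (force elim!: fib_nonempty simp: fib_def)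
qed

lemma add_T:
  assumes "g \<in> supported" "h \<in> supported"
  shows "fib g \<oplus>\<^bsub>T\<^esub> fib h = fib (\<lambda>w. g w + h w)"
proof -
  have "fib g \<oplus>\<^bsub>T\<^esub> fib h = (\<Union>p\<in>fib g. \<Union>q\<in>fib h. {p + q})"
    by (simp add: tensor_power_def quotient_module_def set_add_def' free_module_def)
  also have "\<dots> = fib (\<lambda>w. g w + h w)"
  proof
    show "(\<Union>p\<in>fib g. \<Union>q\<in>fib h. {p + q}) \<subseteq> fib (\<lambda>w. g w + h w)"
      using pm.subspace_add[OF subspace_LD] by (auto simp: fib_def tensor_coord_add fun_eq_iff)
    show "fib (\<lambda>w. g w + h w) \<subseteq> (\<Union>p\<in>fib g. \<Union>q\<in>fib h. {p + q})"
    proof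
      fix r assume r: "r \<in> fib (\<lambda>w. g w + h w)"
      obtain p where p: "p \<in> fib g"
        using fib_nonempty[OF assms(1)] .
      have "r - p \<in> fib h"
        using r p pm.subspace_diff[OF subspace_LD, of r p] by (auto simp: fib_def tensor_coord_diff)
      then show "r \<in> (\<Union>p\<in>fib g. \<Union>q\<in>fib h. {p + q})"
        using p by (intro UN_I[of p] UN_I[of "r - p"]) auto
    qed
  qed
  finally show ?thesis .
qed

lemma smult_T:
  assumes "g \<in> supported"
  shows "c \<odot>\<^bsub>T\<^esub> fib g = fib (\<lambda>w. c * g w)"
proof -
  have "c \<odot>\<^bsub>T\<^esub> fib g = (\<Union>p\<in>fib g. Rel +>\<^bsub>M\<^esub> pm_scale c p)"
    by (simp add: tensor_power_def quotient_module_def rcoset_smult_def free_module_def)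
  also have "\<dots> = (\<Union>p\<in>fib g. fib (\<lambda>w. c * g w))"
    using pm.subspace_scale[OF subspace_LD]
    by (intro SUP_cong refl, subst coset_eq_fib) (auto simp: fib_def tensor_coord_scale fun_eq_iff)
  also have "\<dots> = fib (\<lambda>w. c * g w)"
    using fib_nonempty[OF assms] by blast
  finally show ?thesis .
qed

lemma fib_inj: "g \<in> supported \<Longrightarrow> fib g = fib h \<Longrightarrow> g = h"
  by (erule fib_nonempty) (auto simp: fib_def)

section \<open>Place permutations in coordinates\<close>

lemma free_place_perm_superset:
  assumes "finite S" "Poly_Mapping.keys p \<subseteq> S"
  shows "free_place_perm \<sigma> p = (\<Sum>xs\<in>S. Poly_Mapping.single (permute_list \<sigma> xs) (Poly_Mapping.lookup p xs))"
  unfolding free_place_perm_def using assms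
  by (intro sum.mono_neutral_left) (auto simp: in_keys_iff)

lemma free_place_perm_add: "free_place_perm \<sigma> (p + q) = free_place_perm \<sigma> p + free_place_perm \<sigma> (q :: 'v list \<Rightarrow>\<^sub>0 rat)"
proof -
  let ?A = "Poly_Mapping.keys p \<union> Poly_Mapping.keys q"
  show ?thesis
    using free_place_perm_superset[of ?A "p + q"] free_place_perm_superset[of ?A p]
      free_place_perm_superset[of ?A q] Poly_Mapping.keys_add[of p q]
    by (simp add: lookup_add single_add sum.distrib)
qed

lemma free_place_perm_sum: "free_place_perm \<sigma> (\<Sum>a\<in>S. P a :: 'v list \<Rightarrow>\<^sub>0 rat) = (\<Sum>a\<in>S. free_place_perm \<sigma> (P a))"
  by (induction S rule: infinite_finite_induct) (simp_all add: free_place_perm_add, simp_all add: free_place_perm_def)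

lemma free_place_perm_single:
  "free_place_perm \<sigma> (Poly_Mapping.single (xs :: 'v list) (c :: rat)) = Poly_Mapping.single (permute_list \<sigma> xs) c"
  by (simp add: free_place_perm_def)

lemma free_place_perm_inv:
  assumes "\<sigma> permutes {..<d}" "p \<in> LD"
  shows "free_place_perm \<sigma> (free_place_perm (inv_into UNIV \<sigma>) p) = p"
proof -
  have "permute_list \<sigma> (permute_list (inv_into UNIV \<sigma>) xs) = xs" if "length xs = d" for xs :: "'v list"
    using that assms(1) permute_list_compose[of \<sigma> xs "inv_into UNIV \<sigma>"] permutes_inv_o(2)[OF assms(1)] by simp
  then have "free_place_perm \<sigma> (free_place_perm (inv_into UNIV \<sigma>) p) =
      (\<Sum>xs\<in>Poly_Mapping.keys p. Poly_Mapping.single xs (Poly_Mapping.lookup p xs))"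
    unfolding free_place_perm_def[of "inv_into UNIV \<sigma>"] free_place_perm_sum free_place_perm_single
    using assms(2) by (intro sum.cong) auto
  then show ?thesis
    by (simp only: sum_single[symmetric])
qed

text \<open>\<open>lcoord\<close> does not change when the word and the vectors are permuted
  together, so permuting the vectors alone amounts to permuting the word by the inverse.\<close>

lemma free_place_perm_fib:
  assumes "\<sigma> permutes {..<d}" "p \<in> fib g"
  shows "free_place_perm \<sigma> p \<in> fib (\<lambda>w. g (permute_list (inv_into UNIV \<sigma>) w))"
proof -
  have p: "p \<in> LD" "tensor_coord p = g"
    using assms by (simp_all add: fib_def)
  have \<sigma>': "inv_into UNIV \<sigma> permutes {..<d}"
    using assms(1) by (rule permutes_inv)
  have "free_place_perm \<sigma> p \<in> LD"
    unfolding free_place_perm_def using p(1)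
    by (intro pm.subspace_sum[OF subspace_LD] single_LD) auto
  moreover have "tensor_coord (free_place_perm \<sigma> p) w = g (permute_list (inv_into UNIV \<sigma>) w)" for w
  proof (cases "length w = d")
    case True
    have words: "permute_list (inv_into UNIV \<sigma>) w \<in> words n d \<longleftrightarrow> w \<in> words n d"
      using True \<sigma>' by (simp add: words_def)
    have perm: "permute_list \<sigma> (permute_list (inv_into UNIV \<sigma>) w) = w"
      using True assms(1) permute_list_compose[of \<sigma> w "inv_into UNIV \<sigma>"] permutes_inv_o(2)[OF assms(1)] by simp
    have "lcoord w (permute_list \<sigma> xs) = lcoord (permute_list (inv_into UNIV \<sigma>) w) xs" if "length xs = d" for xs
      using lcoord_permute[of \<sigma> "permute_list (inv_into UNIV \<sigma>) w" xs] that True assms(1) perm by simp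
    moreover have "length xs = d" if "xs \<in> Poly_Mapping.keys p" for xs
      using p(1) that by auto
    ultimately have "(\<Sum>xs\<in>Poly_Mapping.keys p. Poly_Mapping.lookup p xs * lcoord w (permute_list \<sigma> xs)) =
        (\<Sum>xs\<in>Poly_Mapping.keys p. Poly_Mapping.lookup p xs * lcoord (permute_list (inv_into UNIV \<sigma>) w) xs)"
      by (intro sum.cong) auto
    moreover have "tensor_coord (free_place_perm \<sigma> p) w = (if w \<in> words n d then
        \<Sum>xs\<in>Poly_Mapping.keys p. Poly_Mapping.lookup p xs * lcoord w (permute_list \<sigma> xs) else 0)"
      unfolding free_place_perm_def tensor_coord_sum tensor_coord_single by simp
    ultimately show ?thesis
      unfolding p(2)[symmetric] tensor_coord_def[of p] words by simp
  next
    case False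
    then show ?thesis
      using p(2) by (auto simp: tensor_coord_def words_def)
  qed
  ultimately show ?thesis
    by (simp add: fib_def fun_eq_iff)
qed

text \<open>As \<open>place_perm\<close> is a mere image of a set, one inclusion is not enough;
  applying the inverse permutation shows that the image fills the fibre.\<close>

lemma place_perm_fib:
  assumes "\<sigma> permutes {..<d}" "g \<in> supported"
  shows "place_perm \<sigma> (fib g) = fib (\<lambda>w. g (permute_list (inv_into UNIV \<sigma>) w))"
proof
  show "place_perm \<sigma> (fib g) \<subseteq> fib (\<lambda>w. g (permute_list (inv_into UNIV \<sigma>) w))"
    using free_place_perm_fib[OF assms(1)] by (auto simp: place_perm_def)
  show "fib (\<lambda>w. g (permute_list (inv_into UNIV \<sigma>) w)) \<subseteq> place_perm \<sigma> (fib g)"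
  proof
    fix q assume q: "q \<in> fib (\<lambda>w. g (permute_list (inv_into UNIV \<sigma>) w))"
    have "g (permute_list (inv_into UNIV \<sigma>) (permute_list \<sigma> w)) = g w" for w
    proof (cases "length w = d")
      case True
      then show ?thesis
        using permute_list_compose[of "inv_into UNIV \<sigma>" w \<sigma>] permutes_inv_o(1)[OF assms(1)] assms(1)
          permutes_inv[OF assms(1)] by simp
    next
      case False
      then have "w \<notin> words n d" "permute_list (inv_into UNIV \<sigma>) (permute_list \<sigma> w) \<notin> words n d"
        by (auto simp: words_def)
      then show ?thesis
        using assms(2) by (simp add: supported_def)
    qed
    then have "free_place_perm (inv_into UNIV \<sigma>) q \<in> fib g"
      using free_place_perm_fib[OF permutes_inv[OF assms(1)] q] permutes_inv_inv[OF assms(1)] by simp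
    moreover have "q = free_place_perm \<sigma> (free_place_perm (inv_into UNIV \<sigma>) q)"
      using free_place_perm_inv[OF assms(1)] q by (simp add: fib_def)
    ultimately show "q \<in> place_perm \<sigma> (fib g)"
      unfolding place_perm_def by blast
  qed
qed

end

section \<open>The isomorphism\<close>

text \<open>In this form all places play the same role, so the sum can be reindexed along a
  permutation.\<close>

lemma unit_act_index:
  "unit_act i j g w = (\<Sum>k<length w. if w ! k = i then g (w[k := j]) else 0)"
  by (induction w arbitrary: g) (simp_all add: sum.lessThan_Suc_shift del: sum.lessThan_Suc cong: if_cong)

lemma permute_list_update:
  assumes "\<tau> permutes {..<length w}" "k < length w"
  shows "(permute_list \<tau> w)[k := x] = permute_list \<tau> (w[\<tau> k := x])"
proof (rule nth_equalityI)
  fix m assume "m < length ((permute_list \<tau> w)[k := x])"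
  then have m: "m < length w" "\<tau> m < length w"
    using permutes_in_image[OF assms(1), of m] by simp_all
  have "\<tau> m = \<tau> k \<longleftrightarrow> m = k"
    using permutes_inj[OF assms(1)] by (auto simp: inj_eq)
  then show "(permute_list \<tau> w)[k := x] ! m = permute_list \<tau> (w[\<tau> k := x]) ! m"
    using m assms permutes_in_image[OF assms(1), of k]
    by (cases "m = k") (simp_all add: permute_list_nth)
qed simp

lemma unit_act_permute:
  assumes "\<tau> permutes {..<length w}" "\<And>v. length v = length w \<Longrightarrow> g' v = g (permute_list \<tau> v)"
  shows "unit_act i j g' w = unit_act i j g (permute_list \<tau> w)"
proof -
  let ?F = "\<lambda>k. if w ! k = i then g (permute_list \<tau> (w[k := j])) else 0"
  have "unit_act i j g' w = (\<Sum>k<length w. ?F k)"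
    unfolding unit_act_index using assms(2) by (intro sum.cong) auto
  also have "\<dots> = (\<Sum>k<length w. ?F (\<tau> k))"
    using sum.permute[OF assms(1), of ?F] by (simp add: comp_def)
  also have "\<dots> = unit_act i j g (permute_list \<tau> w)"
    unfolding unit_act_index using assms(1)
    by (intro sum.cong) (auto simp: permute_list_nth permute_list_update)
  finally show ?thesis .
qed

lemma word_act_permute:
  assumes "\<tau> permutes {..<length w}" "\<And>v. length v = length w \<Longrightarrow> g' v = g (permute_list \<tau> v)"
  shows "word_act xs g' w = word_act xs g (permute_list \<tau> w)"
  using assms(1,2)
proof (induction xs arbitrary: w)
  case (Cons x xs)
  obtain i j where "letter_act x = unit_act i j"
    by (cases x) auto
  moreover have "unit_act i j (word_act xs g') w = unit_act i j (word_act xs g) (permute_list \<tau> w)"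
    by (rule unit_act_permute) (use Cons in simp_all)
  ultimately show ?case by simp
qed simp

lemma free_act_permute:
  assumes "\<tau> permutes {..<length w}" "\<And>v. length v = length w \<Longrightarrow> g' v = g (permute_list \<tau> v)"
  shows "free_act p g' w = free_act p g (permute_list \<tau> w)"
  unfolding free_act_def using word_act_permute[of \<tau> w g' g] assms by simp

locale schur_isomorphism = coordinates scale n d b coord + pres: schur_presentation n d
  for scale :: "rat \<Rightarrow> 'v::ab_group_add \<Rightarrow> 'v" and n d b coord
begin

abbreviation "A \<equiv> free_algebra (schur_generators n)"
abbreviation "J \<equiv> Idl\<^bsub>A\<^esub> (schur_relations n d)"
abbreviation "S \<equiv> schur_algebra scale d"
abbreviation "Q \<equiv> presented_algebra (schur_generators n) (schur_relations n d)"

text \<open>Coordinates are constant on a fibre, so the choice of a representative does not matter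
  for elements of the tensor power.\<close>

definition unfib :: "('v list \<Rightarrow>\<^sub>0 rat) set \<Rightarrow> nat list \<Rightarrow> rat"
  where "unfib t = tensor_coord (SOME p. p \<in> t)"

lemma unfib_fib [simp]: "g \<in> supported \<Longrightarrow> unfib (fib g) = g"
  using fib_nonempty[of g] someI_ex[of "\<lambda>p. p \<in> fib g"] by (auto simp: unfib_def fib_def)

lemma unfib_supported: "unfib t \<in> supported"
  by (simp add: unfib_def tensor_coord_supported)

lemma fib_unfib [simp]: "t \<in> carrier T \<Longrightarrow> fib (unfib t) = t"
  by (auto simp: carrier_T)

lemma fib_carrier [simp]: "g \<in> supported \<Longrightarrow> fib g \<in> carrier T"
  by (simp add: carrier_T)

text \<open>For \<open>p\<close> outside the free algebra on the admissible generators, indices out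
  of range can produce values off \<open>words n d\<close>. Cutting these off makes
  \<open>rho p\<close> an endomorphism for every \<open>p\<close>.\<close>

definition restr :: "(nat list \<Rightarrow> rat) \<Rightarrow> nat list \<Rightarrow> rat"
  where "restr g w = (if w \<in> words n d then g w else 0)"

lemma restr_supported [simp]: "restr g \<in> supported"
  by (simp add: restr_def supported_def)

lemma restr_id [simp]: "g \<in> supported \<Longrightarrow> restr g = g"
  by (auto simp: restr_def supported_def fun_eq_iff)

lemma supported_add: "g \<in> supported \<Longrightarrow> h \<in> supported \<Longrightarrow> (\<lambda>w. g w + h w) \<in> supported"
  and supported_scale: "g \<in> supported \<Longrightarrow> (\<lambda>w. c * g w) \<in> supported"
  by (simp_all add: supported_def)

definition rho :: "(generator word \<Rightarrow>\<^sub>0 rat) \<Rightarrow> ('v list \<Rightarrow>\<^sub>0 rat) set \<Rightarrow> ('v list \<Rightarrow>\<^sub>0 rat) set"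
  where "rho p = (\<lambda>t\<in>carrier T. fib (restr (free_act p (unfib t))))"

lemma rho_fib [simp]: "g \<in> supported \<Longrightarrow> rho p (fib g) = fib (restr (free_act p g))"
  by (simp add: rho_def)

lemma S_simps:
  "carrier S = {f \<in> linear_endos T. \<forall>\<sigma>. \<sigma> permutes {..<d} \<longrightarrow>
     (\<forall>t \<in> carrier T. f (place_perm \<sigma> t) = place_perm \<sigma> (f t))}"
  "monoid.mult S = compose (carrier T)" "one S = (\<lambda>t\<in>carrier T. t)"
  "add S = (\<lambda>f g. \<lambda>t\<in>carrier T. f t \<oplus>\<^bsub>T\<^esub> g t)"
  "smult S = (\<lambda>c f. \<lambda>t\<in>carrier T. c \<odot>\<^bsub>T\<^esub> f t)"
  by (simp_all add: schur_algebra_def Let_def)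

lemma extensional_T_eqI:
  assumes "f \<in> extensional (carrier T)" "h \<in> extensional (carrier T)"
    "\<And>g. g \<in> supported \<Longrightarrow> f (fib g) = h (fib g)"
  shows "f = h"
  using assms by (intro extensionalityI[of f "carrier T" h]) (auto simp: carrier_T)

lemma rho_extensional [simp]: "rho p \<in> extensional (carrier T)"
  by (simp add: rho_def)

lemma permute_supported:
  assumes "\<sigma> permutes {..<d}" "g \<in> supported"
  shows "(\<lambda>w. g (permute_list \<sigma> w)) \<in> supported"
proof -
  have "w \<in> words n d" if "permute_list \<sigma> w \<in> words n d" for w
    using that assms(1) by (auto simp: words_def)
  then show ?thesis
    using assms(2) by (auto simp: supported_def)
qed

lemma rho_closed: "rho p \<in> carrier S"
proof -
  have "rho p (place_perm \<sigma> t) = place_perm \<sigma> (rho p t)"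
    if \<sigma>: "\<sigma> permutes {..<d}" and t: "t \<in> carrier T" for \<sigma> t
  proof -
    obtain g where g: "g \<in> supported" "t = fib g"
      using t by (auto simp: carrier_T)
    let ?\<tau> = "inv_into UNIV \<sigma>"
    have \<tau>: "?\<tau> permutes {..<d}"
      using \<sigma> by (rule permutes_inv)
    have "restr (free_act p (\<lambda>w. g (permute_list ?\<tau> w))) w = restr (free_act p g) (permute_list ?\<tau> w)" for w
    proof (cases "length w = d")
      case True
      then show ?thesis
        using free_act_permute[of ?\<tau> w "\<lambda>w. g (permute_list ?\<tau> w)" g p] \<tau>
        by (simp add: restr_def words_def)
    next
      case False
      then show ?thesis by (simp add: restr_def words_def)
    qed
    then have "restr (free_act p (\<lambda>w. g (permute_list ?\<tau> w))) = (\<lambda>w. restr (free_act p g) (permute_list ?\<tau> w))" ..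
    then show ?thesis
      using g place_perm_fib[OF \<sigma>] permute_supported[OF \<tau> g(1)] by simp
  qed
  moreover have "rho p \<in> linear_endos T"
  proof -
    have add: "rho p (fib g \<oplus>\<^bsub>T\<^esub> fib h) = rho p (fib g) \<oplus>\<^bsub>T\<^esub> rho p (fib h)"
      if "g \<in> supported" "h \<in> supported" for g h
    proof -
      have "restr (free_act p (\<lambda>w. g w + h w)) = (\<lambda>w. restr (free_act p g) w + restr (free_act p h) w)"
        by (simp add: restr_def fun_eq_iff)
      then show ?thesis
        using that by (simp add: add_T supported_add)
    qed
    have smult: "rho p (c \<odot>\<^bsub>T\<^esub> fib g) = c \<odot>\<^bsub>T\<^esub> rho p (fib g)" if "g \<in> supported" for c g
    proof -
      have "restr (free_act p (\<lambda>w. c * g w)) = (\<lambda>w. c * restr (free_act p g) w)"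
        by (simp add: restr_def fun_eq_iff)
      then show ?thesis
        using that by (simp add: smult_T supported_scale)
    qed
    have "rho p \<in> carrier T \<rightarrow>\<^sub>E carrier T"
      by (auto simp: rho_def)
    then show ?thesis
      using add smult by (auto simp: linear_endos_def carrier_T)
  qed
  ultimately show ?thesis
    by (simp add: S_simps)
qed

lemma rho_add: "rho (p + q) = rho p \<oplus>\<^bsub>S\<^esub> rho q"
proof (rule extensional_T_eqI)
  fix g assume g: "g \<in> supported"
  have "restr (free_act (p + q) g) = (\<lambda>w. restr (free_act p g) w + restr (free_act q g) w)"
    by (simp add: restr_def fun_eq_iff)
  then show "rho (p + q) (fib g) = (rho p \<oplus>\<^bsub>S\<^esub> rho q) (fib g)"
    using g by (simp add: S_simps add_T)
qed (simp_all add: S_simps)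

lemma rho_scale: "rho (pm_scale c p) = c \<odot>\<^bsub>S\<^esub> rho p"
proof (rule extensional_T_eqI)
  fix g assume g: "g \<in> supported"
  have "restr (free_act (pm_scale c p) g) = (\<lambda>w. c * restr (free_act p g) w)"
    by (simp add: restr_def fun_eq_iff)
  then show "rho (pm_scale c p) (fib g) = (c \<odot>\<^bsub>S\<^esub> rho p) (fib g)"
    using g by (simp add: S_simps smult_T)
qed (simp_all add: S_simps)

text \<open>For \<open>p\<close> in the carrier only values on \<open>words n d\<close> are read, so
  the truncation between the two actions is invisible.\<close>

lemma rho_mult:
  assumes "p \<in> carrier A"
  shows "rho (p * q) = rho p \<otimes>\<^bsub>S\<^esub> rho q"
proof (rule extensional_T_eqI)
  fix g assume g: "g \<in> supported"
  have "restr (free_act (p * q) g) = restr (free_act p (restr (free_act q g)))"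
    using free_act_cong[OF assms, of d "free_act q g" "restr (free_act q g)"]
    by (auto simp: restr_def fun_eq_iff)
  then show "rho (p * q) (fib g) = (rho p \<otimes>\<^bsub>S\<^esub> rho q) (fib g)"
    using g by (simp add: S_simps compose_def)
qed (simp_all add: S_simps)

lemma rho_one: "rho 1 = \<one>\<^bsub>S\<^esub>"
  by (rule extensional_T_eqI) (simp_all add: S_simps)

text \<open>This is \<open>J_eq_kernel\<close> in other terms. The kernel tests all functions
  whereas \<open>rho\<close> sees only supported ones, but truncation does not affect the values at
  words in \<open>words n d\<close>.\<close>

lemma rho_eq_iff:
  assumes "p \<in> carrier A" "q \<in> carrier A"
  shows "rho p = rho q \<longleftrightarrow> p - q \<in> J"
proof
  assume "rho p = rho q"
  then have eq: "restr (free_act p g) = restr (free_act q g)" if "g \<in> supported" for g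
    using that rho_fib fib_inj[of "restr (free_act p g)"] by (metis restr_supported)
  have "free_act (p - q) g w = 0" if w: "w \<in> words n d" for g w
  proof -
    have "free_act r g w = free_act r (restr g) w" if "r \<in> carrier A" for r
      by (rule free_act_cong[OF that _ w]) (simp add: restr_def)
    then show ?thesis
      using fun_cong[OF eq[of "restr g"], of w] w assms by (simp add: restr_def)
  qed
  then show "p - q \<in> J"
    using assms by (simp add: pres.J_eq_kernel pres.kernel_def free_carrier_diff)
next
  assume "p - q \<in> J"
  then have "free_act p g w = free_act q g w" if "w \<in> words n d" for g w
    using that by (simp add: pres.J_eq_kernel pres.kernel_def)
  then have "restr (free_act p g) = restr (free_act q g)" for g
    by (simp add: restr_def fun_eq_iff)
  then show "rho p = rho q"
    by (simp add: rho_def)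
qed

text \<open>The matrix entries of an endomorphism commuting with place permutations are invariant
  when both words are permuted simultaneously, so \<open>exists_free_act\<close> realises
  them.\<close>

lemma rho_surj:
  assumes f: "f \<in> carrier S"
  obtains p where "p \<in> carrier A" "rho p = f"
proof -
  have f_lin: "f \<in> carrier T \<rightarrow>\<^sub>E carrier T"
    "\<And>x y. x \<in> carrier T \<Longrightarrow> y \<in> carrier T \<Longrightarrow> f (x \<oplus>\<^bsub>T\<^esub> y) = f x \<oplus>\<^bsub>T\<^esub> f y"
    "\<And>c x. x \<in> carrier T \<Longrightarrow> f (c \<odot>\<^bsub>T\<^esub> x) = c \<odot>\<^bsub>T\<^esub> f x"
    and f_perm: "\<And>\<sigma> t. \<sigma> permutes {..<d} \<Longrightarrow> t \<in> carrier T \<Longrightarrow> f (place_perm \<sigma> t) = place_perm \<sigma> (f t)"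
    using f by (auto simp: S_simps linear_endos_def)
  define O' where "O' g = unfib (f (fib g))" for g
  have f_fib: "f (fib g) = fib (O' g)" if "g \<in> supported" for g
    using f_lin(1) that by (auto simp: O'_def PiE_iff)
  have O'_supp: "O' g \<in> supported" for g
    by (simp add: O'_def unfib_supported)
  have O'_add: "O' (\<lambda>w. g w + h w) = (\<lambda>w. O' g w + O' h w)" if "g \<in> supported" "h \<in> supported" for g h
  proof -
    have "f (fib (\<lambda>w. g w + h w)) = fib (\<lambda>w. O' g w + O' h w)"
      using f_lin(2)[of "fib g" "fib h"] that by (simp add: add_T f_fib O'_supp)
    then show ?thesis
      using O'_supp by (simp add: O'_def[of "\<lambda>w. g w + h w"] supported_add)
  qed
  have O'_scale: "O' (\<lambda>w. c * g w) = (\<lambda>w. c * O' g w)" if "g \<in> supported" for g c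
  proof -
    have "f (fib (\<lambda>w. c * g w)) = fib (\<lambda>w. c * O' g w)"
      using f_lin(3)[of "fib g" c] that by (simp add: smult_T f_fib O'_supp)
    then show ?thesis
      using O'_supp by (simp add: O'_def[of "\<lambda>w. c * g w"] supported_scale)
  qed
  have O'_sum: "O' (\<lambda>w. \<Sum>v\<in>V. a v * delta v w) = (\<lambda>w. \<Sum>v\<in>V. a v * O' (delta v) w)"
    if "finite V" "V \<subseteq> words n d" for V and a :: "nat list \<Rightarrow> rat"
  proof -
    have delta: "delta v \<in> supported" if "v \<in> words n d" for v
      using that by (auto simp: supported_def delta_def)
    have "(\<lambda>w. \<Sum>v\<in>V. a v * delta v w) \<in> supported \<and>
        O' (\<lambda>w. \<Sum>v\<in>V. a v * delta v w) = (\<lambda>w. \<Sum>v\<in>V. a v * O' (delta v) w)"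
      using that
    proof (induction V rule: finite_induct)
      case empty
      have "(\<lambda>_. 0) \<in> supported"
        by (simp add: supported_def)
      then show ?case
        using O'_scale[of "\<lambda>_. 0" 0] by simp
    next
      case (insert v V)
      then show ?case
        using supported_add[OF supported_scale[OF delta, of v "a v"]]
          O'_add[OF supported_scale[OF delta, of v "a v"]] O'_scale[OF delta, of v "a v"] by simp
    qed
    then show ?thesis ..
  qed
  have "O' (delta v) w = O' (delta v') w'"
    if wv: "w \<in> words n d" "v \<in> words n d" "w' \<in> words n d" "v' \<in> words n d"
      "mset (zip w v) = mset (zip w' v')" for w v w' v'
  proof -
    have len: "length w = d" "length v = d" "length w' = d" "length v' = d"
      using wv by (auto simp: words_def)
    \<comment> \<open>Equal multisets of letter pairs mean that a single permutation carries
      \<open>w\<close> to \<open>w'\<close> and \<open>v\<close> to \<open>v'\<close>.\<close>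
    obtain \<sigma> where \<sigma>: "\<sigma> permutes {..<length (zip w v)}" "permute_list \<sigma> (zip w v) = zip w' v'"
      using wv(5) mset_eq_permutation[of "zip w' v'" "zip w v"] by metis
    have \<sigma>': "\<sigma> permutes {..<d}"
      using \<sigma>(1) len by simp
    have zip: "zip (permute_list \<sigma> w) (permute_list \<sigma> v) = zip w' v'"
      using \<sigma>(2) permute_list_zip[OF \<sigma>', of w v] len by simp
    have w': "w' = permute_list \<sigma> w" and v': "v' = permute_list \<sigma> v"
      using arg_cong[OF zip, of "map fst"] arg_cong[OF zip, of "map snd"] len by simp_all
    let ?\<tau> = "inv_into UNIV \<sigma>"
    have inv1: "permute_list ?\<tau> (permute_list \<sigma> u) = u" if "length u = d" for u :: "nat list"
      using that \<sigma>' permute_list_compose[of ?\<tau> u \<sigma>] permute_list_compose[of \<sigma> u ?\<tau>] permutes_inv[OF \<sigma>']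
        permutes_inv_o[OF \<sigma>'] by simp
    have inv2: "permute_list \<sigma> (permute_list ?\<tau> u) = u" if "length u = d" for u :: "nat list"
      using that \<sigma>' permute_list_compose[of ?\<tau> u \<sigma>] permute_list_compose[of \<sigma> u ?\<tau>] permutes_inv[OF \<sigma>']
        permutes_inv_o[OF \<sigma>'] by simp
    have dv: "delta v \<in> supported"
      using wv by (auto simp: supported_def delta_def)
    have "(\<lambda>u. delta v (permute_list ?\<tau> u)) = delta v'"
    proof
      fix u
      show "delta v (permute_list ?\<tau> u) = delta v' u"
        using inv1[OF len(2)] inv2[of u] len v' by (auto simp: delta_def)
    qed
    then have "fib (O' (delta v')) = place_perm \<sigma> (fib (O' (delta v)))"
      using f_perm[OF \<sigma>', of "fib (delta v)"] dv place_perm_fib[OF \<sigma>' dv] f_fib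
        permute_supported[OF permutes_inv[OF \<sigma>'] dv] by simp
    also have "\<dots> = fib (\<lambda>u. O' (delta v) (permute_list ?\<tau> u))"
      by (rule place_perm_fib[OF \<sigma>' O'_supp])
    finally have "O' (delta v') = (\<lambda>u. O' (delta v) (permute_list ?\<tau> u))"
      by (rule fib_inj[OF O'_supp])
    then show ?thesis
      using inv1[OF len(1)] w' by simp
  qed
  then obtain p where p: "p \<in> carrier A"
    "\<And>w v. w \<in> words n d \<Longrightarrow> v \<in> words n d \<Longrightarrow> free_act p (delta v) w = O' (delta v) w"
    using pres.exists_free_act[of "\<lambda>w v. O' (delta v) w"] by blast
  have "rho p = f"
  proof (rule extensional_T_eqI)
    show "f \<in> extensional (carrier T)"
      using f_lin(1) by (simp add: PiE_iff)
    fix g assume g: "g \<in> supported"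
    have expand_g: "g = (\<lambda>w. \<Sum>v\<in>words n d. g v * delta v w)"
    proof
      fix w
      have "(\<Sum>v\<in>words n d. g v * delta v w) = (\<Sum>v\<in>words n d. if w = v then g v else 0)"
        by (rule sum.cong) (auto simp: delta_def)
      also have "\<dots> = g w"
        using g finite_words by (auto simp: supported_def)
      finally show "g w = (\<Sum>v\<in>words n d. g v * delta v w)" ..
    qed
    have "restr (free_act p g) w = O' g w" for w
    proof (cases "w \<in> words n d")
      case True
      have "free_act p g w = (\<Sum>v\<in>words n d. g v * free_act p (delta v) w)"
        by (subst expand_g) (simp add: free_act_fsum)
      also have "\<dots> = (\<Sum>v\<in>words n d. g v * O' (delta v) w)"
        using True p(2) by (intro sum.cong) auto
      also have "\<dots> = O' g w"
        by (subst (2) expand_g) (simp add: O'_sum finite_words)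
      finally show ?thesis
        using True by (simp add: restr_def)
    next
      case False
      then show ?thesis
        using O'_supp[of g] by (simp add: restr_def supported_def)
    qed
    then have "restr (free_act p g) = O' g" ..
    then show "rho p (fib g) = f (fib g)"
      using g f_fib by simp
  qed simp
  then show ?thesis
    using that p(1) by blast
qed

lemma schur_iso: "algebra_isomorphic S Q"
proof -
  \<comment> \<open>The inverse of the map induced by \<open>rho\<close>. Two preimages of
    \<open>f\<close> differ by an element of \<open>J\<close>, so the coset does not depend on the
    choice.\<close>
  define h where "h f = J +>\<^bsub>A\<^esub> (SOME p. p \<in> carrier A \<and> rho p = f)" for f
  note ideal = pres.ideal_J
  note qa = quotient_algebra_cosets[OF free_q_algebra ideal]
  have Q: "Q = quotient_algebra A J"
    by (simp add: presented_algebra_def)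
  have coset_eq: "J +>\<^bsub>A\<^esub> p = J +>\<^bsub>A\<^esub> q \<longleftrightarrow> p - q \<in> J" if "p \<in> carrier A" "q \<in> carrier A" for p q
    using pres.quot_eq_0_iff[of "p - q"] pres.quot_diff[OF that] free_carrier_diff[OF that]
      algebra_emb_hom(4)[OF quotient_q_algebra[OF free_q_algebra ideal], of "J +>\<^bsub>A\<^esub> p" "J +>\<^bsub>A\<^esub> q"] that
    by (auto simp: pres.quot_def A_RCOSETS_def')
  have h_rho: "h (rho p) = J +>\<^bsub>A\<^esub> p" if "p \<in> carrier A" for p
  proof -
    have "(SOME q. q \<in> carrier A \<and> rho q = rho p) \<in> carrier A \<and> rho (SOME q. q \<in> carrier A \<and> rho q = rho p) = rho p"
      by (rule someI[of _ p]) (simp add: that)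
    then show ?thesis
      unfolding h_def using coset_eq rho_eq_iff that by blast
  qed
  have car: "p + q \<in> carrier A" "p * q \<in> carrier A" "pm_scale c p \<in> carrier A" "1 \<in> carrier A"
    if "p \<in> carrier A" "q \<in> carrier A" for p q c
    using that by (simp_all add: free_carrier_add free_carrier_mult free_carrier_scale free_carrier_one)
  have closed: "h f \<in> carrier Q" if "f \<in> carrier S" for f
    by (rule rho_surj[OF that]) (auto simp: h_rho Q A_RCOSETS_def')
  have "h \<in> ring_iso S Q"
  proof (rule ring_iso_memI)
    show "h f \<in> carrier Q" if "f \<in> carrier S" for f
      using that by (rule closed)
  next
    fix f f' assume f: "f \<in> carrier S" "f' \<in> carrier S"
    obtain p where p: "p \<in> carrier A" "rho p = f"
      by (rule rho_surj[OF f(1)])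
    obtain q where q: "q \<in> carrier A" "rho q = f'"
      by (rule rho_surj[OF f(2)])
    show "h (f \<otimes>\<^bsub>S\<^esub> f') = h f \<otimes>\<^bsub>Q\<^esub> h f'"
      using p q car[OF p(1) q(1)] qa(2)[OF p(1) q(1)]
      unfolding Q p(2)[symmetric] q(2)[symmetric] by (simp add: rho_mult[symmetric] h_rho pres.free_ops del: quotient_algebra_simps)
    show "h (f \<oplus>\<^bsub>S\<^esub> f') = h f \<oplus>\<^bsub>Q\<^esub> h f'"
      using p q car[OF p(1) q(1)] qa(1)[OF p(1) q(1)]
      unfolding Q p(2)[symmetric] q(2)[symmetric] by (simp add: rho_add[symmetric] h_rho pres.free_ops del: quotient_algebra_simps)
  next
    show "h \<one>\<^bsub>S\<^esub> = \<one>\<^bsub>Q\<^esub>"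
      unfolding Q rho_one[symmetric] by (simp add: h_rho free_carrier_one pres.free_ops)
  next
    show "bij_betw h (carrier S) (carrier Q)"
      unfolding bij_betw_def
    proof
      show "inj_on h (carrier S)"
      proof (rule inj_onI)
        fix f f' assume f: "f \<in> carrier S" "f' \<in> carrier S" and eq: "h f = h f'"
        obtain p where p: "p \<in> carrier A" "rho p = f"
          by (rule rho_surj[OF f(1)])
        obtain q where q: "q \<in> carrier A" "rho q = f'"
          by (rule rho_surj[OF f(2)])
        show "f = f'"
          using eq p(1) q(1) unfolding p(2)[symmetric] q(2)[symmetric]
          by (simp add: h_rho coset_eq rho_eq_iff)
      qed
      show "h ` carrier S = carrier Q"
      proof
        show "h ` carrier S \<subseteq> carrier Q"
          using closed by blast
        show "carrier Q \<subseteq> h ` carrier S"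
        proof
          fix x assume "x \<in> carrier Q"
          then obtain p where "p \<in> carrier A" "x = J +>\<^bsub>A\<^esub> p"
            by (auto simp: Q A_RCOSETS_def')
          then show "x \<in> h ` carrier S"
            using h_rho rho_closed by (intro image_eqI[of _ _ "rho p"]) simp_all
        qed
      qed
    qed
  qed
  moreover have "h (c \<odot>\<^bsub>S\<^esub> f) = c \<odot>\<^bsub>Q\<^esub> h f" if f: "f \<in> carrier S" for c f
  proof -
    obtain p where p: "p \<in> carrier A" "rho p = f"
      by (rule rho_surj[OF f])
    then show ?thesis
      using car(3)[OF p(1) p(1), of c] qa(3)[OF p(1) p(1), of c]
      unfolding Q p(2)[symmetric] by (simp add: rho_scale[symmetric] h_rho pres.free_ops del: quotient_algebra_simps)
  qed
  ultimately show ?thesis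
    unfolding algebra_isomorphic_def by blast
qed

end

theorem theorem1p1:
  fixes scale :: "rat \<Rightarrow> 'v::ab_group_add \<Rightarrow> 'v"
    and n d :: nat
  assumes "n \<ge> 1"
    and "vector_space scale"
    and "vector_space.dim scale (UNIV :: 'v set) = n"
  shows "algebra_isomorphic (schur_algebra scale d)
           (presented_algebra (schur_generators n) (schur_relations n d))"
proof -
  interpret V: vector_space scale
    by fact
  obtain B where B: "V.independent B" "UNIV \<subseteq> V.span B" "card B = n"
    using V.basis_exists[of UNIV] assms(3) by metis
  \<comment> \<open>An infinite set has \<open>card\<close> 0, which \<open>n \<ge> 1\<close>
    excludes.\<close>
  have fin: "finite B"
    using B(3) assms(1) by (metis card.infinite not_one_le_zero)
  obtain b where b: "bij_betw b {1..n} B"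
    using fin B(3) finite_same_card_bij[of "{1..n}" B] by auto
  have span: "v \<in> V.span B" for v
    using B(2) by blast
  have "coordinates scale n b (\<lambda>i v. V.representation B v (b i))"
  proof
    fix i j u v c
    show "V.representation B (u + v) (b i) = V.representation B u (b i) + V.representation B v (b i)"
      using V.representation_add[OF B(1) span span, of u v] by simp
    show "V.representation B (scale c v) (b i) = c * V.representation B v (b i)"
      using V.representation_scale[OF B(1) span, of c v] by simp
    show "V.representation B (b j) (b i) = (if i = j then 1 else 0)" if "i \<in> {1..n}" "j \<in> {1..n}"
      using V.representation_basis[OF B(1), of "b j"] b that
      by (auto simp: bij_betw_def inj_on_eq_iff)
    have "(\<Sum>x\<in>B. scale (V.representation B v x) x) = v"
      using V.sum_representation_eq[OF B(1) span fin subset_refl] .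
    then show "v = (\<Sum>i=1..n. scale (V.representation B v (b i)) (b i))"
      using sum.reindex_bij_betw[OF b, of "\<lambda>x. scale (V.representation B v x) x"] by simp
  qed
  then interpret schur_isomorphism scale n d b "\<lambda>i v. V.representation B v (b i)"
    by (simp add: schur_isomorphism_def)
  show ?thesis
    by (rule schur_iso)
qed

end
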